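(* Let $n,m\ge1$, and let $G_{n,m}:=\ker\phi_{n,m}$, where $\phi_{n,m}:\mathbb F_{nm}\to\mathbb F_n\times\mathbb F_m$ is the group homomorphism with $\phi_{n,m}(g^{(nm)}_{m(i-1)+j})=(g^{(n)}_i,g^{(m)}_j)$ for $1\le i\le n$, $1\le j\le m$. (i) $\lambda_{\mathbb F_n}\otimes_\varphi\lambda_{\mathbb F_m}\cong(\lambda_{\mathbb F_{nm}/G_{n,m}})^{\oplus\infty}$ (unitary equivalence). (ii) If $n,m\ge2$, then $\lambda_{\mathbb F_{nm}/G_{n,m}}$ is a type II$_1$ factor representation.
   Context: $\mathbb F_n$ is the free group of rank $n$ with free generators $g^{(n)}_1,\dots,g^{(n)}_n$, and $\lambda_{\mathbb F_n}$ is its left regular representation on $\ell^2(\mathbb F_n)$. For a discrete group $\Gamma$ and a subgroup $\Gamma_0$, $\Gamma/\Gamma_0$ is the left coset space and the quasi-regular representation $\lambda_{\Gamma/\Gamma_0}$ is the unitary representation of $\Gamma$ on $\ell^2(\Gamma/\Gamma_0)$ given by the natural left action of $\Gamma$ on the standard basis. The symbol $\infty$ denotes countable infinity, so $\pi^{\oplus\infty}$ is the direct sum of countably infinitely many copies of $\pi$. A unitary representation $U$ of a group $G$ is a type II$_1$ factor representation if the von Neumann algebra $U(G)''$ is a factor (has trivial center) of type II$_1$. For unitary representations $\pi$ of $\mathbb F_n$ and $\pi'$ of $\mathbb F_m$, $\pi\otimes_\varphi\pi'$ is the unitary representation of $\mathbb F_{nm}$ defined by $\pi\otimes_\varphi\pi':=(\pi\otimes\pi')\circ\varphi_{n,m}$,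 where $\varphi_{n,m}:C^*(\mathbb F_{nm})\to C^*(\mathbb F_n)\otimes C^*(\mathbb F_m)$ is the unital $*$-homomorphism of full group C$^*$-algebras (minimal tensor product) with $\varphi_{n,m}(g^{(nm)}_{m(i-1)+j})=g^{(n)}_i\otimes g^{(m)}_j$; that is, $(\pi\otimes_\varphi\pi')(g)=\pi(g')\otimes\pi'(g'')$ with $(g',g'')=\phi_{n,m}(g)$. *)

theory Defs
  imports "HOL-Analysis.Analysis" "HOL-Algebra.Left_Coset" "HOL-Algebra.Module"
begin

section \<open>Free groups of finite rank\<close>

text \<open>The letter \<open>(i, True)\<close> stands for the generator \<open>g\<^sub>i\<close>, the letter \<open>(i, False)\<close> for its inverse.\<close>

type_synonym letter = "nat \<times> bool"

fun inv_letter :: "letter \<Rightarrow> letter" where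
  "inv_letter (i, b) = (i, \<not> b)"

fun reduced_word :: "letter list \<Rightarrow> bool" where
  "reduced_word (a # b # w) \<longleftrightarrow> b \<noteq> inv_letter a \<and> reduced_word (b # w)"
| "reduced_word _ \<longleftrightarrow> True"

fun cancel_Cons :: "letter \<Rightarrow> letter list \<Rightarrow> letter list" where
  "cancel_Cons a [] = [a]"
| "cancel_Cons a (b # w) = (if b = inv_letter a then w else a # b # w)"

definition free_group :: "nat \<Rightarrow> letter list monoid" where
  "free_group n =
     \<lparr>carrier = {w. set w \<subseteq> {1..n} \<times> UNIV \<and> reduced_word w},
      mult = \<lambda>u v. foldr cancel_Cons u v,
      one = []\<rparr>"

definition free_gen :: "nat \<Rightarrow> letter list" where
  "free_gen i = [(i, True)]"


lemma inv_letter_inv [simp]: "inv_letter (inv_letter a) = a"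
  by (cases a) auto

lemma fst_inv_letter [simp]: "fst (inv_letter a) = fst a"
  by (cases a) auto

lemma inv_letter_neq [simp]: "inv_letter a \<noteq> a" "a \<noteq> inv_letter a"
  by (cases a; auto)+

lemma reduced_ConsD: "reduced_word (a # w) \<Longrightarrow> reduced_word w"
  by (cases w) auto

lemma reduced_cancel_Cons: "reduced_word w \<Longrightarrow> reduced_word (cancel_Cons a w)"
  by (cases w) (auto dest: reduced_ConsD)

lemma reduced_foldr: "reduced_word w \<Longrightarrow> reduced_word (foldr cancel_Cons u w)"
  by (induction u) (auto intro: reduced_cancel_Cons)

lemma cancel_Cons_reduced: "reduced_word (a # w) \<Longrightarrow> cancel_Cons a w = a # w"
  by (cases w) auto

lemma cancel_Cons_cancel: "reduced_word w \<Longrightarrow> cancel_Cons a (cancel_Cons (inv_letter a) w) = w"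
  by (cases w) (auto simp: cancel_Cons_reduced)

lemma foldr_cancel_Cons_left:
  assumes "reduced_word x" "reduced_word w"
  shows "foldr cancel_Cons (cancel_Cons a x) w = cancel_Cons a (foldr cancel_Cons x w)"
proof (cases x)
  case (Cons b y)
  have "cancel_Cons a (cancel_Cons (inv_letter a) (foldr cancel_Cons y w)) = foldr cancel_Cons y w"
    by (rule cancel_Cons_cancel) (simp add: reduced_foldr assms)
  then show ?thesis using Cons by auto
qed simp

lemma foldr_cancel_Cons_assoc:
  assumes "reduced_word v" "reduced_word w"
  shows "foldr cancel_Cons (foldr cancel_Cons u v) w = foldr cancel_Cons u (foldr cancel_Cons v w)"
  by (induction u) (simp_all add: foldr_cancel_Cons_left reduced_foldr assms)

lemma foldr_cancel_Cons_Nil: "reduced_word u \<Longrightarrow> foldr cancel_Cons u [] = u"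
proof (induction u)
  case (Cons a u)
  then have "foldr cancel_Cons u [] = u" using reduced_ConsD by blast
  then show ?case using cancel_Cons_reduced[OF Cons.prems] by simp
qed simp

lemma set_cancel_Cons: "set (cancel_Cons a w) \<subseteq> insert a (set w)"
  by (cases w) auto

lemma set_foldr_cancel_Cons: "set (foldr cancel_Cons u w) \<subseteq> set u \<union> set w"
proof (induction u)
  case (Cons a u)
  then show ?case using set_cancel_Cons[of a "foldr cancel_Cons u w"] by auto
qed simp

lemma foldr_inverse:
  assumes "reduced_word v"
  shows "foldr cancel_Cons (rev (map inv_letter u)) (foldr cancel_Cons u v) = v"
proof (induction u)
  case (Cons a u)
  have "cancel_Cons (inv_letter a) (cancel_Cons (inv_letter (inv_letter a)) (foldr cancel_Cons u v))
      = foldr cancel_Cons u v"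
    by (rule cancel_Cons_cancel) (simp add: reduced_foldr assms)
  then show ?case using Cons by simp
qed (simp)

lemma reduced_append_iff:
  "reduced_word (u @ [a, b]) \<longleftrightarrow> reduced_word (u @ [a]) \<and> b \<noteq> inv_letter a"
  by (induction u rule: reduced_word.induct) auto

lemma reduced_rev: "reduced_word u \<Longrightarrow> reduced_word (rev (map inv_letter u))"
proof (induction u rule: reduced_word.induct)
  case (1 a b w)
  then show ?case by (auto simp: reduced_append_iff)
qed auto

theorem group_free_group: "group (free_group n)"
proof (rule groupI)
  fix x y assume "x \<in> carrier (free_group n)" "y \<in> carrier (free_group n)"
  then show "x \<otimes>\<^bsub>free_group n\<^esub> y \<in> carrier (free_group n)"
    using set_foldr_cancel_Cons[of x y] by (auto simp: free_group_def reduced_foldr)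
next
  fix x assume x: "x \<in> carrier (free_group n)"
  show "\<exists>y\<in>carrier (free_group n). y \<otimes>\<^bsub>free_group n\<^esub> x = \<one>\<^bsub>free_group n\<^esub>"
  proof (intro bexI)
    show "rev (map inv_letter x) \<otimes>\<^bsub>free_group n\<^esub> x = \<one>\<^bsub>free_group n\<^esub>"
      using x foldr_inverse[of "[]" x] by (simp add: free_group_def foldr_cancel_Cons_Nil)
    show "rev (map inv_letter x) \<in> carrier (free_group n)"
      using x by (force simp: free_group_def reduced_rev)
  qed
qed (auto simp: free_group_def foldr_cancel_Cons_assoc)

text \<open>The universal property of the free generators.\<close>

theorem free_group_universal:
  assumes "group G" and f: "\<And>i. i \<in> {1..n} \<Longrightarrow> f i \<in> carrier G"
  shows "\<exists>h \<in> hom (free_group n) G. (\<forall>i\<in>{1..n}. h (free_gen i) = f i)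
      \<and> (\<forall>h' \<in> hom (free_group n) G. (\<forall>i\<in>{1..n}. h' (free_gen i) = f i)
           \<longrightarrow> (\<forall>w\<in>carrier (free_group n). h' w = h w))"
proof -
  interpret group G by fact
  define F where "F = free_group n"
  interpret F: group F unfolding F_def by (rule group_free_group)
  define l where "l a = (if snd a then f (fst a) else inv\<^bsub>G\<^esub> f (fst a))" for a :: letter
  define h where "h w = foldr (\<lambda>a x. l a \<otimes>\<^bsub>G\<^esub> x) w \<one>\<^bsub>G\<^esub>" for w
  let ?L = "{1..n} \<times> (UNIV :: bool set)"
  have l: "l a \<in> carrier G" if "a \<in> ?L" for a
    using that by (auto simp: l_def f)
  have l_inv: "l a \<otimes>\<^bsub>G\<^esub> l (inv_letter a) = \<one>\<^bsub>G\<^esub>" if "a \<in> ?L" for a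
    using that by (cases a) (auto simp: l_def f)
  have h: "h w \<in> carrier G" if "set w \<subseteq> ?L" for w
    using that by (induction w) (auto simp: h_def l)
  have hc: "h (cancel_Cons a w) = l a \<otimes>\<^bsub>G\<^esub> h w" if "a \<in> ?L" "set w \<subseteq> ?L" for a w
  proof (cases w)
    case (Cons b v)
    have hv: "h v \<in> carrier G" using that Cons by (auto intro!: h)
    have "l a \<otimes>\<^bsub>G\<^esub> (l (inv_letter a) \<otimes>\<^bsub>G\<^esub> h v) = h v" if "b = inv_letter a"
    proof -
      have "l (inv_letter a) \<in> carrier G" using \<open>set w \<subseteq> ?L\<close> Cons that by (auto intro!: l)
      then show ?thesis using l_inv[OF \<open>a \<in> ?L\<close>] l[OF \<open>a \<in> ?L\<close>] hv by (simp flip: m_assoc)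
    qed
    then show ?thesis using Cons by (auto simp: h_def)
  qed (simp add: h_def)
  have hm: "h (foldr cancel_Cons u w) = h u \<otimes>\<^bsub>G\<^esub> h w" if "set u \<subseteq> ?L" "set w \<subseteq> ?L" for u w
    using that(1)
  proof (induction u)
    case Nil then show ?case using h[OF that(2)] by (simp add: h_def)
  next
    case (Cons a u)
    have "h (cancel_Cons a (foldr cancel_Cons u w)) = l a \<otimes>\<^bsub>G\<^esub> h (foldr cancel_Cons u w)"
      using Cons.prems that(2) set_foldr_cancel_Cons[of u w] by (intro hc) auto
    also have "\<dots> = l a \<otimes>\<^bsub>G\<^esub> (h u \<otimes>\<^bsub>G\<^esub> h w)" using Cons by simp
    also have "\<dots> = h (a # u) \<otimes>\<^bsub>G\<^esub> h w"
      using Cons.prems l[of a] h[of u] h[OF that(2)] by (simp add: h_def m_assoc)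
    finally show ?case by simp
  qed
  have hom: "h \<in> hom F G"
    by (rule homI) (auto simp: F_def free_group_def h hm)
  have gen: "h (free_gen i) = f i" if "i \<in> {1..n}" for i
    using f[OF that] by (simp add: h_def free_gen_def l_def)
  have uniq: "h' w = h w" if h': "h' \<in> hom F G" "\<And>i. i \<in> {1..n} \<Longrightarrow> h' (free_gen i) = f i"
    and "w \<in> carrier F" for h' w
    using \<open>w \<in> carrier F\<close>
  proof (induction w)
    case Nil
    have "h' \<one>\<^bsub>F\<^esub> = \<one>\<^bsub>G\<^esub>"
      using h'(1) F.is_group \<open>group G\<close> by (intro hom_one) auto
    then show ?case by (simp add: h_def F_def free_group_def)
  next
    case (Cons a w)
    obtain i b where a: "a = (i, b)" by fastforce
    have i: "i \<in> {1..n}" using Cons.prems a by (auto simp: F_def free_group_def)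
    have w: "w \<in> carrier F" using Cons.prems by (auto simp: F_def free_group_def dest: reduced_ConsD)
    have g: "free_gen i \<in> carrier F" using i by (auto simp: F_def free_group_def free_gen_def)
    have "inv\<^bsub>F\<^esub> (free_gen i) = [(i, False)]"
      using i g by (intro F.inv_equality) (auto simp: F_def free_group_def free_gen_def)
    then have "[a] = (if b then free_gen i else inv\<^bsub>F\<^esub> (free_gen i))"
      by (simp add: a free_gen_def)
    then have "h' [a] = l a"
      using g i h' \<open>group G\<close> F.is_group group_hom.hom_inv[of F G h' "free_gen i"]
      by (auto simp: l_def a group_hom_def group_hom_axioms_def)
    moreover have "a # w = [a] \<otimes>\<^bsub>F\<^esub> w"
      using Cons.prems by (simp add: F_def free_group_def cancel_Cons_reduced)
    moreover have "[a] \<in> carrier F" using i by (auto simp: F_def free_group_def a)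
    ultimately have "h' (a # w) = l a \<otimes>\<^bsub>G\<^esub> h' w" using hom_mult[OF h'(1)] w by simp
    then show ?case using Cons.IH[OF w] by (simp add: h_def)
  qed
  show ?thesis using hom gen uniq unfolding F_def by blast
qed

text \<open>In particular the homomorphism \<open>\<phi>\<^bsub>n,m\<^esub>\<close> exists and is unique.\<close>

lemma ex_phi:
  assumes "m \<ge> 1"
  shows "\<exists>\<phi> \<in> hom (free_group (n * m)) (free_group n \<times>\<times> free_group m).
    \<forall>i\<in>{1..n}. \<forall>j\<in>{1..m}. \<phi> (free_gen (m * (i - 1) + j)) = (free_gen i, free_gen j)"
proof -
  define f where "f k = (free_gen ((k - 1) div m + 1), free_gen ((k - 1) mod m + 1))" for k
  have "f k \<in> carrier (free_group n \<times>\<times> free_group m)" if "k \<in> {1..n * m}" for k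
  proof -
    have "(k - 1) div m < n" using that by (intro less_mult_imp_div_less) auto
    then show ?thesis using assms mod_less_divisor[of m "k - 1"]
      by (auto simp: f_def free_group_def free_gen_def Suc_le_eq)
  qed
  then obtain h where h: "h \<in> hom (free_group (n * m)) (free_group n \<times>\<times> free_group m)"
    "\<forall>k\<in>{1..n * m}. h (free_gen k) = f k"
    using free_group_universal[OF DirProd_group[OF group_free_group group_free_group],
        of "n * m" f n m] by blast
  have "h (free_gen (m * (i - 1) + j)) = (free_gen i, free_gen j)"
    if "i \<in> {1..n}" "j \<in> {1..m}" for i j
  proof -
    have "m * (i - 1) + j \<le> m * (i - 1) + m" using that by simp
    also have "\<dots> = m * i" using that by (cases i) auto
    also have "\<dots> \<le> n * m" using that by (simp add: mult.commute)
    finally have "m * (i - 1) + j \<in> {1..n * m}" using that by auto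
    moreover have "m * (i - 1) + j - 1 = m * (i - 1) + (j - 1)" using that by auto
    moreover have "j - 1 < m" using that by auto
    ultimately have "f (m * (i - 1) + j) = (free_gen (i - 1 + 1), free_gen (j - 1 + 1))"
      unfolding f_def by simp
    then show ?thesis using h(2) that \<open>m * (i - 1) + j \<in> {1..n * m}\<close> by simp
  qed
  then show ?thesis using h(1) by blast
qed


section \<open>Complex Hilbert spaces\<close>

text \<open>
  The fields \<^const>\<open>mult\<close> and \<^const>\<open>one\<close> are inherited from the library's record of modules and
  play no role.  Inner products are linear in the first argument.
\<close>

record 'v hilbert = "(complex, 'v) module" +
  hinner :: "'v \<Rightarrow> 'v \<Rightarrow> complex"

definition hnorm :: "('v, 'x) hilbert_scheme \<Rightarrow> 'v \<Rightarrow> real" where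
  "hnorm H x = sqrt (Re (hinner H x x))"

text \<open>The value outside the carrier is chosen so as to satisfy the locale \<^locale>\<open>Metric_space\<close>.\<close>

definition hdist :: "('v, 'x) hilbert_scheme \<Rightarrow> 'v \<Rightarrow> 'v \<Rightarrow> real" where
  "hdist H x y =
     (if x \<in> carrier H \<and> y \<in> carrier H then hnorm H (x \<ominus>\<^bsub>H\<^esub> y) else 0)"

definition complex_ring :: "complex ring" where
  "complex_ring =
     \<lparr>carrier = UNIV, mult = (*), one = 1, zero = 0, add = (+)\<rparr>"

locale hilbert_space = module complex_ring H
  for H :: "('v, 'x) hilbert_scheme" (structure) +
  assumes hinner_add_left:
      "\<lbrakk>x \<in> carrier H; y \<in> carrier H; z \<in> carrier H\<rbrakk>
        \<Longrightarrow> hinner H (x \<oplus> y) z = hinner H x z + hinner H y z"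
    and hinner_smult_left:
      "\<lbrakk>x \<in> carrier H; y \<in> carrier H\<rbrakk> \<Longrightarrow> hinner H (c \<odot> x) y = c * hinner H x y"
    and hinner_commute:
      "\<lbrakk>x \<in> carrier H; y \<in> carrier H\<rbrakk> \<Longrightarrow> hinner H y x = cnj (hinner H x y)"
    and hinner_nonneg: "x \<in> carrier H \<Longrightarrow> 0 \<le> Re (hinner H x x)"
    and hinner_eq_zero: "\<lbrakk>x \<in> carrier H; hinner H x x = 0\<rbrakk> \<Longrightarrow> x = \<zero>"
    and complete: "Metric_space.mcomplete (carrier H) (hdist H)"

definition bounded_ops :: "('v, 'x) hilbert_scheme \<Rightarrow> ('v \<Rightarrow> 'v) set" where
  "bounded_ops H =
     {A \<in> carrier H \<rightarrow>\<^sub>E carrier H.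
        (\<forall>x\<in>carrier H. \<forall>y\<in>carrier H. A (x \<oplus>\<^bsub>H\<^esub> y) = A x \<oplus>\<^bsub>H\<^esub> A y) \<and>
        (\<forall>c. \<forall>x\<in>carrier H. A (c \<odot>\<^bsub>H\<^esub> x) = c \<odot>\<^bsub>H\<^esub> A x) \<and>
        (\<exists>C. \<forall>x\<in>carrier H. hnorm H (A x) \<le> C * hnorm H x)}"

abbreviation id_op :: "('v, 'x) hilbert_scheme \<Rightarrow> 'v \<Rightarrow> 'v" where
  "id_op H \<equiv> (\<lambda>x\<in>carrier H. x)"

definition is_adjoint :: "('v, 'x) hilbert_scheme \<Rightarrow> ('v \<Rightarrow> 'v) \<Rightarrow> ('v \<Rightarrow> 'v) \<Rightarrow> bool" where
  "is_adjoint H A B \<longleftrightarrow> A \<in> bounded_ops H \<and> B \<in> bounded_ops H \<and>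
     (\<forall>x\<in>carrier H. \<forall>y\<in>carrier H. hinner H (A x) y = hinner H x (B y))"

definition unitary_between ::
    "('v, 'x) hilbert_scheme \<Rightarrow> ('w, 'y) hilbert_scheme \<Rightarrow> ('v \<Rightarrow> 'w) \<Rightarrow> bool" where
  "unitary_between H K V \<longleftrightarrow>
     bij_betw V (carrier H) (carrier K) \<and>
     (\<forall>x\<in>carrier H. \<forall>y\<in>carrier H. V (x \<oplus>\<^bsub>H\<^esub> y) = V x \<oplus>\<^bsub>K\<^esub> V y) \<and>
     (\<forall>c. \<forall>x\<in>carrier H. V (c \<odot>\<^bsub>H\<^esub> x) = c \<odot>\<^bsub>K\<^esub> V x) \<and>
     (\<forall>x\<in>carrier H. \<forall>y\<in>carrier H. hinner K (V x) (V y) = hinner H x y)"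

definition unitary_group :: "('v, 'x) hilbert_scheme \<Rightarrow> ('v \<Rightarrow> 'v) monoid" where
  "unitary_group H =
     \<lparr>carrier = {U \<in> extensional (carrier H). unitary_between H H U},
      mult = compose (carrier H),
      one = id_op H\<rparr>"

text \<open>\<open>\<ell>\<^sup>2(X)\<close>, with square summable functions on \<open>X\<close> extended by 0.\<close>

definition ell2 :: "'a set \<Rightarrow> ('a \<Rightarrow> complex) hilbert" where
  "ell2 X =
     \<lparr>carrier = {f. (\<forall>x. x \<notin> X \<longrightarrow> f x = 0) \<and> (\<lambda>x. (cmod (f x))\<^sup>2) summable_on X},
      mult = undefined, one = undefined,
      zero = \<lambda>x. 0,
      add = \<lambda>f g x. f x + g x,
      smult = \<lambda>c f x. c * f x,
      hinner = \<lambda>f g. \<Sum>\<^sub>\<infinity>x\<in>X. f x * cnj (g x)\<rparr>"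

text \<open>The Hilbert space direct sum of countably infinitely many copies of \<open>H\<close>.\<close>

definition inf_copies :: "('v, 'x) hilbert_scheme \<Rightarrow> (nat \<Rightarrow> 'v) hilbert" where
  "inf_copies H =
     \<lparr>carrier = {f. (\<forall>k. f k \<in> carrier H) \<and> summable (\<lambda>k. (hnorm H (f k))\<^sup>2)},
      mult = undefined, one = undefined,
      zero = \<lambda>k. \<zero>\<^bsub>H\<^esub>,
      add = \<lambda>f g k. f k \<oplus>\<^bsub>H\<^esub> g k,
      smult = \<lambda>c f k. c \<odot>\<^bsub>H\<^esub> f k,
      hinner = \<lambda>f g. \<Sum>k. hinner H (f k) (g k)\<rparr>"

text \<open>
  \<open>hilbert_tensor H K T t\<close> says that \<open>T\<close>, with the elementary tensors \<open>t a b\<close>, is a Hilbert space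
  tensor product of \<open>H\<close> and \<open>K\<close>, i.e. a completion of the algebraic tensor product with respect
  to the inner product determined by \<open>\<langle>a \<otimes> b, c \<otimes> d\<rangle> = \<langle>a, c\<rangle>\<langle>b, d\<rangle>\<close>.  This determines \<open>(T, t)\<close> up to a
  unique unitary.
\<close>

definition hilbert_tensor ::
    "('v, 'x) hilbert_scheme \<Rightarrow> ('w, 'y) hilbert_scheme \<Rightarrow> ('t, 'z) hilbert_scheme
      \<Rightarrow> ('v \<Rightarrow> 'w \<Rightarrow> 't) \<Rightarrow> bool" where
  "hilbert_tensor H K T t \<longleftrightarrow>
     hilbert_space T \<and>
     (\<forall>a\<in>carrier H. \<forall>b\<in>carrier K. t a b \<in> carrier T) \<and>
     (\<forall>a\<in>carrier H. \<forall>a'\<in>carrier H. \<forall>b\<in>carrier K. t (a \<oplus>\<^bsub>H\<^esub> a') b = t a b \<oplus>\<^bsub>T\<^esub> t a' b) \<and>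
     (\<forall>a\<in>carrier H. \<forall>b\<in>carrier K. \<forall>b'\<in>carrier K. t a (b \<oplus>\<^bsub>K\<^esub> b') = t a b \<oplus>\<^bsub>T\<^esub> t a b') \<and>
     (\<forall>c. \<forall>a\<in>carrier H. \<forall>b\<in>carrier K. t (c \<odot>\<^bsub>H\<^esub> a) b = c \<odot>\<^bsub>T\<^esub> t a b) \<and>
     (\<forall>c. \<forall>a\<in>carrier H. \<forall>b\<in>carrier K. t a (c \<odot>\<^bsub>K\<^esub> b) = c \<odot>\<^bsub>T\<^esub> t a b) \<and>
     (\<forall>a\<in>carrier H. \<forall>a'\<in>carrier H. \<forall>b\<in>carrier K. \<forall>b'\<in>carrier K.
        hinner T (t a b) (t a' b') = hinner H a a' * hinner K b b') \<and>
     Metric_space.mtopology (carrier T) (hdist T) closure_of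
       {finsum T (\<lambda>i. t (a i) (b i)) {..<k} | (k::nat) a b.
          a \<in> {..<k} \<rightarrow> carrier H \<and> b \<in> {..<k} \<rightarrow> carrier K}
       = carrier T"

definition tensor_op ::
    "('v, 'x) hilbert_scheme \<Rightarrow> ('w, 'y) hilbert_scheme \<Rightarrow> ('t, 'z) hilbert_scheme
      \<Rightarrow> ('v \<Rightarrow> 'w \<Rightarrow> 't) \<Rightarrow> ('v \<Rightarrow> 'v) \<Rightarrow> ('w \<Rightarrow> 'w) \<Rightarrow> 't \<Rightarrow> 't" where
  "tensor_op H K T t A B =
     (THE C. C \<in> bounded_ops T \<and>
        (\<forall>a\<in>carrier H. \<forall>b\<in>carrier K. C (t a b) = t (A a) (B b)))"


section \<open>Unitary representations\<close>

definition unitary_rep ::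
    "('g, 'm) monoid_scheme \<Rightarrow> ('v, 'x) hilbert_scheme \<Rightarrow> ('g \<Rightarrow> 'v \<Rightarrow> 'v) \<Rightarrow> bool" where
  "unitary_rep G H \<pi> \<longleftrightarrow> group G \<and> hilbert_space H \<and> \<pi> \<in> hom G (unitary_group H)"

definition unitarily_equivalent ::
    "('g, 'm) monoid_scheme \<Rightarrow> ('v, 'x) hilbert_scheme \<Rightarrow> ('g \<Rightarrow> 'v \<Rightarrow> 'v)
      \<Rightarrow> ('w, 'y) hilbert_scheme \<Rightarrow> ('g \<Rightarrow> 'w \<Rightarrow> 'w) \<Rightarrow> bool" where
  "unitarily_equivalent G H \<pi> K \<rho> \<longleftrightarrow>
     unitary_rep G H \<pi> \<and> unitary_rep G K \<rho> \<and>
     (\<exists>V. unitary_between H K V \<and>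
        (\<forall>g\<in>carrier G. \<forall>x\<in>carrier H. V (\<pi> g x) = \<rho> g (V x)))"

definition regular_rep ::
    "('g, 'm) monoid_scheme \<Rightarrow> 'g \<Rightarrow> ('g \<Rightarrow> complex) \<Rightarrow> 'g \<Rightarrow> complex" where
  "regular_rep G g =
     (\<lambda>f\<in>carrier (ell2 (carrier G)). \<lambda>x. if x \<in> carrier G then f (inv\<^bsub>G\<^esub> g \<otimes>\<^bsub>G\<^esub> x) else 0)"

text \<open>
  The formula \<open>(\<lambda>(g) f)(C) = f (g\<^sup>-\<^sup>1 C)\<close> expresses that the basis vector at \<open>C\<close> is moved to the one
  at \<open>g C\<close>.
\<close>

definition quasi_regular_rep ::
    "('g, 'm) monoid_scheme \<Rightarrow> 'g set \<Rightarrow> 'g \<Rightarrow> ('g set \<Rightarrow> complex) \<Rightarrow> 'g set \<Rightarrow> complex" where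
  "quasi_regular_rep G G0 g =
     (\<lambda>f\<in>carrier (ell2 (lcosets\<^bsub>G\<^esub> G0)).
        \<lambda>C. if C \<in> lcosets\<^bsub>G\<^esub> G0 then f (inv\<^bsub>G\<^esub> g <#\<^bsub>G\<^esub> C) else 0)"

definition inf_copies_rep ::
    "('v, 'x) hilbert_scheme \<Rightarrow> ('g \<Rightarrow> 'v \<Rightarrow> 'v) \<Rightarrow> 'g \<Rightarrow> (nat \<Rightarrow> 'v) \<Rightarrow> nat \<Rightarrow> 'v" where
  "inf_copies_rep H \<pi> g = (\<lambda>f\<in>carrier (inf_copies H). \<lambda>k. \<pi> g (f k))"

text \<open>\<open>\<pi> \<otimes>\<^sub>\<phi> \<rho> = (\<pi> \<otimes> \<rho>) \<circ> \<phi>\<close>, for a homomorphism \<open>\<phi>\<close> into a product of two groups.\<close>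

definition tensor_rep ::
    "('v, 'x) hilbert_scheme \<Rightarrow> ('w, 'y) hilbert_scheme \<Rightarrow> ('t, 'z) hilbert_scheme
      \<Rightarrow> ('v \<Rightarrow> 'w \<Rightarrow> 't) \<Rightarrow> ('g \<Rightarrow> 'h \<times> 'k) \<Rightarrow> ('h \<Rightarrow> 'v \<Rightarrow> 'v) \<Rightarrow> ('k \<Rightarrow> 'w \<Rightarrow> 'w)
      \<Rightarrow> 'g \<Rightarrow> 't \<Rightarrow> 't" where
  "tensor_rep H K T t \<phi> \<pi> \<rho> g = tensor_op H K T t (\<pi> (fst (\<phi> g))) (\<rho> (snd (\<phi> g)))"


section \<open>Type II\<open>\<^sub>1\<close> factors\<close>

definition commutant :: "('v, 'x) hilbert_scheme \<Rightarrow> ('v \<Rightarrow> 'v) set \<Rightarrow> ('v \<Rightarrow> 'v) set" where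
  "commutant H S =
     {A \<in> bounded_ops H. \<forall>B\<in>S. compose (carrier H) A B = compose (carrier H) B A}"

definition von_neumann_algebra :: "('v, 'x) hilbert_scheme \<Rightarrow> ('v \<Rightarrow> 'v) set \<Rightarrow> bool" where
  "von_neumann_algebra H M \<longleftrightarrow>
     M \<subseteq> bounded_ops H \<and>
     (\<forall>A\<in>M. \<forall>B. is_adjoint H A B \<longrightarrow> B \<in> M) \<and>
     commutant H (commutant H M) = M"

text \<open>A factor is required to act on a nonzero space.\<close>

definition factor :: "('v, 'x) hilbert_scheme \<Rightarrow> ('v \<Rightarrow> 'v) set \<Rightarrow> bool" where
  "factor H M \<longleftrightarrow>
     von_neumann_algebra H M \<and> carrier H \<noteq> {\<zero>\<^bsub>H\<^esub>} \<and>
     M \<inter> commutant H M = {\<lambda>x\<in>carrier H. c \<odot>\<^bsub>H\<^esub> x | c. True}"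

definition projections :: "('v, 'x) hilbert_scheme \<Rightarrow> ('v \<Rightarrow> 'v) set \<Rightarrow> ('v \<Rightarrow> 'v) set" where
  "projections H M = {p \<in> M. is_adjoint H p p \<and> compose (carrier H) p p = p}"

definition mvn_equivalent ::
    "('v, 'x) hilbert_scheme \<Rightarrow> ('v \<Rightarrow> 'v) set \<Rightarrow> ('v \<Rightarrow> 'v) \<Rightarrow> ('v \<Rightarrow> 'v) \<Rightarrow> bool" where
  "mvn_equivalent H M p q \<longleftrightarrow>
     (\<exists>v\<in>M. \<exists>w\<in>M. is_adjoint H v w \<and>
        compose (carrier H) w v = p \<and> compose (carrier H) v w = q)"

definition finite_projection ::
    "('v, 'x) hilbert_scheme \<Rightarrow> ('v \<Rightarrow> 'v) set \<Rightarrow> ('v \<Rightarrow> 'v) \<Rightarrow> bool" where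
  "finite_projection H M p \<longleftrightarrow>
     p \<in> projections H M \<and>
     (\<forall>q\<in>projections H M.
        mvn_equivalent H M p q \<and> compose (carrier H) p q = q \<longrightarrow> q = p)"

definition abelian_projection ::
    "('v, 'x) hilbert_scheme \<Rightarrow> ('v \<Rightarrow> 'v) set \<Rightarrow> ('v \<Rightarrow> 'v) \<Rightarrow> bool" where
  "abelian_projection H M p \<longleftrightarrow>
     p \<in> projections H M \<and>
     (\<forall>A\<in>M. \<forall>B\<in>M.
        let pAp = compose (carrier H) p (compose (carrier H) A p);
            pBp = compose (carrier H) p (compose (carrier H) B p)
        in compose (carrier H) pAp pBp = compose (carrier H) pBp pAp)"

text \<open>
  Type II\<open>\<^sub>1\<close>: no nonzero abelian projection, and the identity is a finite projection.  (The further
  requirement for type II, a finite projection with central support 1, is then met by the identity.)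
\<close>

definition type_II1 :: "('v, 'x) hilbert_scheme \<Rightarrow> ('v \<Rightarrow> 'v) set \<Rightarrow> bool" where
  "type_II1 H M \<longleftrightarrow>
     von_neumann_algebra H M \<and>
     (\<forall>p. abelian_projection H M p \<longrightarrow> p = (\<lambda>x\<in>carrier H. \<zero>\<^bsub>H\<^esub>)) \<and>
     finite_projection H M (id_op H)"

definition type_II1_factor_rep ::
    "('g, 'm) monoid_scheme \<Rightarrow> ('v, 'x) hilbert_scheme \<Rightarrow> ('g \<Rightarrow> 'v \<Rightarrow> 'v) \<Rightarrow> bool" where
  "type_II1_factor_rep G H \<pi> \<longleftrightarrow>
     unitary_rep G H \<pi> \<and>
     (let M = commutant H (commutant H (\<pi> ` carrier G)) in factor H M \<and> type_II1 H M)"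


section \<open>The spaces \<open>\<ell>\<^sup>2(X)\<close> and their tensor products\<close>

lemma ell2_simps [simp]:
  "zero (ell2 X) = (\<lambda>x. 0)" "add (ell2 X) = (\<lambda>f g x. f x + g x)"
  "smult (ell2 X) = (\<lambda>c f x. c * f x)"
  "hinner (ell2 X) f g = (\<Sum>\<^sub>\<infinity>x\<in>X. f x * cnj (g x))"
  by (simp_all add: ell2_def)

lemma ell2_iff:
  "f \<in> carrier (ell2 X) \<longleftrightarrow> (\<forall>x. x \<notin> X \<longrightarrow> f x = 0) \<and> (\<lambda>x. (cmod (f x))\<^sup>2) summable_on X"
  by (simp add: ell2_def)

lemma ell2_iff_bdd:
  "f \<in> carrier (ell2 X) \<longleftrightarrow> (\<forall>x. x \<notin> X \<longrightarrow> f x = 0) \<and>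
     (\<exists>C. \<forall>F. finite F \<longrightarrow> F \<subseteq> X \<longrightarrow> L2_set (\<lambda>x. cmod (f x)) F \<le> C)"
proof -
  have "(\<lambda>x. (cmod (f x))\<^sup>2) summable_on X
      \<longleftrightarrow> (\<exists>C. \<forall>F. finite F \<longrightarrow> F \<subseteq> X \<longrightarrow> L2_set (\<lambda>x. cmod (f x)) F \<le> C)" (is "?l \<longleftrightarrow> ?r")
  proof
    assume ?l
    then show ?r
      by (intro exI[of _ "sqrt (\<Sum>\<^sub>\<infinity>x\<in>X. (cmod (f x))\<^sup>2)"])
         (auto simp: L2_set_def intro!: finite_sum_le_infsum)
  next
    assume ?r
    then obtain C where C: "\<And>F. finite F \<Longrightarrow> F \<subseteq> X \<Longrightarrow> L2_set (\<lambda>x. cmod (f x)) F \<le> C" by blast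
    have "(\<Sum>x\<in>F. (cmod (f x))\<^sup>2) \<le> C\<^sup>2" if "finite F" "F \<subseteq> X" for F
      using C[OF that] by (simp add: L2_set_def sqrt_le_D)
    then show ?l by (intro nonneg_bdd_above_summable_on) (auto simp: bdd_above_def)
  qed
  then show ?thesis by (simp add: ell2_iff)
qed

lemma ell2_norm_bdd:
  assumes "f \<in> carrier (ell2 X)" "finite F" "F \<subseteq> X"
  shows "L2_set (\<lambda>x. cmod (f x)) F \<le> sqrt (\<Sum>\<^sub>\<infinity>x\<in>X. (cmod (f x))\<^sup>2)"
  using assms by (auto simp: L2_set_def ell2_iff intro!: finite_sum_le_infsum)

lemma ell2_norm_leI:
  assumes "f \<in> carrier (ell2 X)" "\<And>F. finite F \<Longrightarrow> F \<subseteq> X \<Longrightarrow> L2_set (\<lambda>x. cmod (f x)) F \<le> C"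
  shows "sqrt (\<Sum>\<^sub>\<infinity>x\<in>X. (cmod (f x))\<^sup>2) \<le> C"
proof -
  have "0 \<le> C" using assms(2)[of "{}"] by simp
  have "(\<Sum>x\<in>F. (cmod (f x))\<^sup>2) \<le> C\<^sup>2" if "finite F" "F \<subseteq> X" for F
    using assms(2)[OF that] by (simp add: L2_set_def sqrt_le_D)
  then have "(\<Sum>\<^sub>\<infinity>x\<in>X. (cmod (f x))\<^sup>2) \<le> C\<^sup>2"
    using assms(1) by (intro infsum_le_finite_sums) (auto simp: ell2_iff)
  then show ?thesis using \<open>0 \<le> C\<close> by (simp add: real_le_lsqrt)
qed

lemma L2_set_cmod_triangle:
  "L2_set (\<lambda>x. cmod (f x + g x)) F \<le> L2_set (\<lambda>x. cmod (f x)) F + L2_set (\<lambda>x. cmod (g x)) F"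
proof -
  have "L2_set (\<lambda>x. cmod (f x + g x)) F \<le> L2_set (\<lambda>x. cmod (f x) + cmod (g x)) F"
    by (intro L2_set_mono) (auto intro: norm_triangle_ineq)
  also have "\<dots> \<le> L2_set (\<lambda>x. cmod (f x)) F + L2_set (\<lambda>x. cmod (g x)) F"
    by (rule L2_set_triangle_ineq)
  finally show ?thesis .
qed

lemma L2_set_cmod_smult: "L2_set (\<lambda>x. cmod (c * f x)) F = cmod c * L2_set (\<lambda>x. cmod (f x)) F"
  by (simp add: norm_mult L2_set_right_distrib)

lemma ell2_add:
  assumes "f \<in> carrier (ell2 X)" "g \<in> carrier (ell2 X)"
  shows "(\<lambda>x. f x + g x) \<in> carrier (ell2 X)"
proof -
  let ?n = "\<lambda>f. sqrt (\<Sum>\<^sub>\<infinity>x\<in>X. (cmod (f x))\<^sup>2)"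
  have "L2_set (\<lambda>x. cmod (f x + g x)) F \<le> ?n f + ?n g" if "finite F" "F \<subseteq> X" for F
    using L2_set_cmod_triangle[of f g F] ell2_norm_bdd[OF assms(1) that] ell2_norm_bdd[OF assms(2) that]
    by linarith
  moreover have "f x + g x = 0" if "x \<notin> X" for x
    using assms that by (simp add: ell2_iff)
  ultimately show ?thesis unfolding ell2_iff_bdd by blast
qed

lemma ell2_smult:
  assumes "f \<in> carrier (ell2 X)"
  shows "(\<lambda>x. c * f x) \<in> carrier (ell2 X)"
proof -
  have "L2_set (\<lambda>x. cmod (c * f x)) F \<le> cmod c * sqrt (\<Sum>\<^sub>\<infinity>x\<in>X. (cmod (f x))\<^sup>2)"
    if "finite F" "F \<subseteq> X" for F
    unfolding L2_set_cmod_smult using ell2_norm_bdd[OF assms that] by (rule mult_left_mono) simp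
  moreover have "c * f x = 0" if "x \<notin> X" for x
    using assms that by (simp add: ell2_iff)
  ultimately show ?thesis unfolding ell2_iff_bdd by blast
qed

lemma ell2_zero: "(\<lambda>x. 0) \<in> carrier (ell2 X)"
  by (simp add: ell2_iff)

lemma ell2_diff: "f \<in> carrier (ell2 X) \<Longrightarrow> g \<in> carrier (ell2 X) \<Longrightarrow> (\<lambda>x. f x - g x) \<in> carrier (ell2 X)"
  using ell2_add[of f X "\<lambda>x. (-1) * g x"] ell2_smult[of g X "-1"] by simp

lemma cring_complex_ring: "cring complex_ring"
proof (rule cringI)
  show "abelian_group complex_ring"
    by (rule abelian_groupI) (auto simp: complex_ring_def add_ac intro: exI[of _ "- x" for x])
  show "comm_monoid complex_ring"
    by (rule comm_monoidI) (auto simp: complex_ring_def mult_ac)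
qed (auto simp: complex_ring_def algebra_simps)

lemma abelian_group_ell2: "abelian_group (ell2 X)"
proof (rule abelian_groupI)
  fix f assume "f \<in> carrier (ell2 X)"
  then show "\<exists>g\<in>carrier (ell2 X). g \<oplus>\<^bsub>ell2 X\<^esub> f = \<zero>\<^bsub>ell2 X\<^esub>"
    using ell2_smult[of f X "-1"] by (intro bexI[of _ "\<lambda>x. (-1) * f x"]) auto
qed (auto simp: ell2_add ell2_zero add_ac)

lemma module_ell2: "module complex_ring (ell2 X)"
  by (rule moduleI[OF cring_complex_ring abelian_group_ell2])
     (auto simp: complex_ring_def ell2_smult algebra_simps)

lemma ell2_minus:
  assumes "f \<in> carrier (ell2 X)" "g \<in> carrier (ell2 X)"
  shows "f \<ominus>\<^bsub>ell2 X\<^esub> g = (\<lambda>x. f x - g x)"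
proof -
  interpret abelian_group "ell2 X" by (rule abelian_group_ell2)
  have "\<ominus>\<^bsub>ell2 X\<^esub> g = (\<lambda>x. - g x)"
    using assms ell2_smult[of g X "-1"] by (intro minus_equality) auto
  then show ?thesis using assms by (simp add: a_minus_def)
qed

lemma ell2_hinner_summable:
  assumes "f \<in> carrier (ell2 X)" "g \<in> carrier (ell2 X)"
  shows "(\<lambda>x. f x * cnj (g x)) summable_on X"
proof (rule abs_summable_summable, rule nonneg_bdd_above_summable_on)
  let ?n = "\<lambda>f. sqrt (\<Sum>\<^sub>\<infinity>x\<in>X. (cmod (f x))\<^sup>2)"
  show "bdd_above (sum (\<lambda>x. norm (f x * cnj (g x))) ` {F. F \<subseteq> X \<and> finite F})"
  proof (rule bdd_aboveI2)
    fix F assume F: "F \<in> {F. F \<subseteq> X \<and> finite F}"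
    have "(\<Sum>x\<in>F. norm (f x * cnj (g x))) \<le> L2_set (\<lambda>x. cmod (f x)) F * L2_set (\<lambda>x. cmod (g x)) F"
      using L2_set_mult_ineq[of "\<lambda>x. cmod (f x)" "\<lambda>x. cmod (g x)" F] by (simp add: norm_mult)
    also have "\<dots> \<le> ?n f * ?n g"
      using assms F by (intro mult_mono ell2_norm_bdd) (auto simp: infsum_nonneg)
    finally show "(\<Sum>x\<in>F. norm (f x * cnj (g x))) \<le> ?n f * ?n g" .
  qed
qed auto

lemma ell2_hinner_self:
  assumes "f \<in> carrier (ell2 X)"
  shows "hinner (ell2 X) f f = complex_of_real (\<Sum>\<^sub>\<infinity>x\<in>X. (cmod (f x))\<^sup>2)"
proof -
  have "((\<lambda>x. (cmod (f x))\<^sup>2) has_sum (\<Sum>\<^sub>\<infinity>x\<in>X. (cmod (f x))\<^sup>2)) X"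
    using assms by (simp add: ell2_iff)
  then have "((\<lambda>x. complex_of_real ((cmod (f x))\<^sup>2))
      has_sum complex_of_real (\<Sum>\<^sub>\<infinity>x\<in>X. (cmod (f x))\<^sup>2)) X"
    by (rule has_sum_of_real)
  then show ?thesis by (simp add: complex_norm_square infsumI del: of_real_power)
qed

lemma ell2_hnorm:
  "f \<in> carrier (ell2 X) \<Longrightarrow> hnorm (ell2 X) f = sqrt (\<Sum>\<^sub>\<infinity>x\<in>X. (cmod (f x))\<^sup>2)"
  by (simp only: hnorm_def ell2_hinner_self Re_complex_of_real)

lemma ell2_hdist:
  assumes "f \<in> carrier (ell2 X)" "g \<in> carrier (ell2 X)"
  shows "hdist (ell2 X) f g = sqrt (\<Sum>\<^sub>\<infinity>x\<in>X. (cmod (f x - g x))\<^sup>2)"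
  using assms by (simp add: hdist_def ell2_minus ell2_hnorm ell2_diff)

lemma ell2_norm_eq_0:
  assumes "f \<in> carrier (ell2 X)" "(\<Sum>\<^sub>\<infinity>x\<in>X. (cmod (f x))\<^sup>2) = 0"
  shows "f x = 0"
proof (cases "x \<in> X")
  case True
  then have "L2_set (\<lambda>x. cmod (f x)) {x} \<le> 0"
    using ell2_norm_bdd[OF assms(1), of "{x}"] assms(2) by simp
  then show ?thesis by simp
qed (use assms in \<open>auto simp: ell2_iff\<close>)

lemma Metric_space_ell2: "Metric_space (carrier (ell2 X)) (hdist (ell2 X))"
proof
  fix f g h
  have nonneg: "0 \<le> sqrt (\<Sum>\<^sub>\<infinity>x\<in>X. (cmod (f x - g x))\<^sup>2)"
    by (simp add: infsum_nonneg)
  show "0 \<le> hdist (ell2 X) f g"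
  proof (cases "f \<in> carrier (ell2 X) \<and> g \<in> carrier (ell2 X)")
    case True
    then show ?thesis using nonneg ell2_hdist[of f X g] by metis
  next
    case False
    then show ?thesis unfolding hdist_def by (simp only: if_False order_refl)
  qed
  show "hdist (ell2 X) f g = hdist (ell2 X) g f"
  proof (cases "f \<in> carrier (ell2 X) \<and> g \<in> carrier (ell2 X)")
    case True
    then show ?thesis using ell2_hdist[of f X g] ell2_hdist[of g X f]
      by (simp only: norm_minus_commute)
  next
    case False
    then show ?thesis unfolding hdist_def by (simp only: if_False conj_commute)
  qed
  show "hdist (ell2 X) f g = 0 \<longleftrightarrow> f = g" if "f \<in> carrier (ell2 X)" "g \<in> carrier (ell2 X)"
  proof
    assume "hdist (ell2 X) f g = 0"
    then have "(\<Sum>\<^sub>\<infinity>x\<in>X. (cmod (f x - g x))\<^sup>2) = 0"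
      unfolding ell2_hdist[OF that] by simp
    from ell2_norm_eq_0[OF ell2_diff[OF that] this] have "f x - g x = 0" for x .
    then show "f = g" by (simp add: fun_eq_iff)
  next
    assume "f = g"
    then show "hdist (ell2 X) f g = 0" using ell2_hdist[OF that] by simp
  qed
  show "hdist (ell2 X) f h \<le> hdist (ell2 X) f g + hdist (ell2 X) g h"
    if "f \<in> carrier (ell2 X)" "g \<in> carrier (ell2 X)" "h \<in> carrier (ell2 X)"
  proof -
    have "sqrt (\<Sum>\<^sub>\<infinity>x\<in>X. (cmod (f x - h x))\<^sup>2)
        \<le> sqrt (\<Sum>\<^sub>\<infinity>x\<in>X. (cmod (f x - g x))\<^sup>2) + sqrt (\<Sum>\<^sub>\<infinity>x\<in>X. (cmod (g x - h x))\<^sup>2)"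
    proof (rule ell2_norm_leI[OF ell2_diff])
      fix F assume F: "finite F" "F \<subseteq> X"
      have "L2_set (\<lambda>x. cmod (f x - h x)) F
          \<le> L2_set (\<lambda>x. cmod (f x - g x)) F + L2_set (\<lambda>x. cmod (g x - h x)) F"
        using L2_set_cmod_triangle[of "\<lambda>x. f x - g x" "\<lambda>x. g x - h x" F] by simp
      also have "\<dots> \<le> sqrt (\<Sum>\<^sub>\<infinity>x\<in>X. (cmod (f x - g x))\<^sup>2) + sqrt (\<Sum>\<^sub>\<infinity>x\<in>X. (cmod (g x - h x))\<^sup>2)"
        using F that by (intro add_mono ell2_norm_bdd ell2_diff)
      finally show "L2_set (\<lambda>x. cmod (f x - h x)) F \<le> \<dots>" .
    qed (use that in auto)
    then show ?thesis unfolding ell2_hdist[OF that(1,2)] ell2_hdist[OF that(2,3)] ell2_hdist[OF that(1,3)] .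
  qed
qed

lemma ell2_complete: "Metric_space.mcomplete (carrier (ell2 X)) (hdist (ell2 X))"
proof -
  interpret Metric_space "carrier (ell2 X)" "hdist (ell2 X)" by (rule Metric_space_ell2)
  show ?thesis unfolding mcomplete_def
  proof (intro allI impI)
    fix \<sigma> assume "MCauchy \<sigma>"
    then have "range \<sigma> \<subseteq> carrier (ell2 X)" unfolding MCauchy_def by (rule conjunct1)
    then have \<sigma>: "\<sigma> k \<in> carrier (ell2 X)" for k by blast
    have cau: "\<exists>N. \<forall>k\<ge>N. \<forall>l\<ge>N. \<forall>F. finite F \<longrightarrow> F \<subseteq> X \<longrightarrow> L2_set (\<lambda>x. cmod (\<sigma> k x - \<sigma> l x)) F < e"
      if "e > 0" for e
    proof -
      obtain N where N: "\<And>k l. k \<ge> N \<Longrightarrow> l \<ge> N \<Longrightarrow> hdist (ell2 X) (\<sigma> k) (\<sigma> l) < e"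
        using \<open>MCauchy \<sigma>\<close> \<open>e > 0\<close> unfolding MCauchy_def by meson
      have "L2_set (\<lambda>x. cmod (\<sigma> k x - \<sigma> l x)) F < e"
        if "k \<ge> N" "l \<ge> N" "finite F" "F \<subseteq> X" for k l F
        using ell2_norm_bdd[OF ell2_diff[OF \<sigma>[of k] \<sigma>[of l]] that(3,4)] N[OF that(1,2)]
        unfolding ell2_hdist[OF \<sigma> \<sigma>] by linarith
      then show ?thesis by blast
    qed
    have "Cauchy (\<lambda>k. \<sigma> k x)" for x
    proof (cases "x \<in> X")
      case True
      show ?thesis
      proof (rule CauchyI)
        fix e :: real assume "e > 0"
        from cau[OF this] obtain N where
          N: "\<forall>k\<ge>N. \<forall>l\<ge>N. \<forall>F. finite F \<longrightarrow> F \<subseteq> X \<longrightarrow> L2_set (\<lambda>x. cmod (\<sigma> k x - \<sigma> l x)) F < e" by blast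
        have "norm (\<sigma> k x - \<sigma> l x) < e" if "k \<ge> N" "l \<ge> N" for k l
        proof -
          have "L2_set (\<lambda>x. cmod (\<sigma> k x - \<sigma> l x)) {x} < e"
            using N that True by blast
          then show ?thesis by simp
        qed
        then show "\<exists>M. \<forall>k\<ge>M. \<forall>l\<ge>M. norm (\<sigma> k x - \<sigma> l x) < e" by blast
      qed
    next
      case False
      then have "\<sigma> k x = 0" for k using \<sigma>[of k] by (simp add: ell2_iff)
      then show ?thesis by (simp add: Cauchy_def)
    qed
    then have "\<exists>l. (\<lambda>k. \<sigma> k x) \<longlonglongrightarrow> l" for x
      using Cauchy_convergent_iff convergent_def by blast
    then obtain f where f: "\<And>x. (\<lambda>k. \<sigma> k x) \<longlonglongrightarrow> f x" by metis
    have lim: "\<exists>N. \<forall>k\<ge>N. \<forall>F. finite F \<longrightarrow> F \<subseteq> X \<longrightarrow> L2_set (\<lambda>x. cmod (\<sigma> k x - f x)) F \<le> e"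
      if "e > 0" for e
    proof -
      from cau[OF that] obtain N where
        N: "\<forall>k\<ge>N. \<forall>l\<ge>N. \<forall>F. finite F \<longrightarrow> F \<subseteq> X \<longrightarrow> L2_set (\<lambda>x. cmod (\<sigma> k x - \<sigma> l x)) F < e" by blast
      have "L2_set (\<lambda>x. cmod (\<sigma> k x - f x)) F \<le> e" if "k \<ge> N" "finite F" "F \<subseteq> X" for k F
      proof (rule tendsto_upperbound)
        show "(\<lambda>l. L2_set (\<lambda>x. cmod (\<sigma> k x - \<sigma> l x)) F) \<longlonglongrightarrow> L2_set (\<lambda>x. cmod (\<sigma> k x - f x)) F"
          unfolding L2_set_def by (intro tendsto_intros f)
        show "\<forall>\<^sub>F l in sequentially. L2_set (\<lambda>x. cmod (\<sigma> k x - \<sigma> l x)) F \<le> e"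
          using N that unfolding eventually_sequentially by (meson less_imp_le)
      qed simp
      then show ?thesis by blast
    qed
    have zero: "f x = 0" if "x \<notin> X" for x
    proof -
      have "\<sigma> k x = 0" for k using \<sigma>[of k] that by (simp add: ell2_iff)
      then show ?thesis using f[of x] by (simp add: LIMSEQ_const_iff)
    qed
    obtain N where N: "\<forall>F. finite F \<longrightarrow> F \<subseteq> X \<longrightarrow> L2_set (\<lambda>x. cmod (\<sigma> N x - f x)) F \<le> 1"
      using lim[of 1] by auto
    have "(\<lambda>x. \<sigma> N x - f x) \<in> carrier (ell2 X)"
      unfolding ell2_iff_bdd using N zero \<sigma>[of N] by (auto simp: ell2_iff)
    from ell2_diff[OF \<sigma>[of N] this] have fe: "f \<in> carrier (ell2 X)" by simp
    have "limitin mtopology \<sigma> f sequentially"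
      unfolding limit_metric_sequentially
    proof (intro conjI allI impI)
      fix e :: real assume "e > 0"
      then obtain N where
        N: "\<forall>k\<ge>N. \<forall>F. finite F \<longrightarrow> F \<subseteq> X \<longrightarrow> L2_set (\<lambda>x. cmod (\<sigma> k x - f x)) F \<le> e / 2"
        using lim[of "e / 2"] by auto
      have "hdist (ell2 X) (\<sigma> k) f \<le> e / 2" if "k \<ge> N" for k
        unfolding ell2_hdist[OF \<sigma> fe] by (rule ell2_norm_leI[OF ell2_diff[OF \<sigma> fe]]) (use N that in blast)
      then have "hdist (ell2 X) (\<sigma> k) f < e" if "k \<ge> N" for k
        using that \<open>e > 0\<close> by (smt (verit) field_sum_of_halves)
      then show "\<exists>N. \<forall>k\<ge>N. \<sigma> k \<in> carrier (ell2 X) \<and> hdist (ell2 X) (\<sigma> k) f < e"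
        using \<sigma> by blast
    qed (rule fe)
    then show "\<exists>f. limitin mtopology \<sigma> f sequentially" by blast
  qed
qed

theorem hilbert_space_ell2: "hilbert_space (ell2 X)"
proof (intro hilbert_space.intro module_ell2 hilbert_space_axioms.intro ell2_complete)
  fix f g h c assume f: "f \<in> carrier (ell2 X)" and g: "g \<in> carrier (ell2 X)"
  show "hinner (ell2 X) (f \<oplus>\<^bsub>ell2 X\<^esub> g) h = hinner (ell2 X) f h + hinner (ell2 X) g h"
    if "h \<in> carrier (ell2 X)"
    using ell2_hinner_summable[OF f that] ell2_hinner_summable[OF g that]
    by (simp add: distrib_right infsum_add)
  show "hinner (ell2 X) (c \<odot>\<^bsub>ell2 X\<^esub> f) g = c * hinner (ell2 X) f g"
    by (simp add: mult.assoc infsum_cmult_right')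
  show "hinner (ell2 X) g f = cnj (hinner (ell2 X) f g)"
    by (simp flip: infsum_cnj add: mult.commute)
next
  fix f assume f: "f \<in> carrier (ell2 X)"
  show "0 \<le> Re (hinner (ell2 X) f f)"
    unfolding ell2_hinner_self[OF f] by (simp add: infsum_nonneg)
  show "f = \<zero>\<^bsub>ell2 X\<^esub>" if "hinner (ell2 X) f f = 0"
  proof -
    have "(\<Sum>\<^sub>\<infinity>x\<in>X. (cmod (f x))\<^sup>2) = 0"
      using that unfolding ell2_hinner_self[OF f] by simp
    from ell2_norm_eq_0[OF f this] show ?thesis by auto
  qed
qed

text \<open>\<open>\<ell>\<^sup>2(X \<times> Y)\<close> is a tensor product of \<open>\<ell>\<^sup>2(X)\<close> and \<open>\<ell>\<^sup>2(Y)\<close>.\<close>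

lemma ell2_finsum:
  assumes "finite I" "\<And>i. i \<in> I \<Longrightarrow> f i \<in> carrier (ell2 X)"
  shows "finsum (ell2 X) f I = (\<lambda>x. \<Sum>i\<in>I. f i x)"
proof -
  interpret abelian_group "ell2 X" by (rule abelian_group_ell2)
  show ?thesis using assms
  proof (induction I)
    case (insert i I)
    then have "finsum (ell2 X) f (insert i I) = f i \<oplus>\<^bsub>ell2 X\<^esub> finsum (ell2 X) f I"
      by (intro finsum_insert) auto
    then show ?case using insert by simp
  qed simp
qed

lemma ell2_tensor_in:
  assumes "f \<in> carrier (ell2 X)" "g \<in> carrier (ell2 Y)"
  shows "(\<lambda>(x, y). f x * g y) \<in> carrier (ell2 (X \<times> Y))"
proof -
  have "(\<lambda>(x, y). (cmod (f x))\<^sup>2 * (cmod (g y))\<^sup>2) summable_on (X \<times> Y)"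
    using assms by (intro summable_on_SigmaI[where g = "\<lambda>x. (cmod (f x))\<^sup>2 * (\<Sum>\<^sub>\<infinity>y\<in>Y. (cmod (g y))\<^sup>2)"])
      (auto simp: ell2_iff intro!: has_sum_cmult_right summable_on_cmult_left)
  then show ?thesis
    using assms by (auto simp: ell2_iff case_prod_unfold norm_mult power_mult_distrib)
qed

theorem hilbert_tensor_ell2:
  "hilbert_tensor (ell2 X) (ell2 Y) (ell2 (X \<times> Y)) (\<lambda>f g (x, y). f x * g y)"
proof -
  interpret Metric_space "carrier (ell2 (X \<times> Y))" "hdist (ell2 (X \<times> Y))"
    by (rule Metric_space_ell2)
  let ?t = "\<lambda>f g (x, y). f x * g y :: complex"
  let ?D = "{finsum (ell2 (X \<times> Y)) (\<lambda>i. ?t (a i) (b i)) {..<k} | (k::nat) a b.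
      a \<in> {..<k} \<rightarrow> carrier (ell2 X) \<and> b \<in> {..<k} \<rightarrow> carrier (ell2 Y)}"
  have "h \<in> mtopology closure_of ?D" if h: "h \<in> carrier (ell2 (X \<times> Y))" for h
    unfolding metric_closure_of
  proof (intro CollectI conjI allI impI h)
    fix r :: real assume "r > 0"
    define n where "n = (\<lambda>z. (cmod (h z))\<^sup>2)"
    have sn: "n summable_on (X \<times> Y)" using h by (simp add: ell2_iff n_def)
    obtain S where S: "finite S" "S \<subseteq> X \<times> Y" "dist (sum n S) (infsum n (X \<times> Y)) \<le> (r / 2)\<^sup>2"
      using infsum_finite_approximation[OF sn, of "(r / 2)\<^sup>2"] \<open>r > 0\<close> by auto
    obtain s where s: "bij_betw s {..<card S} S"
      using \<open>finite S\<close> ex_bij_betw_nat_finite[of S] by (auto simp: atLeast0LessThan)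
    have sS: "s i \<in> S" if "i < card S" for i using s that by (auto simp: bij_betw_def)
    define a where "a i x = (if x = fst (s i) then h (s i) else 0)" for i x
    define b where "b i y = (if y = snd (s i) then 1 else 0 :: complex)" for i y
    have fin: "(\<lambda>x. if x = u then c else 0) \<in> carrier (ell2 U)" if "u \<in> U" for u c and U :: "'u set"
    proof -
      have "(\<lambda>x. (cmod (if x = u then c else 0))\<^sup>2) summable_on {u}" by simp
      then have "(\<lambda>x. (cmod (if x = u then c else 0))\<^sup>2) summable_on U"
        by (rule summable_on_cong_neutral[THEN iffD1, rotated -1]) (use that in auto)
      then show ?thesis using that by (auto simp: ell2_iff)
    qed
    have a: "a i \<in> carrier (ell2 X)" and b: "b i \<in> carrier (ell2 Y)" if "i < card S" for i
      using S(2) sS[OF that] unfolding a_def b_def by (force intro!: fin)+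
    let ?f = "finsum (ell2 (X \<times> Y)) (\<lambda>i. ?t (a i) (b i)) {..<card S}"
    have "?f = (\<lambda>z. \<Sum>i<card S. ?t (a i) (b i) z)"
      by (rule ell2_finsum) (auto intro!: ell2_tensor_in a b)
    also have "\<dots> = (\<lambda>z. \<Sum>i<card S. if z = s i then h (s i) else 0)"
      by (intro ext sum.cong) (auto simp: a_def b_def prod_eq_iff split: prod.splits)
    also have "\<dots> = (\<lambda>z. \<Sum>w\<in>S. if z = w then h w else 0)"
      by (intro ext sum.reindex_bij_betw[OF s])
    also have "\<dots> = (\<lambda>z. if z \<in> S then h z else 0)" using \<open>finite S\<close> by auto
    finally have f: "?f = (\<lambda>z. if z \<in> S then h z else 0)" .
    have "(\<lambda>z. (cmod (if z \<in> S then h z else 0))\<^sup>2) summable_on (X \<times> Y)"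
      by (rule summable_on_comparison_test[OF sn]) (auto simp: n_def)
    then have f_in: "?f \<in> carrier (ell2 (X \<times> Y))"
      unfolding f using S(2) by (auto simp: ell2_iff)
    have "(\<Sum>\<^sub>\<infinity>z\<in>X \<times> Y. (cmod (h z - ?f z))\<^sup>2) = (\<Sum>\<^sub>\<infinity>z\<in>X \<times> Y - S. n z)"
      unfolding f by (rule infsum_cong_neutral) (auto simp: n_def)
    also have "\<dots> = infsum n (X \<times> Y) - sum n S"
      using S sn by (simp add: infsum_Diff)
    also have "\<dots> \<le> (r / 2)\<^sup>2" using S(3) by (simp add: dist_real_def)
    finally have "hdist (ell2 (X \<times> Y)) h ?f \<le> r / 2"
      unfolding ell2_hdist[OF h f_in] using \<open>r > 0\<close> by (intro real_le_lsqrt) auto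
    then have "?f \<in> mball h r" using \<open>r > 0\<close> h f_in by simp
    moreover have "?f \<in> ?D" using a b by (intro CollectI exI conjI refl) auto
    ultimately show "\<exists>f\<in>?D. f \<in> mball h r" by blast
  qed
  then have "mtopology closure_of ?D = carrier (ell2 (X \<times> Y))"
    using closure_of_subset_topspace[of mtopology ?D] by auto
  moreover have "hinner (ell2 (X \<times> Y)) (?t a b) (?t a' b') = hinner (ell2 X) a a' * hinner (ell2 Y) b b'"
    if "a \<in> carrier (ell2 X)" "a' \<in> carrier (ell2 X)" "b \<in> carrier (ell2 Y)" "b' \<in> carrier (ell2 Y)"
    for a a' b b'
  proof -
    have "hinner (ell2 (X \<times> Y)) (?t a b) (?t a' b')
        = (\<Sum>\<^sub>\<infinity>(x, y)\<in>X \<times> Y. (a x * cnj (a' x)) * (b y * cnj (b' y)))"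
      by (simp add: case_prod_unfold mult_ac)
    also have "\<dots> = (\<Sum>\<^sub>\<infinity>x\<in>X. \<Sum>\<^sub>\<infinity>y\<in>Y. (a x * cnj (a' x)) * (b y * cnj (b' y)))"
      using ell2_hinner_summable[OF ell2_tensor_in[OF that(1,3)] ell2_tensor_in[OF that(2,4)]]
      by (intro infsum_Sigma'_banach[symmetric]) (simp add: case_prod_unfold mult_ac)
    also have "\<dots> = hinner (ell2 X) a a' * hinner (ell2 Y) b b'"
      by (simp add: infsum_cmult_right' infsum_cmult_left')
    finally show ?thesis .
  qed
  ultimately show ?thesis
    unfolding hilbert_tensor_def
    by (auto simp: hilbert_space_ell2 ell2_tensor_in algebra_simps simp del: ell2_simps(4))
qed

end

theory Submission
  imports Defs "HOL-Algebra.Elementary_Groups"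
begin

text \<open>
  Let \<open>P = \<F>\<^sub>n \<times> \<F>\<^sub>m\<close> and let \<open>K\<close> be the quotient of \<open>\<F>\<^bsub>nm\<^esub>\<close> by \<open>G\<close>, which \<open>\<phi>\<close> embeds into \<open>P\<close>.

  (i) The left hand side is the left regular representation of \<open>P\<close> composed with \<open>\<phi>\<close>. Left
  translation by the image of \<open>\<phi>\<close> is free, so \<open>\<ell>\<^sup>2(P)\<close> splits into one copy of \<open>\<ell>\<^sup>2(K)\<close> for each right
  coset of the image. On the image the two components have equal exponent sums, hence there are
  infinitely many cosets.

  (ii) The quasi-regular representation generates the group von Neumann algebra \<open>M\<close> of \<open>K\<close>. In free
  groups, with \<open>s\<^sub>k = a\<^sup>kb\<^sup>k\<close> the conjugates \<open>s\<^sub>k w s\<^sub>k\<^sup>-\<^sup>1\<close> leave every finite set as \<open>k \<rightarrow> \<infinity>\<close>, for each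
  \<open>w \<noteq> 1\<close>; applied to both factors of \<open>P\<close> this provides a sequence in \<open>K\<close> with the same property.
  Therefore \<open>\<lambda>(s\<^sub>k) A \<lambda>(s\<^sub>k)\<^sup>*\<close> tends weakly to \<open>\<tau>(A)\<close> for all \<open>A\<close> in \<open>M\<close>, where \<open>\<tau>(A) = \<langle>A\<delta>\<^sub>1, \<delta>\<^sub>1\<rangle>\<close>, and
  the centre is trivial. Finiteness of the identity follows from \<open>\<tau>\<close> being a faithful trace. If \<open>pMp\<close> is
  commutative, then \<open>p \<lambda>(g) p \<lambda>(hg\<^sup>-\<^sup>1) p = p \<lambda>(hg\<^sup>-\<^sup>1) p \<lambda>(g) p\<close>; letting first \<open>g\<close> and then \<open>h\<close> run through
  the sequence gives \<open>\<tau>(p)\<^sup>3 = 0\<close>.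
\<close>

section \<open>Hilbert spaces and commutants\<close>

text \<open>Powers of a single generator a would not mix, since they commute with a; two generators
  cure this. Both factors of P must use the same k because the sequence has to lie in the image of
  \<phi>: the generators with i = j = 1 and i = j = 2 are mapped to (g_1, g_1) and (g_2, g_2), and
  this is where n, m \<ge> 2 enters. Elements of M commute with right translations, so A is encoded
  by the function \<open>A \<delta>\<^sub>1\<close>, whose value at y x^-1 is the matrix entry of A
  at (x, y). Conjugating A by \<lambda>(s_k) conjugates the argument, and a square summable function
  tends to 0 along a sequence that leaves every finite set. Uniform bounds turn such limits of
  entries into weak limits. For an abelian projection p put \<xi> =
  \<open>p \<delta>\<^sub>1\<close>, so that \<xi>(1) = \<tau>(p). The limit in g yields \<xi>(h^-1)
  \<xi>(h) = \<xi>(1) times the inner product of \<lambda>(h) \<rho>(h) \<xi> with \<xi>, where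
  \<rho> is right translation. Along h = s_k the left side vanishes, while \<lambda>(h) \<rho>(h)
  tends weakly to the projection onto \<open>\<delta>\<^sub>1\<close>. In (i) the space T is an
  arbitrary tensor product and its operators are definite descriptions, so T is identified with the
  square summable functions on P before anything is computed.\<close>

context hilbert_space
begin

section \<open>Inner product, norm and limits in an abstract Hilbert space\<close>

lemma complex_smult_closed [simp, intro]: "x \<in> carrier H \<Longrightarrow> c \<odot> x \<in> carrier H"
  by (rule smult_closed) (simp_all add: complex_ring_def)

lemma hinner_zero_left [simp]:
  assumes "z \<in> carrier H" shows "hinner H \<zero> z = 0"
  using hinner_add_left[of \<zero> \<zero> z] assms by simp

lemma hinner_zero_right [simp]:
  assumes "z \<in> carrier H" shows "hinner H z \<zero> = 0"
  using hinner_commute[of \<zero> z] assms by simp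

lemma hinner_add_right:
  assumes "x \<in> carrier H" "y \<in> carrier H" "z \<in> carrier H"
  shows "hinner H z (x \<oplus> y) = hinner H z x + hinner H z y"
  using assms hinner_commute[of x z] hinner_commute[of y z] hinner_commute[of "x \<oplus> y" z]
  by (simp add: hinner_add_left)

lemma hinner_smult_right:
  assumes "x \<in> carrier H" "y \<in> carrier H"
  shows "hinner H x (c \<odot> y) = cnj c * hinner H x y"
  using assms hinner_commute[of y x] hinner_commute[of "c \<odot> y" x] by (simp add: hinner_smult_left)

lemma hinner_uminus_left:
  assumes "x \<in> carrier H" "y \<in> carrier H"
  shows "hinner H (\<ominus> x) y = - hinner H x y"
proof -
  have "hinner H (x \<oplus> \<ominus> x) y = hinner H x y + hinner H (\<ominus> x) y"
    using assms by (intro hinner_add_left) auto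
  then show ?thesis using assms by (simp add: M.r_neg eq_neg_iff_add_eq_0 add.commute)
qed

lemma hinner_minus_left:
  assumes "x \<in> carrier H" "y \<in> carrier H" "z \<in> carrier H"
  shows "hinner H (x \<ominus> y) z = hinner H x z - hinner H y z"
  using assms by (simp add: M.minus_eq hinner_add_left hinner_uminus_left)

lemma hinner_minus_right:
  assumes "x \<in> carrier H" "y \<in> carrier H" "z \<in> carrier H"
  shows "hinner H z (x \<ominus> y) = hinner H z x - hinner H z y"
  using assms hinner_commute[of x z] hinner_commute[of y z] hinner_commute[of "x \<ominus> y" z]
  by (simp add: hinner_minus_left)

lemma minus_eq_zero_iff:
  assumes "x \<in> carrier H" "y \<in> carrier H"
  shows "x \<ominus> y = \<zero> \<longleftrightarrow> x = y"
proof
  assume "x \<ominus> y = \<zero>"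
  then have "y = x" using assms M.minus_equality[of x "\<ominus> y"] by (simp add: M.minus_eq)
  then show "x = y" ..
qed (use assms in \<open>simp add: M.minus_eq M.r_neg\<close>)

lemma minus_zero [simp]: "x \<in> carrier H \<Longrightarrow> x \<ominus> \<zero> = x"
  by (simp add: M.minus_eq)

lemma hinner_self: "x \<in> carrier H \<Longrightarrow> hinner H x x = complex_of_real ((hnorm H x)\<^sup>2)"
  using hinner_commute[of x x] hinner_nonneg[of x]
  by (auto simp: hnorm_def complex_eq_iff)

lemma hnorm_nonneg [simp]: "x \<in> carrier H \<Longrightarrow> 0 \<le> hnorm H x"
  by (simp add: hnorm_def hinner_nonneg)

lemma hnorm_sq: "x \<in> carrier H \<Longrightarrow> (hnorm H x)\<^sup>2 = Re (hinner H x x)"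
  by (simp add: hnorm_def hinner_nonneg)

lemma hnorm_eq_zero_iff: "x \<in> carrier H \<Longrightarrow> hnorm H x = 0 \<longleftrightarrow> x = \<zero>"
  using hinner_self[of x] hinner_eq_zero[of x] by (auto simp: hnorm_def)

lemma hnorm_zero [simp]: "hnorm H \<zero> = 0"
  by (simp add: hnorm_eq_zero_iff)

lemma hinner_ext:
  assumes "x \<in> carrier H" "y \<in> carrier H" "\<And>z. z \<in> carrier H \<Longrightarrow> hinner H x z = hinner H y z"
  shows "x = y"
  using assms hinner_eq_zero[of "x \<ominus> y"] by (simp add: hinner_minus_left minus_eq_zero_iff)

lemma hnorm_smult:
  assumes "x \<in> carrier H" shows "hnorm H (c \<odot> x) = cmod c * hnorm H x"
proof (rule power2_eq_imp_eq)
  have "hinner H (c \<odot> x) (c \<odot> x) = complex_of_real ((cmod c)\<^sup>2) * hinner H x x"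
    using assms complex_norm_square[of c] by (simp add: hinner_smult_left hinner_smult_right)
  then show "(hnorm H (c \<odot> x))\<^sup>2 = (cmod c * hnorm H x)\<^sup>2"
    using assms by (simp add: hnorm_sq power_mult_distrib)
qed (use assms in auto)

lemma Cauchy_Schwarz:
  assumes x: "x \<in> carrier H" and y: "y \<in> carrier H"
  shows "cmod (hinner H x y) \<le> hnorm H x * hnorm H y"
proof (cases "y = \<zero>")
  case True
  then show ?thesis using x by simp
next
  case False
  define a where "a = hinner H x y"
  define s where "s = (hnorm H y)\<^sup>2"
  have s: "s > 0" using y False by (simp add: s_def hnorm_eq_zero_iff)
  \<comment> \<open>The coefficient of the orthogonal projection of x onto y; nonnegativity of the
    squared norm of \<open>?z\<close> is the claim divided by the squared norm of y.\<close>
  define c where "c = a / complex_of_real s"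
  let ?z = "x \<ominus> c \<odot> y"
  have yx: "hinner H y x = cnj a" unfolding a_def using x y by (rule hinner_commute)
  have "hinner H ?z ?z = hinner H x x - cnj c * a - c * cnj a + c * cnj c * complex_of_real s"
    using x y hinner_self[OF y] yx
    by (simp add: hinner_minus_left hinner_minus_right hinner_smult_left hinner_smult_right
        s_def a_def[symmetric] algebra_simps)
  also have "\<dots> = hinner H x x - a * cnj a / complex_of_real s"
    using s by (simp add: c_def field_simps)
  also have "\<dots> = complex_of_real ((hnorm H x)\<^sup>2 - (cmod a)\<^sup>2 / s)"
    using x by (simp add: hinner_self complex_norm_square[symmetric] flip: of_real_power)
  finally have "0 \<le> (hnorm H x)\<^sup>2 - (cmod a)\<^sup>2 / s"
    using hinner_nonneg[of ?z] x y by simp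
  then have "(cmod a)\<^sup>2 \<le> (hnorm H x * hnorm H y)\<^sup>2"
    using s by (simp add: field_simps s_def)
  then show ?thesis unfolding a_def by (rule power2_le_imp_le) (use x y in auto)
qed

lemma hnorm_triangle:
  assumes x: "x \<in> carrier H" and y: "y \<in> carrier H"
  shows "hnorm H (x \<oplus> y) \<le> hnorm H x + hnorm H y"
proof (rule power2_le_imp_le)
  have "(hnorm H (x \<oplus> y))\<^sup>2 = (hnorm H x)\<^sup>2 + 2 * Re (hinner H x y) + (hnorm H y)\<^sup>2"
    using x y hinner_commute[OF x y] by (simp add: hnorm_sq hinner_add_left hinner_add_right)
  also have "Re (hinner H x y) \<le> hnorm H x * hnorm H y"
    using Cauchy_Schwarz[OF x y] complex_Re_le_cmod order_trans by blast
  finally show "(hnorm H (x \<oplus> y))\<^sup>2 \<le> (hnorm H x + hnorm H y)\<^sup>2"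
    by (simp add: power2_sum)
qed (use x y in auto)

lemma hnorm_uminus: "x \<in> carrier H \<Longrightarrow> hnorm H (\<ominus> x) = hnorm H x"
  using hinner_commute[of "\<ominus> x" x] by (simp add: hnorm_def hinner_uminus_left)

lemma hnorm_minus_commute:
  assumes "x \<in> carrier H" "y \<in> carrier H"
  shows "hnorm H (x \<ominus> y) = hnorm H (y \<ominus> x)"
proof -
  have "hnorm H (x \<ominus> y) = hnorm H (\<ominus> (x \<ominus> y))" using assms by (simp add: hnorm_uminus)
  also have "\<ominus> (x \<ominus> y) = y \<ominus> x" using assms by (simp add: M.minus_eq M.minus_add M.a_comm)
  finally show ?thesis .
qed

lemma hnorm_minus_triangle:
  assumes "x \<in> carrier H" "y \<in> carrier H" "z \<in> carrier H"
  shows "hnorm H (x \<ominus> z) \<le> hnorm H (x \<ominus> y) + hnorm H (y \<ominus> z)"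
proof -
  have "x \<ominus> z = (x \<ominus> y) \<oplus> (y \<ominus> z)"
    using assms by (intro hinner_ext) (auto simp: hinner_minus_left hinner_add_left)
  then show ?thesis using hnorm_triangle[of "x \<ominus> y" "y \<ominus> z"] assms by simp
qed

lemma Metric_space_hdist: "Metric_space (carrier H) (hdist H)"
proof
  show "0 \<le> hdist H x y" for x y by (simp add: hdist_def)
  show "hdist H x y = hdist H y x" for x y by (auto simp: hdist_def hnorm_minus_commute)
  show "hdist H x y = 0 \<longleftrightarrow> x = y" if "x \<in> carrier H" "y \<in> carrier H" for x y
    using that by (simp add: hdist_def hnorm_eq_zero_iff minus_eq_zero_iff)
  show "hdist H x z \<le> hdist H x y + hdist H y z"
    if "x \<in> carrier H" "y \<in> carrier H" "z \<in> carrier H" for x y z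
    using that by (simp add: hdist_def hnorm_minus_triangle)
qed

lemma Cauchy_limit:
  assumes z: "\<And>k. z k \<in> carrier H"
    and cauchy: "\<And>e. e > 0 \<Longrightarrow> \<exists>N. \<forall>k\<ge>N. \<forall>l\<ge>N. hnorm H (z k \<ominus> z l) < e"
  obtains x where "x \<in> carrier H" "(\<lambda>k. hnorm H (z k \<ominus> x)) \<longlonglongrightarrow> 0"
proof -
  interpret Metric_space "carrier H" "hdist H" by (rule Metric_space_hdist)
  have "MCauchy z" unfolding MCauchy_def using z cauchy by (auto simp: hdist_def)
  then obtain x where x: "limitin mtopology z x sequentially"
    using complete unfolding mcomplete_def by blast
  then have xH: "x \<in> carrier H" by (simp add: limit_metric_sequentially)
  have "(\<lambda>k. hdist H (z k) x) \<longlonglongrightarrow> 0"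
    using x limitin_metric_dist_null z by blast
  then show ?thesis using that[OF xH] z xH by (simp add: hdist_def)
qed

lemma tendsto_hinner_left:
  assumes "\<And>k. z k \<in> carrier H" "x \<in> carrier H" "y \<in> carrier H"
    and lim: "(\<lambda>k. hnorm H (z k \<ominus> x)) \<longlonglongrightarrow> 0"
  shows "(\<lambda>k. hinner H (z k) y) \<longlonglongrightarrow> hinner H x y"
proof (rule LIM_zero_cancel, rule Lim_null_comparison)
  show "\<forall>\<^sub>F k in sequentially. norm (hinner H (z k) y - hinner H x y) \<le> hnorm H (z k \<ominus> x) * hnorm H y"
    using assms Cauchy_Schwarz[of "z k \<ominus> x" y for k] by (auto simp: hinner_minus_left)
  show "(\<lambda>k. hnorm H (z k \<ominus> x) * hnorm H y) \<longlonglongrightarrow> 0"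
    using tendsto_mult_right[OF lim, of "hnorm H y"] by simp
qed

lemma tendsto_hnorm:
  assumes "\<And>k. z k \<in> carrier H" "x \<in> carrier H"
    and lim: "(\<lambda>k. hnorm H (z k \<ominus> x)) \<longlonglongrightarrow> 0"
  shows "(\<lambda>k. hnorm H (z k)) \<longlonglongrightarrow> hnorm H x"
proof (rule LIM_zero_cancel, rule Lim_null_comparison[OF _ lim])
  \<comment> \<open>The reverse triangle inequality: the triangle inequality in both directions with
    third point \<zero>.\<close>
  have "norm (hnorm H (z k) - hnorm H x) \<le> hnorm H (z k \<ominus> x)" for k
    using hnorm_minus_triangle[of "z k" x \<zero>] hnorm_minus_triangle[of x "z k" \<zero>] assms(1)[of k] assms(2)
      hnorm_minus_commute[of x "z k"]
    by (simp add: minus_zero abs_le_iff)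
  then show "\<forall>\<^sub>F k in sequentially. norm (hnorm H (z k) - hnorm H x) \<le> hnorm H (z k \<ominus> x)" by simp
qed

lemma hinner_finsum_left:
  assumes "finite F" "\<And>i. i \<in> F \<Longrightarrow> f i \<in> carrier H" "z \<in> carrier H"
  shows "hinner H (finsum H f F) z = (\<Sum>i\<in>F. hinner H (f i) z)"
  using assms
proof (induction F)
  case (insert i F)
  have "finsum H f (insert i F) = f i \<oplus> finsum H f F"
    using insert by (intro M.finsum_insert) auto
  then show ?case using insert by (simp add: hinner_add_left Pi_def)
qed simp

end

section \<open>Bounded operators, adjoints and commutants\<close>

lemma bounded_opsD:
  assumes "A \<in> bounded_ops H"
  shows "A \<in> extensional (carrier H)"
    and "\<And>x. x \<in> carrier H \<Longrightarrow> A x \<in> carrier H"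
    and "\<And>x y. \<lbrakk>x \<in> carrier H; y \<in> carrier H\<rbrakk> \<Longrightarrow> A (x \<oplus>\<^bsub>H\<^esub> y) = A x \<oplus>\<^bsub>H\<^esub> A y"
    and "\<And>c x. x \<in> carrier H \<Longrightarrow> A (c \<odot>\<^bsub>H\<^esub> x) = c \<odot>\<^bsub>H\<^esub> A x"
  using assms by (auto simp: bounded_ops_def PiE_def)

lemma (in hilbert_space) bounded_ops_bound:
  assumes "A \<in> bounded_ops H"
  obtains C where "C \<ge> 0" "\<And>x. x \<in> carrier H \<Longrightarrow> hnorm H (A x) \<le> C * hnorm H x"
proof -
  obtain C where C: "\<And>x. x \<in> carrier H \<Longrightarrow> hnorm H (A x) \<le> C * hnorm H x"
    using assms unfolding bounded_ops_def by blast
  have "hnorm H (A x) \<le> max C 0 * hnorm H x" if "x \<in> carrier H" for x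
    using C[OF that] mult_right_mono[of C "max C 0" "hnorm H x"] that by simp
  then show ?thesis using that[of "max C 0"] by simp
qed

lemma (in hilbert_space) is_adjoint_sym:
  assumes "is_adjoint H A B" shows "is_adjoint H B A"
  unfolding is_adjoint_def
proof (intro conjI ballI)
  fix x y assume xy: "x \<in> carrier H" "y \<in> carrier H"
  have A: "A \<in> bounded_ops H" and B: "B \<in> bounded_ops H" using assms by (auto simp: is_adjoint_def)
  have "hinner H (B x) y = cnj (hinner H y (B x))"
    using xy bounded_opsD[OF B] by (intro hinner_commute) auto
  also have "hinner H y (B x) = hinner H (A y) x" using assms xy by (simp add: is_adjoint_def)
  also have "cnj (hinner H (A y) x) = hinner H x (A y)"
    using xy bounded_opsD[OF A] by (intro hinner_commute[symmetric]) auto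
  finally show "hinner H (B x) y = hinner H x (A y)" .
qed (use assms in \<open>auto simp: is_adjoint_def\<close>)

lemma is_adjointD:
  assumes "is_adjoint H A B"
  shows "A \<in> bounded_ops H" "B \<in> bounded_ops H"
    "\<And>x y. \<lbrakk>x \<in> carrier H; y \<in> carrier H\<rbrakk> \<Longrightarrow> hinner H (A x) y = hinner H x (B y)"
  using assms by (auto simp: is_adjoint_def)

lemma commutant_subset: "commutant H S \<subseteq> bounded_ops H"
  by (auto simp: commutant_def)

lemma commutant_antimono: "S \<subseteq> S' \<Longrightarrow> commutant H S' \<subseteq> commutant H S"
  by (auto simp: commutant_def)

lemma commutantD:
  assumes "A \<in> commutant H S" "B \<in> S" "x \<in> carrier H"
  shows "A (B x) = B (A x)"
proof -
  have "compose (carrier H) A B x = compose (carrier H) B A x" using assms by (simp add: commutant_def)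
  then show ?thesis using assms(3) by (simp add: compose_eq)
qed

lemma commutantI:
  assumes "A \<in> bounded_ops H" "\<And>B x. B \<in> S \<Longrightarrow> x \<in> carrier H \<Longrightarrow> A (B x) = B (A x)"
  shows "A \<in> commutant H S"
  using assms by (auto simp: commutant_def compose_def fun_eq_iff)

lemma subset_double_commutant:
  assumes "S \<subseteq> bounded_ops H" shows "S \<subseteq> commutant H (commutant H S)"
  using assms by (auto intro!: commutantI dest: commutantD)

lemma triple_commutant:
  assumes "S \<subseteq> bounded_ops H"
  shows "commutant H (commutant H (commutant H S)) = commutant H S"
  using commutant_antimono[OF subset_double_commutant[OF assms]]
    subset_double_commutant[OF commutant_subset] by (metis subset_antisym)

text \<open>Taking adjoints in A D = D A, where D is the adjoint of C, gives C B = B C.\<close>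

lemma (in hilbert_space) commutant_adjoint_closed:
  assumes S: "\<And>C. C \<in> S \<Longrightarrow> \<exists>D\<in>S. is_adjoint H C D"
    and A: "A \<in> commutant H S" and AB: "is_adjoint H A B"
  shows "B \<in> commutant H S"
proof (rule commutantI)
  show B: "B \<in> bounded_ops H" using AB by (simp add: is_adjoint_def)
  have A': "A \<in> bounded_ops H" using AB by (simp add: is_adjoint_def)
  fix C x assume "C \<in> S" and x: "x \<in> carrier H"
  from S[OF \<open>C \<in> S\<close>] obtain D where "D \<in> S" and "is_adjoint H C D" by blast
  from is_adjoint_sym[OF this(2)] have DC: "is_adjoint H D C" .
  note cl = bounded_opsD(2)[OF A'] bounded_opsD(2)[OF B] bounded_opsD(2)[OF is_adjointD(1)[OF DC]]
    bounded_opsD(2)[OF is_adjointD(2)[OF DC]]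
  show "B (C x) = C (B x)"
  proof (rule hinner_ext)
    fix z assume z: "z \<in> carrier H"
    have "hinner H z (B (C x)) = hinner H (A z) (C x)" using is_adjointD(3)[OF AB] z x cl by simp
    also have "\<dots> = hinner H (D (A z)) x" using is_adjointD(3)[OF DC] z x cl by simp
    also have "\<dots> = hinner H (A (D z)) x" using commutantD[OF A \<open>D \<in> S\<close> z] by simp
    also have "\<dots> = hinner H z (C (B x))"
      using is_adjointD(3)[OF AB] is_adjointD(3)[OF DC] z x cl by simp
    finally show "hinner H (B (C x)) z = hinner H (C (B x)) z"
      using hinner_commute[of z "B (C x)"] hinner_commute[of z "C (B x)"] z x cl by simp
  qed (use x cl in auto)
qed

text \<open>\<open>commutant_adjoint_closed\<close> is used twice. The second use, for the outer
  commutant, asks for an adjoint of each element of \<open>commutant H S\<close> inside that set: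
  \<open>adj\<close> provides it and the first use places it there.\<close>

lemma (in hilbert_space) von_neumann_double_commutant:
  assumes S: "S \<subseteq> bounded_ops H" "\<And>C. C \<in> S \<Longrightarrow> \<exists>D\<in>S. is_adjoint H C D"
    and adj: "\<And>A. A \<in> bounded_ops H \<Longrightarrow> \<exists>B. is_adjoint H A B"
  shows "von_neumann_algebra H (commutant H (commutant H S))"
  unfolding von_neumann_algebra_def
proof (intro conjI ballI allI impI)
  show "commutant H (commutant H (commutant H (commutant H S))) = commutant H (commutant H S)"
    by (rule triple_commutant[OF commutant_subset])
  fix A B assume "A \<in> commutant H (commutant H S)" "is_adjoint H A B"
  moreover have "\<exists>D\<in>commutant H S. is_adjoint H C D" if "C \<in> commutant H S" for C
  proof -
    have "C \<in> bounded_ops H" using that commutant_subset by (rule set_rev_mp)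
    then obtain D where "is_adjoint H C D" using adj by blast
    then show ?thesis using commutant_adjoint_closed[OF S(2) that] by blast
  qed
  ultimately show "B \<in> commutant H (commutant H S)"
    by (rule commutant_adjoint_closed[rotated])
qed (rule commutant_subset)

section \<open>Operators on square summable functions\<close>

declare ell2_simps(4) [simp del]

interpretation ell2: hilbert_space "ell2 X" for X
  by (rule hilbert_space_ell2)

text \<open>The multiple c of the point mass at x, written \<open>\<delta>\<^sub>x\<close> below
  when c = 1. The scalar belongs to the vector because functionals are later assumed to be additive
  only, so that it cannot be pulled out of them.\<close>

definition single :: "complex \<Rightarrow> 'a \<Rightarrow> 'a \<Rightarrow> complex" where
  "single c x = (\<lambda>y. if y = x then c else 0)"

definition restrict0 :: "'a set \<Rightarrow> ('a \<Rightarrow> complex) \<Rightarrow> 'a \<Rightarrow> complex" where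
  "restrict0 F f = (\<lambda>y. if y \<in> F then f y else 0)"

lemma restrict0_insert:
  "x \<notin> F \<Longrightarrow> restrict0 (insert x F) f = (\<lambda>y. single (f x) x y + restrict0 F f y)"
  by (auto simp: restrict0_def single_def fun_eq_iff)

lemma restrict0_in_ell2:
  assumes "finite F" "F \<subseteq> X"
  shows "restrict0 F f \<in> carrier (ell2 X)"
proof -
  have "(\<lambda>y. (cmod (restrict0 F f y))\<^sup>2) summable_on F" using assms(1) by simp
  then have "(\<lambda>y. (cmod (restrict0 F f y))\<^sup>2) summable_on X"
    by (rule summable_on_cong_neutral[THEN iffD1, rotated -1]) (use assms(2) in \<open>auto simp: restrict0_def\<close>)
  then show ?thesis using assms(2) by (auto simp: ell2_iff restrict0_def)
qed

lemma single_in_ell2 [simp, intro]: "x \<in> X \<Longrightarrow> single c x \<in> carrier (ell2 X)"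
  using restrict0_in_ell2[of "{x}" X "\<lambda>_. c"] by (simp add: restrict0_def single_def)

lemma single_smult: "single c x = (\<lambda>y. c * single 1 x y)"
  by (auto simp: single_def)

lemma hinner_restrict0_right:
  assumes "finite F" "F \<subseteq> X"
  shows "hinner (ell2 X) f (restrict0 F g) = (\<Sum>x\<in>F. f x * cnj (g x))"
proof -
  have "hinner (ell2 X) f (restrict0 F g) = (\<Sum>\<^sub>\<infinity>x\<in>F. f x * cnj (g x))"
    unfolding ell2_simps by (rule infsum_cong_neutral) (use assms in \<open>auto simp: restrict0_def\<close>)
  then show ?thesis using assms by simp
qed

lemma hinner_single_right:
  "x \<in> X \<Longrightarrow> hinner (ell2 X) f (single c x) = f x * cnj c"
  using hinner_restrict0_right[of "{x}" X f "\<lambda>_. c"] by (simp add: restrict0_def single_def)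

lemma hinner_single_left:
  assumes "x \<in> X" "f \<in> carrier (ell2 X)" shows "hinner (ell2 X) (single c x) f = c * cnj (f x)"
  using ell2.hinner_commute[of f X "single c x"] assms by (simp add: hinner_single_right)

lemma hnorm_restrict0:
  assumes "finite F" "F \<subseteq> X"
  shows "hnorm (ell2 X) (restrict0 F f) = L2_set (\<lambda>x. cmod (f x)) F"
proof -
  have "hinner (ell2 X) (restrict0 F f) (restrict0 F f) = (\<Sum>x\<in>F. complex_of_real ((cmod (f x))\<^sup>2))"
    unfolding hinner_restrict0_right[OF assms] complex_norm_square
    by (intro sum.cong) (auto simp: restrict0_def)
  then show ?thesis by (simp add: hnorm_def L2_set_def flip: of_real_sum of_real_power)
qed

lemma hnorm_single: "x \<in> X \<Longrightarrow> hnorm (ell2 X) (single c x) = cmod c"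
  using hnorm_restrict0[of "{x}" X "\<lambda>_. c"] by (simp add: restrict0_def single_def)

section \<open>Reduction to finitely supported functions and point masses\<close>

lemma ell2_approx:
  assumes f: "f \<in> carrier (ell2 X)" and "e > 0"
  obtains F where "finite F" "F \<subseteq> X" "hnorm (ell2 X) (\<lambda>x. f x - restrict0 F f x) < e"
proof -
  define n where "n = (\<lambda>z. (cmod (f z))\<^sup>2)"
  have sn: "n summable_on X" using f by (simp add: ell2_iff n_def)
  obtain F where F: "finite F" "F \<subseteq> X" "dist (sum n F) (infsum n X) \<le> (e / 2)\<^sup>2"
    using infsum_finite_approximation[OF sn, of "(e / 2)\<^sup>2"] \<open>e > 0\<close> by auto
  have "(\<Sum>\<^sub>\<infinity>z\<in>X. (cmod (f z - restrict0 F f z))\<^sup>2) = (\<Sum>\<^sub>\<infinity>z\<in>X - F. n z)"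
    by (rule infsum_cong_neutral) (auto simp: n_def restrict0_def)
  also have "\<dots> = infsum n X - sum n F"
    using F sn by (simp add: infsum_Diff)
  also have "\<dots> \<le> (e / 2)\<^sup>2" using F(3) by (simp add: dist_real_def)
  finally have "hnorm (ell2 X) (\<lambda>x. f x - restrict0 F f x) \<le> e / 2"
    unfolding ell2_hnorm[OF ell2_diff[OF f restrict0_in_ell2[OF F(1,2)]]]
    using \<open>e > 0\<close> by (intro real_le_lsqrt) auto
  then show ?thesis using that[OF F(1,2)] \<open>e > 0\<close> by linarith
qed

lemma additive_restrict0:
  fixes l :: "('a \<Rightarrow> complex) \<Rightarrow> complex"
  assumes "finite F" "F \<subseteq> X"
    and add: "\<And>f g. \<lbrakk>f \<in> carrier (ell2 X); g \<in> carrier (ell2 X)\<rbrakk> \<Longrightarrow> l (\<lambda>x. f x + g x) = l f + l g"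
  shows "l (restrict0 F f) = (\<Sum>x\<in>F. l (single (f x) x))"
  using assms(1,2)
proof (induction F)
  case empty
  have "l (\<lambda>x. 0) = 0" using add[of "\<lambda>x. 0" "\<lambda>x. 0"] by (simp add: ell2_zero)
  then show ?case by (simp add: restrict0_def)
next
  case (insert x F)
  have "l (restrict0 (insert x F) f) = l (single (f x) x) + l (restrict0 F f)"
    unfolding restrict0_insert[OF insert.hyps(2)]
    using insert by (intro add) (auto simp: restrict0_in_ell2)
  then show ?case using insert by simp
qed

text \<open>
  Real linearity suffices, so that the lemma applies to both arguments of a sesquilinear form.
\<close>

lemma ell2_functional_tendsto_0:
  fixes l :: "nat \<Rightarrow> ('a \<Rightarrow> complex) \<Rightarrow> complex"
  assumes add: "\<And>k f g. \<lbrakk>f \<in> carrier (ell2 X); g \<in> carrier (ell2 X)\<rbrakk>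
      \<Longrightarrow> l k (\<lambda>x. f x + g x) = l k f + l k g"
    and bound: "\<And>k f. f \<in> carrier (ell2 X) \<Longrightarrow> cmod (l k f) \<le> C * hnorm (ell2 X) f"
    and lim: "\<And>x c. x \<in> X \<Longrightarrow> (\<lambda>k. l k (single c x)) \<longlonglongrightarrow> 0"
    and u: "u \<in> carrier (ell2 X)"
  shows "(\<lambda>k. l k u) \<longlonglongrightarrow> 0"
proof (rule LIMSEQ_I)
  fix e :: real assume "e > 0"
  \<comment> \<open>The tail may contribute at most e / 2. \<open>C\<close> is not known to be
    nonnegative, so \<bar>C\<bar> + 1 serves as a positive bound by which one can divide.\<close>
  define e' where "e' = e / (2 * (\<bar>C\<bar> + 1))"
  have "e' > 0" using \<open>e > 0\<close> by (simp add: e'_def)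
  obtain F where F: "finite F" "F \<subseteq> X" "hnorm (ell2 X) (\<lambda>x. u x - restrict0 F u x) < e'"
    using ell2_approx[OF u \<open>e' > 0\<close>] .
  let ?w = "\<lambda>x. u x - restrict0 F u x"
  have r: "restrict0 F u \<in> carrier (ell2 X)" by (rule restrict0_in_ell2[OF F(1,2)])
  have w: "?w \<in> carrier (ell2 X)" by (rule ell2_diff[OF u r])
  have "(\<lambda>k. l k (restrict0 F u)) \<longlonglongrightarrow> (\<Sum>x\<in>F. 0)"
  proof -
    have "l k (restrict0 F u) = (\<Sum>x\<in>F. l k (single (u x) x))" for k
      by (rule additive_restrict0[OF F(1,2), where l = "l k"]) (rule add)
    moreover have "(\<lambda>k. \<Sum>x\<in>F. l k (single (u x) x)) \<longlonglongrightarrow> (\<Sum>x\<in>F. 0)"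
      using F by (intro tendsto_sum lim) blast
    ultimately show ?thesis by simp
  qed
  then obtain N where N: "\<And>k. k \<ge> N \<Longrightarrow> cmod (l k (restrict0 F u)) < e / 2"
    using LIMSEQ_D[of "\<lambda>k. l k (restrict0 F u)" 0 "e / 2"] \<open>e > 0\<close> by auto
  have "cmod (l k u) < e" if "k \<ge> N" for k
  proof -
    have "cmod (l k ?w) \<le> C * hnorm (ell2 X) ?w" by (rule bound[OF w])
    also have "\<dots> \<le> (\<bar>C\<bar> + 1) * hnorm (ell2 X) ?w"
      using ell2.hnorm_nonneg[OF w] by (intro mult_right_mono) auto
    also have "\<dots> \<le> (\<bar>C\<bar> + 1) * e'" using F(3) by (intro mult_left_mono) auto
    also have "\<dots> = e / 2" by (simp add: e'_def field_simps add_nonneg_eq_0_iff)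
    finally have "cmod (l k ?w) \<le> e / 2" .
    moreover have "l k u = l k (restrict0 F u) + l k ?w" using add[OF r w] by simp
    then have "cmod (l k u) \<le> cmod (l k (restrict0 F u)) + cmod (l k ?w)"
      by (simp only: norm_triangle_ineq)
    ultimately show ?thesis using N[OF that] by linarith
  qed
  then show "\<exists>N. \<forall>k\<ge>N. norm (l k u - 0) < e" by auto
qed

lemma ell2_functional_eq_0:
  fixes l :: "('a \<Rightarrow> complex) \<Rightarrow> complex"
  assumes "\<And>f g. \<lbrakk>f \<in> carrier (ell2 X); g \<in> carrier (ell2 X)\<rbrakk> \<Longrightarrow> l (\<lambda>x. f x + g x) = l f + l g"
    and "\<And>f. f \<in> carrier (ell2 X) \<Longrightarrow> cmod (l f) \<le> C * hnorm (ell2 X) f"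
    and "\<And>x c. x \<in> X \<Longrightarrow> l (single c x) = 0"
    and "u \<in> carrier (ell2 X)"
  shows "l u = 0"
  using ell2_functional_tendsto_0[of X "\<lambda>_. l" C u] assms by (simp add: LIMSEQ_const_iff)

lemma ell2_functional_ext:
  fixes l l' :: "('a \<Rightarrow> complex) \<Rightarrow> complex"
  assumes "\<And>f g. \<lbrakk>f \<in> carrier (ell2 X); g \<in> carrier (ell2 X)\<rbrakk> \<Longrightarrow> l (\<lambda>x. f x + g x) = l f + l g"
    and "\<And>f g. \<lbrakk>f \<in> carrier (ell2 X); g \<in> carrier (ell2 X)\<rbrakk> \<Longrightarrow> l' (\<lambda>x. f x + g x) = l' f + l' g"
    and bd: "\<And>f. f \<in> carrier (ell2 X) \<Longrightarrow> cmod (l f) \<le> C * hnorm (ell2 X) f"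
      "\<And>f. f \<in> carrier (ell2 X) \<Longrightarrow> cmod (l' f) \<le> C' * hnorm (ell2 X) f"
    and "\<And>x c. x \<in> X \<Longrightarrow> l (single c x) = l' (single c x)"
    and "u \<in> carrier (ell2 X)"
  shows "l u = l' u"
proof -
  have "l u - l' u = 0"
  proof (rule ell2_functional_eq_0[where X = X and l = "\<lambda>f. l f - l' f" and C = "C + C'"])
    fix f assume f: "f \<in> carrier (ell2 X)"
    show "cmod (l f - l' f) \<le> (C + C') * hnorm (ell2 X) f"
      using bd[OF f] norm_triangle_ineq4[of "l f" "l' f"] by (simp add: distrib_right)
  qed (use assms in auto)
  then show ?thesis by simp
qed

section \<open>Bounded operators as matrices\<close>

lemma bounded_ops_ell2_add:
  assumes "A \<in> bounded_ops (ell2 X)" "f \<in> carrier (ell2 X)" "g \<in> carrier (ell2 X)"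
  shows "A (\<lambda>x. f x + g x) = (\<lambda>x. A f x + A g x)"
  using bounded_opsD(3)[OF assms] by simp

lemma bounded_ops_ell2_smult:
  assumes "A \<in> bounded_ops (ell2 X)" "f \<in> carrier (ell2 X)"
  shows "A (\<lambda>x. c * f x) = (\<lambda>x. c * A f x)"
  using bounded_opsD(4)[OF assms] by simp

lemma bounded_ops_ell2_single:
  assumes "A \<in> bounded_ops (ell2 X)" "x \<in> X"
  shows "A (single c x) = (\<lambda>y. c * A (single 1 x) y)"
  unfolding single_smult[of c x] using assms by (intro bounded_ops_ell2_smult) auto

lemma ell2_hinner_add_left:
  "\<lbrakk>f \<in> carrier (ell2 X); g \<in> carrier (ell2 X); h \<in> carrier (ell2 X)\<rbrakk>
    \<Longrightarrow> hinner (ell2 X) (\<lambda>x. f x + g x) h = hinner (ell2 X) f h + hinner (ell2 X) g h"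
  using ell2.hinner_add_left[of f X g h] by simp

lemma ell2_hinner_add_right:
  "\<lbrakk>f \<in> carrier (ell2 X); g \<in> carrier (ell2 X); h \<in> carrier (ell2 X)\<rbrakk>
    \<Longrightarrow> hinner (ell2 X) h (\<lambda>x. f x + g x) = hinner (ell2 X) h f + hinner (ell2 X) h g"
  using ell2.hinner_add_right[of f X g h] by simp

lemma ell2_hinner_smult_left:
  "\<lbrakk>f \<in> carrier (ell2 X); h \<in> carrier (ell2 X)\<rbrakk>
    \<Longrightarrow> hinner (ell2 X) (\<lambda>x. c * f x) h = c * hinner (ell2 X) f h"
  using ell2.hinner_smult_left[of f X h c] by simp

lemma ell2_hinner_smult_right:
  "\<lbrakk>f \<in> carrier (ell2 X); h \<in> carrier (ell2 X)\<rbrakk>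
    \<Longrightarrow> hinner (ell2 X) h (\<lambda>x. c * f x) = cnj c * hinner (ell2 X) h f"
  using ell2.hinner_smult_right[of h X f c] by simp

text \<open>For fixed z both sides become bounded additive functionals of the argument after pairing
  with z, and these are determined by the point masses.\<close>

lemma ell2_op_ext:
  assumes A: "A \<in> bounded_ops (ell2 X)" and B: "B \<in> bounded_ops (ell2 X)"
    and eq: "\<And>x. x \<in> X \<Longrightarrow> A (single 1 x) = B (single 1 x)"
  shows "A = B"
proof (rule extensionalityI[OF bounded_opsD(1)[OF A] bounded_opsD(1)[OF B]])
  fix u assume u: "u \<in> carrier (ell2 X)"
  note cl = bounded_opsD(2)[OF A] bounded_opsD(2)[OF B]
  obtain CA where CA: "\<And>x. x \<in> carrier (ell2 X) \<Longrightarrow> hnorm (ell2 X) (A x) \<le> CA * hnorm (ell2 X) x"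
    using ell2.bounded_ops_bound[OF A] by blast
  obtain CB where CB: "\<And>x. x \<in> carrier (ell2 X) \<Longrightarrow> hnorm (ell2 X) (B x) \<le> CB * hnorm (ell2 X) x"
    using ell2.bounded_ops_bound[OF B] by blast
  show "A u = B u"
  proof (rule ell2.hinner_ext)
    fix z assume z: "z \<in> carrier (ell2 X)"
    have bd: "cmod (hinner (ell2 X) h z) \<le> (C * hnorm (ell2 X) z) * hnorm (ell2 X) f"
      if "h \<in> carrier (ell2 X)" "hnorm (ell2 X) h \<le> C * hnorm (ell2 X) f" for C f h
      using ell2.Cauchy_Schwarz[OF that(1) z] mult_right_mono[OF that(2) ell2.hnorm_nonneg[OF z]]
      by (simp add: mult_ac)
    show "hinner (ell2 X) (A u) z = hinner (ell2 X) (B u) z"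
    proof (rule ell2_functional_ext[where X = X and l = "\<lambda>u. hinner (ell2 X) (A u) z"
          and l' = "\<lambda>u. hinner (ell2 X) (B u) z", OF _ _ _ _ _ u])
      fix f assume f: "f \<in> carrier (ell2 X)"
      show "cmod (hinner (ell2 X) (A f) z) \<le> (CA * hnorm (ell2 X) z) * hnorm (ell2 X) f"
        by (rule bd[OF cl(1)[OF f] CA[OF f]])
      show "cmod (hinner (ell2 X) (B f) z) \<le> (CB * hnorm (ell2 X) z) * hnorm (ell2 X) f"
        by (rule bd[OF cl(2)[OF f] CB[OF f]])
    next
      fix x c assume x: "x \<in> X"
      show "hinner (ell2 X) (A (single c x)) z = hinner (ell2 X) (B (single c x)) z"
        unfolding bounded_ops_ell2_single[OF A x, of c] bounded_ops_ell2_single[OF B x, of c] eq[OF x] ..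
    next
      fix f g assume "f \<in> carrier (ell2 X)" "g \<in> carrier (ell2 X)"
      then show "hinner (ell2 X) (A (\<lambda>x. f x + g x)) z = hinner (ell2 X) (A f) z + hinner (ell2 X) (A g) z"
        "hinner (ell2 X) (B (\<lambda>x. f x + g x)) z = hinner (ell2 X) (B f) z + hinner (ell2 X) (B g) z"
        using A B cl z by (auto simp: bounded_ops_ell2_add ell2_hinner_add_left)
    qed
  qed (use u cl in auto)
qed

text \<open>The adjoint is written down by its coordinates \<open>b f x\<close>, the inner product
  of f with \<open>A \<delta>\<^sub>x\<close>. Square summability follows by testing with the
  truncation of \<open>b f\<close> itself: if L is its norm on F, pairing f with the image of the
  truncation gives L^2, which is at most C L times the norm of f.\<close>

lemma ell2_adjoint_exists:
  assumes A: "A \<in> bounded_ops (ell2 X)"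
  shows "\<exists>B. is_adjoint (ell2 X) A B"
proof -
  let ?H = "ell2 X"
  note cl = bounded_opsD(2)[OF A]
  obtain C where C: "C \<ge> 0" "\<And>x. x \<in> carrier ?H \<Longrightarrow> hnorm ?H (A x) \<le> C * hnorm ?H x"
    using ell2.bounded_ops_bound[OF A] by blast
  define b where "b f x = (if x \<in> X then hinner ?H f (A (single 1 x)) else 0)" for f x
  have bF: "L2_set (\<lambda>x. cmod (b f x)) F \<le> C * hnorm ?H f"
    if f: "f \<in> carrier ?H" and F: "finite F" "F \<subseteq> X" for f F
  proof -
    let ?g = "restrict0 F (b f)"
    let ?L = "L2_set (\<lambda>x. cmod (b f x)) F"
    have g: "?g \<in> carrier ?H" by (rule restrict0_in_ell2[OF F])
    have "hinner ?H f (A ?g) = (\<Sum>x\<in>F. hinner ?H f (A (single (b f x) x)))"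
      by (rule additive_restrict0[OF F, where l = "\<lambda>g. hinner ?H f (A g)"])
        (use f cl A in \<open>auto simp: bounded_ops_ell2_add ell2_hinner_add_right\<close>)
    also have "\<dots> = (\<Sum>x\<in>F. complex_of_real ((cmod (b f x))\<^sup>2))"
    proof (intro sum.cong refl)
      fix x assume "x \<in> F"
      then have x: "x \<in> X" using F by auto
      show "hinner ?H f (A (single (b f x) x)) = complex_of_real ((cmod (b f x))\<^sup>2)"
        unfolding bounded_ops_ell2_single[OF A x, of "b f x"] complex_norm_square
        using x f cl by (simp add: ell2_hinner_smult_right b_def)
    qed
    also have "\<dots> = complex_of_real (?L\<^sup>2)"
      by (simp add: L2_set_def sum_nonneg)
    finally have "?L\<^sup>2 = cmod (hinner ?H f (A ?g))" by (simp add: norm_power)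
    also have "\<dots> \<le> hnorm ?H f * hnorm ?H (A ?g)" by (rule ell2.Cauchy_Schwarz[OF f cl[OF g]])
    also have "\<dots> \<le> hnorm ?H f * (C * ?L)"
      using C(2)[OF g] f by (intro mult_left_mono) (auto simp: hnorm_restrict0[OF F])
    finally have "?L * ?L \<le> (C * hnorm ?H f) * ?L" by (simp add: power2_eq_square mult_ac)
    moreover have "0 \<le> ?L" "0 \<le> C * hnorm ?H f" using C(1) f by auto
    ultimately show ?thesis by (cases "?L = 0") auto
  qed
  have b: "b f \<in> carrier ?H" "hnorm ?H (b f) \<le> C * hnorm ?H f" if f: "f \<in> carrier ?H" for f
  proof -
    show b: "b f \<in> carrier ?H" unfolding ell2_iff_bdd using bF[OF f] by (auto simp: b_def)
    show "hnorm ?H (b f) \<le> C * hnorm ?H f"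
      unfolding ell2_hnorm[OF b] by (rule ell2_norm_leI[OF b bF[OF f]])
  qed
  define B where "B = restrict b (carrier ?H)"
  have B: "B \<in> bounded_ops ?H"
    unfolding bounded_ops_def
  proof (intro CollectI conjI ballI allI)
    show "B \<in> carrier ?H \<rightarrow>\<^sub>E carrier ?H" using b by (auto simp: B_def)
    show "\<exists>C. \<forall>x\<in>carrier ?H. hnorm ?H (B x) \<le> C * hnorm ?H x" using b by (auto simp: B_def)
    show "B (f \<oplus>\<^bsub>?H\<^esub> g) = B f \<oplus>\<^bsub>?H\<^esub> B g" if f: "f \<in> carrier ?H" and g: "g \<in> carrier ?H" for f g
    proof -
      have "b (\<lambda>x. f x + g x) = (\<lambda>y. b f y + b g y)"
        using ell2_hinner_add_left[OF f g cl[OF single_in_ell2]] by (simp add: b_def fun_eq_iff)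
      then show ?thesis using f g ell2_add[OF f g] by (simp add: B_def)
    qed
    show "B (c \<odot>\<^bsub>?H\<^esub> f) = c \<odot>\<^bsub>?H\<^esub> B f" if f: "f \<in> carrier ?H" for f c
    proof -
      have "b (\<lambda>x. c * f x) = (\<lambda>y. c * b f y)"
        using ell2_hinner_smult_left[OF f cl[OF single_in_ell2]] by (simp add: b_def fun_eq_iff)
      then show ?thesis using f ell2_smult[OF f] by (simp add: B_def)
    qed
  qed
  have "hinner ?H (A u) f = hinner ?H u (B f)" if u: "u \<in> carrier ?H" and f: "f \<in> carrier ?H" for u f
  proof (rule ell2_functional_ext[where X = X and l = "\<lambda>u. hinner ?H (A u) f" and l' = "\<lambda>u. hinner ?H u (B f)",
        OF _ _ _ _ _ u])
    have Bf: "B f \<in> carrier ?H" using f b by (simp add: B_def)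
    fix g assume g: "g \<in> carrier ?H"
    show "cmod (hinner ?H (A g) f) \<le> (C * hnorm ?H f) * hnorm ?H g"
      using ell2.Cauchy_Schwarz[OF cl[OF g] f] mult_right_mono[OF C(2)[OF g] ell2.hnorm_nonneg[OF f]]
      by (simp add: mult_ac)
    show "cmod (hinner ?H g (B f)) \<le> hnorm ?H (B f) * hnorm ?H g"
      using ell2.Cauchy_Schwarz[OF g Bf] by (simp add: mult_ac)
  next
    have Bf: "B f \<in> carrier ?H" using f b by (simp add: B_def)
    fix x c assume x: "x \<in> X"
    show "hinner ?H (A (single c x)) f = hinner ?H (single c x) (B f)"
      unfolding bounded_ops_ell2_single[OF A x, of c] hinner_single_left[OF x Bf]
      using x f cl ell2.hinner_commute[of f X "A (single 1 x)"]
      by (simp add: ell2_hinner_smult_left B_def b_def)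
  next
    fix g h assume "g \<in> carrier ?H" "h \<in> carrier ?H"
    then show "hinner ?H (A (\<lambda>x. g x + h x)) f = hinner ?H (A g) f + hinner ?H (A h) f"
      "hinner ?H (\<lambda>x. g x + h x) (B f) = hinner ?H g (B f) + hinner ?H h (B f)"
      using f cl A b by (auto simp: bounded_ops_ell2_add ell2_hinner_add_left B_def)
  qed
  then show ?thesis using A B unfolding is_adjoint_def by blast
qed

section \<open>Unitaries and regular representations\<close>

lemma unitary_betweenD:
  assumes "unitary_between H K V"
  shows "bij_betw V (carrier H) (carrier K)"
    and "\<And>x. x \<in> carrier H \<Longrightarrow> V x \<in> carrier K"
    and "\<And>x y. \<lbrakk>x \<in> carrier H; y \<in> carrier H\<rbrakk> \<Longrightarrow> V (x \<oplus>\<^bsub>H\<^esub> y) = V x \<oplus>\<^bsub>K\<^esub> V y"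
    and "\<And>c x. x \<in> carrier H \<Longrightarrow> V (c \<odot>\<^bsub>H\<^esub> x) = c \<odot>\<^bsub>K\<^esub> V x"
    and "\<And>x y. \<lbrakk>x \<in> carrier H; y \<in> carrier H\<rbrakk> \<Longrightarrow> hinner K (V x) (V y) = hinner H x y"
    and "\<And>x. x \<in> carrier H \<Longrightarrow> hnorm K (V x) = hnorm H x"
  using assms by (auto simp: unitary_between_def hnorm_def bij_betw_def)

lemma unitary_bounded_ops:
  assumes "unitary_between H H V" "V \<in> extensional (carrier H)"
  shows "V \<in> bounded_ops H"
  unfolding bounded_ops_def
  using unitary_betweenD[OF assms(1)] assms(2) by (auto simp: PiE_def intro!: exI[of _ 1])

lemma compose_bounded_ops:
  assumes A: "A \<in> bounded_ops H" and B: "B \<in> bounded_ops H" and "hilbert_space H"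
  shows "compose (carrier H) A B \<in> bounded_ops H"
proof -
  interpret hilbert_space H by fact
  obtain C where C: "C \<ge> 0" "\<And>x. x \<in> carrier H \<Longrightarrow> hnorm H (A x) \<le> C * hnorm H x"
    using bounded_ops_bound[OF A] by blast
  obtain D where D: "\<And>x. x \<in> carrier H \<Longrightarrow> hnorm H (B x) \<le> D * hnorm H x"
    using bounded_ops_bound[OF B] by blast
  note clA = bounded_opsD[OF A] and clB = bounded_opsD[OF B]
  have "hnorm H (A (B x)) \<le> (C * D) * hnorm H x" if "x \<in> carrier H" for x
    using C(2)[OF clB(2)[OF that]] mult_left_mono[OF D[OF that] C(1)] by (simp add: mult_ac)
  then show ?thesis unfolding bounded_ops_def
    using clA clB by (auto simp: compose_def intro!: exI[of _ "C * D"])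
qed

lemma (in hilbert_space) scalar_bounded_ops: "(\<lambda>x\<in>carrier H. c \<odot> x) \<in> bounded_ops H"
proof -
  have "c \<odot> (x \<oplus> y) = c \<odot> x \<oplus> c \<odot> y" if "x \<in> carrier H" "y \<in> carrier H" for x y
    using that by (intro smult_r_distr) (simp_all add: complex_ring_def)
  moreover have "c \<odot> (d \<odot> x) = d \<odot> (c \<odot> x)" if "x \<in> carrier H" for d x
    using that smult_assoc1[of c d x] smult_assoc1[of d c x] by (simp add: complex_ring_def mult.commute)
  ultimately show ?thesis unfolding bounded_ops_def
    by (auto simp: hnorm_smult intro!: exI[of _ "cmod c"])
qed

lemma (in hilbert_space) scalar_in_commutant:
  assumes "S \<subseteq> bounded_ops H" shows "(\<lambda>x\<in>carrier H. c \<odot> x) \<in> commutant H S"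
proof (rule commutantI[OF scalar_bounded_ops])
  fix B x assume "B \<in> S" and x: "x \<in> carrier H"
  then have "B \<in> bounded_ops H" using assms by blast
  from bounded_opsD[OF this] show "(\<lambda>x\<in>carrier H. c \<odot> x) (B x) = B ((\<lambda>x\<in>carrier H. c \<odot> x) x)"
    using x by simp
qed

lemma (in hilbert_space) id_op_scalar: "id_op H = (\<lambda>x\<in>carrier H. 1 \<odot> x)"
  using smult_one by (auto simp: complex_ring_def fun_eq_iff)

section \<open>Weak convergence of uniformly bounded operators\<close>

lemma ell2_coordinate_le:
  assumes "x \<in> X" "f \<in> carrier (ell2 X)" shows "cmod (f x) \<le> hnorm (ell2 X) f"
  using ell2.Cauchy_Schwarz[of f X "single 1 x"] assms by (simp add: hinner_single_right hnorm_single)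

text \<open>Outside a finite set F all values of f are below e, and the sequence t visits F only
  finitely often.\<close>

lemma ell2_tendsto_0:
  assumes f: "f \<in> carrier (ell2 X)" and t: "\<And>k. t k \<in> X" "\<And>y. y \<in> X \<Longrightarrow> finite {k. t k = y}"
  shows "(\<lambda>k::nat. f (t k)) \<longlonglongrightarrow> 0"
proof (rule LIMSEQ_I)
  fix e :: real assume "e > 0"
  obtain F where F: "finite F" "F \<subseteq> X" "hnorm (ell2 X) (\<lambda>x. f x - restrict0 F f x) < e"
    using ell2_approx[OF f \<open>e > 0\<close>] .
  have "finite (\<Union>y\<in>F. {k. t k = y})" using F t by (intro finite_UN_I) auto
  from this[unfolded finite_nat_set_iff_bounded]
  obtain N where N: "\<And>k. k \<in> (\<Union>y\<in>F. {k. t k = y}) \<Longrightarrow> k < N" by auto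
  have "cmod (f (t k)) < e" if "k \<ge> N" for k
  proof -
    have "t k \<notin> F" using N[of k] that by auto
    then have "f (t k) = f (t k) - restrict0 F f (t k)" by (simp add: restrict0_def)
    then show ?thesis
      using ell2_coordinate_le[OF t(1) ell2_diff[OF f restrict0_in_ell2[OF F(1,2)]], of k f] F(3) by simp
  qed
  then show "\<exists>N. \<forall>k\<ge>N. norm (f (t k) - 0) < e" by auto
qed

text \<open>The common bound C makes the error form d uniformly bounded, so convergence of matrix
  entries spreads to all vectors, one argument of the form at a time.\<close>

lemma ell2_weak_tendsto:
  assumes B: "\<And>k. B k \<in> bounded_ops (ell2 X)" and L: "L \<in> bounded_ops (ell2 X)"
    and bd: "\<And>k f. f \<in> carrier (ell2 X) \<Longrightarrow> hnorm (ell2 X) (B k f) \<le> C * hnorm (ell2 X) f"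
    and lim: "\<And>x y. \<lbrakk>x \<in> X; y \<in> X\<rbrakk> \<Longrightarrow> (\<lambda>k. B k (single 1 x) y) \<longlonglongrightarrow> L (single 1 x) y"
    and u: "u \<in> carrier (ell2 X)" and v: "v \<in> carrier (ell2 X)"
  shows "(\<lambda>k::nat. hinner (ell2 X) (B k u) v) \<longlonglongrightarrow> hinner (ell2 X) (L u) v"
proof -
  let ?H = "ell2 X"
  define d where "d k f g = hinner ?H (B k f) g - hinner ?H (L f) g" for k f g
  note clB = bounded_opsD(2)[OF B] and clL = bounded_opsD(2)[OF L]
  obtain D where D: "\<And>x. x \<in> carrier ?H \<Longrightarrow> hnorm ?H (L x) \<le> D * hnorm ?H x"
    using ell2.bounded_ops_bound[OF L] by blast
  have d_bd: "cmod (d k f g) \<le> (C + D) * hnorm ?H f * hnorm ?H g"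
    if f: "f \<in> carrier ?H" and g: "g \<in> carrier ?H" for k f g
  proof -
    have "cmod (d k f g) \<le> hnorm ?H (B k f) * hnorm ?H g + hnorm ?H (L f) * hnorm ?H g"
      unfolding d_def
      using norm_triangle_ineq4[of "hinner ?H (B k f) g" "hinner ?H (L f) g"]
        ell2.Cauchy_Schwarz[OF clB[OF f, of k] g] ell2.Cauchy_Schwarz[OF clL[OF f] g] by linarith
    also have "\<dots> \<le> (C * hnorm ?H f) * hnorm ?H g + (D * hnorm ?H f) * hnorm ?H g"
      using bd[OF f, of k] D[OF f] g by (intro add_mono mult_right_mono) auto
    finally show ?thesis by (simp add: algebra_simps)
  qed
  have d_basis: "(\<lambda>k. d k (single c x) (single c' y)) \<longlonglongrightarrow> 0" if x: "x \<in> X" and y: "y \<in> X" for c c' x y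
  proof -
    have "d k (single c x) (single c' y) = c * cnj c' * (B k (single 1 x) y - L (single 1 x) y)" for k
      unfolding d_def bounded_ops_ell2_single[OF B x, of _ c] bounded_ops_ell2_single[OF L x, of c]
        hinner_single_right[OF y] by (simp add: algebra_simps)
    moreover have "(\<lambda>k. c * cnj c' * (B k (single 1 x) y - L (single 1 x) y)) \<longlonglongrightarrow> 0"
      using tendsto_mult_right_zero[OF LIM_zero[OF lim[OF x y]]] by simp
    ultimately show ?thesis by simp
  qed
  \<comment> \<open>The second argument is extended first. The form is conjugate linear in it, which
    is covered because only additivity is demanded of the functionals.\<close>
  have d_single: "(\<lambda>k. d k (single c x) v) \<longlonglongrightarrow> 0" if x: "x \<in> X" for c x
  proof (rule ell2_functional_tendsto_0[where X = X and l = "\<lambda>k. d k (single c x)"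
        and C = "(C + D) * hnorm ?H (single c x)"])
    fix k f g assume "f \<in> carrier ?H" "g \<in> carrier ?H"
    then show "d k (single c x) (\<lambda>x. f x + g x) = d k (single c x) f + d k (single c x) g"
      using x clB clL by (simp add: d_def ell2_hinner_add_right)
  qed (use x v d_bd d_basis in auto)
  have "(\<lambda>k. d k u v) \<longlonglongrightarrow> 0"
  proof (rule ell2_functional_tendsto_0[where X = X and l = "\<lambda>k f. d k f v" and C = "(C + D) * hnorm ?H v"])
    fix k f g assume f: "f \<in> carrier ?H" and g: "g \<in> carrier ?H"
    show "d k (\<lambda>x. f x + g x) v = d k f v + d k g v"
      unfolding d_def bounded_ops_ell2_add[OF B f g] bounded_ops_ell2_add[OF L f g]
      using f g v clB clL by (simp add: ell2_hinner_add_left)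
    show "cmod (d k f v) \<le> (C + D) * hnorm ?H v * hnorm ?H f"
      using d_bd[OF f v, of k] by (simp add: mult_ac)
  qed (use u d_single in auto)
  then show ?thesis unfolding d_def by (rule LIM_zero_cancel)
qed

section \<open>Unitaries induced by bijections of index sets\<close>

lemma ell2_reindex_in:
  assumes b: "bij_betw b Y X" and f: "f \<in> carrier (ell2 X)"
  shows "(\<lambda>y. if y \<in> Y then f (b y) else 0) \<in> carrier (ell2 Y)"
proof -
  have "(\<lambda>y. (cmod (f (b y)))\<^sup>2) summable_on Y"
    using summable_on_reindex_bij_betw[OF b, of "\<lambda>x. (cmod (f x))\<^sup>2"] f by (simp add: ell2_iff)
  then have "(\<lambda>y. (cmod (if y \<in> Y then f (b y) else 0))\<^sup>2) summable_on Y"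
    by (rule summable_on_cong[THEN iffD1, rotated]) auto
  then show ?thesis by (simp add: ell2_iff)
qed

text \<open>The source of the concrete unitaries below: left and right translations of a group, and
  the splitting of a group along the cosets of a subgroup.\<close>

lemma unitary_between_reindex:
  assumes b: "bij_betw b Y X"
  shows "unitary_between (ell2 X) (ell2 Y) (\<lambda>f y. if y \<in> Y then f (b y) else 0)"
  unfolding unitary_between_def
proof (intro conjI ballI allI)
  let ?V = "\<lambda>f y. if y \<in> Y then f (b y) else 0 :: complex"
  let ?W = "\<lambda>f x. if x \<in> X then f (inv_into Y b x) else 0 :: complex"
  have b': "bij_betw (inv_into Y b) X Y" by (rule bij_betw_inv_into[OF b])
  have iv: "inv_into Y b (b y) = y" if "y \<in> Y" for y
    using b that by (simp add: bij_betw_def)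
  have vi: "b (inv_into Y b x) = x" if "x \<in> X" for x
    using b that by (simp add: bij_betw_def f_inv_into_f)
  show "bij_betw ?V (carrier (ell2 X)) (carrier (ell2 Y))"
  proof (rule bij_betwI[where g = ?W])
    show "?W (?V f) = f" if "f \<in> carrier (ell2 X)" for f
      using that vi bij_betwE[OF b'] by (auto simp: fun_eq_iff ell2_iff)
    show "?V (?W f) = f" if "f \<in> carrier (ell2 Y)" for f
      using that iv bij_betwE[OF b] by (auto simp: fun_eq_iff ell2_iff)
  qed (use ell2_reindex_in[OF b] ell2_reindex_in[OF b'] in auto)
  fix f g :: "_ \<Rightarrow> complex"
  have "hinner (ell2 Y) (?V f) (?V g) = (\<Sum>\<^sub>\<infinity>y\<in>Y. f (b y) * cnj (g (b y)))"
    unfolding ell2_simps by (rule infsum_cong) auto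
  also have "\<dots> = hinner (ell2 X) f g"
    unfolding ell2_simps by (rule infsum_reindex_bij_betw[OF b])
  finally show "hinner (ell2 Y) (?V f) (?V g) = hinner (ell2 X) f g" .
qed auto

text \<open>Elements of \<open>unitary_group\<close> and \<open>bounded_ops\<close> are extensional,
  so formulas valid on the carrier have to be cut down to it.\<close>

lemma unitary_between_restrict:
  assumes "unitary_between H H V" and "hilbert_space H"
  shows "unitary_between H H (restrict V (carrier H))"
proof -
  interpret hilbert_space H by fact
  show ?thesis using assms(1) unfolding unitary_between_def by auto
qed

section \<open>Left and right regular representations\<close>

context group
begin

text \<open>The right regular representation, which moves \<open>\<delta>\<^sub>x\<close> to the
  point mass at x y^-1 and commutes with all left translations.\<close>

definition right_rep :: "'a \<Rightarrow> ('a \<Rightarrow> complex) \<Rightarrow> 'a \<Rightarrow> complex" where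
  "right_rep y = (\<lambda>f\<in>carrier (ell2 (carrier G)). \<lambda>x. if x \<in> carrier G then f (x \<otimes> y) else 0)"

lemma bij_left: "g \<in> carrier G \<Longrightarrow> bij_betw (\<lambda>x. inv g \<otimes> x) (carrier G) (carrier G)"
  by (rule bij_betwI[where g = "\<lambda>x. g \<otimes> x"]) (auto simp flip: m_assoc)

lemma bij_right: "g \<in> carrier G \<Longrightarrow> bij_betw (\<lambda>x. x \<otimes> g) (carrier G) (carrier G)"
  by (rule bij_betwI[where g = "\<lambda>x. x \<otimes> inv g"]) (auto simp: m_assoc)

lemma unitary_regular:
  "g \<in> carrier G \<Longrightarrow> unitary_between (ell2 (carrier G)) (ell2 (carrier G)) (regular_rep G g)"
  unfolding regular_rep_def
  by (intro unitary_between_restrict unitary_between_reindex bij_left hilbert_space_ell2)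

lemma unitary_right:
  "g \<in> carrier G \<Longrightarrow> unitary_between (ell2 (carrier G)) (ell2 (carrier G)) (right_rep g)"
  unfolding right_rep_def
  by (intro unitary_between_restrict unitary_between_reindex bij_right hilbert_space_ell2)

lemma regular_bounded: "g \<in> carrier G \<Longrightarrow> regular_rep G g \<in> bounded_ops (ell2 (carrier G))"
  by (intro unitary_bounded_ops unitary_regular) (auto simp: regular_rep_def)

lemma right_bounded: "g \<in> carrier G \<Longrightarrow> right_rep g \<in> bounded_ops (ell2 (carrier G))"
  by (intro unitary_bounded_ops unitary_right) (auto simp: right_rep_def)

lemma regular_apply:
  "\<lbrakk>f \<in> carrier (ell2 (carrier G)); x \<in> carrier G\<rbrakk> \<Longrightarrow> regular_rep G g f x = f (inv g \<otimes> x)"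
  by (simp add: regular_rep_def)

lemma right_apply:
  "\<lbrakk>f \<in> carrier (ell2 (carrier G)); x \<in> carrier G\<rbrakk> \<Longrightarrow> right_rep y f x = f (x \<otimes> y)"
  by (simp add: right_rep_def)

lemma regular_mult:
  assumes g: "g \<in> carrier G" and h: "h \<in> carrier G" and f: "f \<in> carrier (ell2 (carrier G))"
  shows "regular_rep G (g \<otimes> h) f = regular_rep G g (regular_rep G h f)"
  using unitary_betweenD(2)[OF unitary_regular[OF h] f] f g h
  by (auto simp: regular_rep_def fun_eq_iff inv_mult_group m_assoc)

lemma regular_one: "f \<in> carrier (ell2 (carrier G)) \<Longrightarrow> regular_rep G \<one> f = f"
  by (auto simp: regular_rep_def fun_eq_iff ell2_iff)

theorem unitary_rep_regular: "unitary_rep G (ell2 (carrier G)) (regular_rep G)"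
  unfolding unitary_rep_def
proof (intro conjI hilbert_space_ell2 is_group homI)
  show "regular_rep G g \<in> carrier (unitary_group (ell2 (carrier G)))" if "g \<in> carrier G" for g
    using unitary_regular[OF that] by (simp add: unitary_group_def) (simp add: regular_rep_def)
  show "regular_rep G (g \<otimes> h) = regular_rep G g \<otimes>\<^bsub>unitary_group (ell2 (carrier G))\<^esub> regular_rep G h"
    if "g \<in> carrier G" "h \<in> carrier G" for g h
  proof (rule extensionalityI[where A = "carrier (ell2 (carrier G))"])
    show "regular_rep G (g \<otimes> h) f = (regular_rep G g \<otimes>\<^bsub>unitary_group (ell2 (carrier G))\<^esub> regular_rep G h) f"
      if "f \<in> carrier (ell2 (carrier G))" for f
      using regular_mult that \<open>g \<in> carrier G\<close> \<open>h \<in> carrier G\<close> by (simp add: unitary_group_def compose_eq)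
  qed (auto simp: unitary_group_def regular_rep_def[of G "g \<otimes> h"] compose_def)
qed

lemma regular_single:
  assumes g: "g \<in> carrier G" and x: "x \<in> carrier G"
  shows "regular_rep G g (single c x) = single c (g \<otimes> x)"
proof
  fix y show "regular_rep G g (single c x) y = single c (g \<otimes> x) y"
  proof (cases "y \<in> carrier G")
    case True
    then have "inv g \<otimes> y = x \<longleftrightarrow> y = g \<otimes> x" using g x inv_solve_left' by metis
    then show ?thesis using True x by (simp add: regular_apply) (simp add: single_def)
  next
    case False
    then have "y \<noteq> g \<otimes> x" using g x by auto
    then have "single c (g \<otimes> x) y = 0" by (simp add: single_def)
    then show ?thesis using False x by (simp add: regular_rep_def)
  qed
qed

lemma right_single:
  assumes g: "g \<in> carrier G" and x: "x \<in> carrier G"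
  shows "right_rep g (single c x) = single c (x \<otimes> inv g)"
proof
  fix y show "right_rep g (single c x) y = single c (x \<otimes> inv g) y"
  proof (cases "y \<in> carrier G")
    case True
    then have "y \<otimes> g = x \<longleftrightarrow> y = x \<otimes> inv g" using g x inv_solve_right' by metis
    then show ?thesis using True x by (simp add: right_apply) (simp add: single_def)
  next
    case False
    then have "y \<noteq> x \<otimes> inv g" using g x by auto
    then have "single c (x \<otimes> inv g) y = 0" by (simp add: single_def)
    then show ?thesis using False x by (simp add: right_rep_def)
  qed
qed

lemma right_commute_regular:
  assumes g: "g \<in> carrier G" and y: "y \<in> carrier G" and f: "f \<in> carrier (ell2 (carrier G))"
  shows "right_rep y (regular_rep G g f) = regular_rep G g (right_rep y f)"
  using unitary_betweenD(2)[OF unitary_regular[OF g] f] unitary_betweenD(2)[OF unitary_right[OF y] f] f g y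
  by (auto simp: regular_rep_def right_rep_def fun_eq_iff m_assoc)

lemma regular_hinner:
  assumes g: "g \<in> carrier G" and u: "u \<in> carrier (ell2 (carrier G))" and v: "v \<in> carrier (ell2 (carrier G))"
  shows "hinner (ell2 (carrier G)) (regular_rep G g u) v = hinner (ell2 (carrier G)) u (regular_rep G (inv g) v)"
proof -
  have v': "regular_rep G (inv g) v \<in> carrier (ell2 (carrier G))"
    using unitary_betweenD(2)[OF unitary_regular] g v by simp
  have "regular_rep G g (regular_rep G (inv g) v) = v"
    using regular_mult[of g "inv g" v] g v by (simp add: regular_one)
  then show ?thesis using unitary_betweenD(5)[OF unitary_regular[OF g] u v'] by simp
qed

lemma regular_adjoint:
  assumes "g \<in> carrier G" shows "is_adjoint (ell2 (carrier G)) (regular_rep G g) (regular_rep G (inv g))"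
  using assms regular_hinner unfolding is_adjoint_def by (auto intro: regular_bounded)

end

section \<open>The factor of a group with mixing conjugations\<close>

lemma ell2_outside: "f \<in> carrier (ell2 X) \<Longrightarrow> x \<notin> X \<Longrightarrow> f x = 0"
  by (simp add: ell2_iff)

text \<open>A sequential strengthening of the condition that nontrivial conjugacy classes are
  infinite: one sequence of conjugators moves every nontrivial element out of every finite set.
  Finiteness concerns the indices k, so repeated values of s count.\<close>

definition conj_mixing :: "('g, 'm) monoid_scheme \<Rightarrow> (nat \<Rightarrow> 'g) \<Rightarrow> bool" where
  "conj_mixing G s \<longleftrightarrow> (\<forall>k. s k \<in> carrier G) \<and>
     (\<forall>x\<in>carrier G - {\<one>\<^bsub>G\<^esub>}. \<forall>y\<in>carrier G. finite {k. s k \<otimes>\<^bsub>G\<^esub> x \<otimes>\<^bsub>G\<^esub> inv\<^bsub>G\<^esub> s k = y})"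

context group
begin

lemma conj_eq_iff:
  assumes "g \<in> carrier G" "x \<in> carrier G" "y \<in> carrier G"
  shows "g \<otimes> x \<otimes> inv g = y \<longleftrightarrow> x = inv g \<otimes> y \<otimes> g"
  using assms by (metis inv_closed inv_solve_left inv_solve_right' m_assoc m_closed)

text \<open>Conjugating x to y by \<open>inv (s k)\<close> is conjugating y to x by
  \<open>s k\<close>, so the two finiteness conditions coincide with x and y exchanged. The value y
  = \<one> is separate, as mixing says nothing about it; it is never attained since x is
  nontrivial.\<close>

lemma conj_mixing_inv:
  assumes "conj_mixing G s" shows "conj_mixing G (\<lambda>k. inv (s k))"
  unfolding conj_mixing_def
proof (intro conjI allI ballI)
  have s: "s k \<in> carrier G" for k using assms by (simp add: conj_mixing_def)
  then show "inv (s k) \<in> carrier G" for k by simp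
  fix x y assume x: "x \<in> carrier G - {\<one>}" and y: "y \<in> carrier G"
  have eq: "inv (s k) \<otimes> x \<otimes> inv (inv (s k)) = y \<longleftrightarrow> s k \<otimes> y \<otimes> inv (s k) = x" for k
    using conj_eq_iff[OF s[of k] y, of x] x s[of k] by auto
  show "finite {k. inv (s k) \<otimes> x \<otimes> inv (inv (s k)) = y}"
  proof (cases "y = \<one>")
    case True
    then have "{k. inv (s k) \<otimes> x \<otimes> inv (inv (s k)) = y} = {}"
      unfolding eq using x s by auto
    then show ?thesis by simp
  next
    case False
    then show ?thesis using assms x y unfolding eq conj_mixing_def by blast
  qed
qed

text \<open>If \<open>s k\<close> takes the value y, then conjugation by \<open>s k\<close> sends x
  to one fixed element; a nontrivial x therefore bounds how often that occurs.\<close>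

lemma conj_mixing_finite:
  assumes "conj_mixing G s" and x: "x \<in> carrier G" "x \<noteq> \<one>" and y: "y \<in> carrier G"
  shows "finite {k. s k = y}"
proof (rule finite_subset)
  show "{k. s k = y} \<subseteq> {k. s k \<otimes> x \<otimes> inv (s k) = y \<otimes> x \<otimes> inv y}" by auto
  show "finite {k. s k \<otimes> x \<otimes> inv (s k) = y \<otimes> x \<otimes> inv y}"
    using assms unfolding conj_mixing_def by simp
qed

section \<open>Operators commuting with right translations, and their coefficients\<close>

definition left_algebra :: "(('a \<Rightarrow> complex) \<Rightarrow> 'a \<Rightarrow> complex) set" where
  "left_algebra = commutant (ell2 (carrier G)) (right_rep ` carrier G)"

definition vN :: "(('a \<Rightarrow> complex) \<Rightarrow> 'a \<Rightarrow> complex) set" where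
  "vN = commutant (ell2 (carrier G)) (commutant (ell2 (carrier G)) (regular_rep G ` carrier G))"

lemma right_in_commutant: "y \<in> carrier G \<Longrightarrow> right_rep y \<in> commutant (ell2 (carrier G)) (regular_rep G ` carrier G)"
  by (rule commutantI) (auto simp: right_bounded right_commute_regular)

text \<open>Right translations commute with left ones, and passing to commutants reverses the
  inclusion. This gives every element of \<open>vN\<close> access to the coefficient formula
  below.\<close>

lemma vN_subset: "vN \<subseteq> left_algebra"
  unfolding vN_def left_algebra_def by (rule commutant_antimono) (auto simp: right_in_commutant)

lemma regular_in_vN: "g \<in> carrier G \<Longrightarrow> regular_rep G g \<in> vN"
  unfolding vN_def using subset_double_commutant[of "regular_rep G ` carrier G"] regular_bounded by blast

lemma vN_bounded: "vN \<subseteq> bounded_ops (ell2 (carrier G))"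
  unfolding vN_def by (rule commutant_subset)

lemma left_algebra_bounded: "left_algebra \<subseteq> bounded_ops (ell2 (carrier G))"
  unfolding left_algebra_def by (rule commutant_subset)

lemma regular_in_left_algebra: "g \<in> carrier G \<Longrightarrow> regular_rep G g \<in> left_algebra"
  using regular_in_vN vN_subset by blast

lemma left_algebra_right:
  assumes "A \<in> left_algebra" "y \<in> carrier G" "f \<in> carrier (ell2 (carrier G))"
  shows "A (right_rep y f) = right_rep y (A f)"
  using assms commutantD[of A "ell2 (carrier G)" "right_rep ` carrier G" "right_rep y" f]
  by (simp add: left_algebra_def)

lemma left_algebra_compose:
  assumes A: "A \<in> left_algebra" and B: "B \<in> left_algebra"
  shows "compose (carrier (ell2 (carrier G))) A B \<in> left_algebra"
  unfolding left_algebra_def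
proof (rule commutantI)
  have A': "A \<in> bounded_ops (ell2 (carrier G))" and B': "B \<in> bounded_ops (ell2 (carrier G))"
    using A B left_algebra_bounded by auto
  then show "compose (carrier (ell2 (carrier G))) A B \<in> bounded_ops (ell2 (carrier G))"
    by (rule compose_bounded_ops[OF _ _ hilbert_space_ell2])
  fix R f assume "R \<in> right_rep ` carrier G" and f: "f \<in> carrier (ell2 (carrier G))"
  then obtain y where y: "y \<in> carrier G" and R: "R = right_rep y" by auto
  show "compose (carrier (ell2 (carrier G))) A B (R f) = R (compose (carrier (ell2 (carrier G))) A B f)"
    using left_algebra_right[OF B y f] left_algebra_right[OF A y bounded_opsD(2)[OF B' f]] f
      unitary_betweenD(2)[OF unitary_right[OF y] f] by (simp add: compose_eq R)
qed

text \<open>\<open>\<delta>\<^sub>x\<close> is the translate of \<open>\<delta>\<^sub>1\<close> by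
  \<open>right_rep (inv x)\<close>, which A commutes with. Hence A acts as left convolution by the
  function \<open>A (single 1 \<one>)\<close>.\<close>

lemma left_algebra_coeff:
  assumes A: "A \<in> left_algebra" and x: "x \<in> carrier G" and y: "y \<in> carrier G"
  shows "A (single 1 x) y = A (single 1 \<one>) (y \<otimes> inv x)"
proof -
  have A': "A \<in> bounded_ops (ell2 (carrier G))" using A left_algebra_bounded by auto
  have "single 1 x = right_rep (inv x) (single 1 \<one>)" using x by (simp add: right_single)
  then have "A (single 1 x) y = right_rep (inv x) (A (single 1 \<one>)) y"
    using left_algebra_right[OF A, of "inv x" "single 1 \<one>"] x by simp
  then show ?thesis using y bounded_opsD(2)[OF A'] by (simp add: right_apply)
qed

text \<open>The vector \<open>\<delta>\<^sub>1\<close> is separating: the convolving function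
  determines all matrix entries.\<close>

lemma left_algebra_eqI:
  assumes A: "A \<in> left_algebra" and B: "B \<in> left_algebra"
    and "A (single 1 \<one>) = B (single 1 \<one>)"
  shows "A = B"
proof (rule ell2_op_ext)
  show A': "A \<in> bounded_ops (ell2 (carrier G))" and B': "B \<in> bounded_ops (ell2 (carrier G))"
    using A B left_algebra_bounded by auto
  fix x assume x: "x \<in> carrier G"
  have "A (single 1 x) y = B (single 1 x) y" for y
  proof (cases "y \<in> carrier G")
    case True
    then show ?thesis using left_algebra_coeff[OF A x True] left_algebra_coeff[OF B x True] assms by simp
  next
    case False
    then show ?thesis
      using ell2_outside[OF bounded_opsD(2)[OF A' single_in_ell2[OF x]] False]
        ell2_outside[OF bounded_opsD(2)[OF B' single_in_ell2[OF x]] False] by simp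
  qed
  then show "A (single 1 x) = B (single 1 x)" by auto
qed

lemma scalar_in_left_algebra: "(\<lambda>x\<in>carrier (ell2 (carrier G)). c \<odot>\<^bsub>ell2 (carrier G)\<^esub> x) \<in> left_algebra"
  unfolding left_algebra_def by (rule ell2.scalar_in_commutant) (auto simp: right_bounded)

text \<open>The matrix entry of the conjugated operator at (x, y) is the coefficient of A at y x^-1
  conjugated by \<open>inv (s k)\<close>. It is constant for y = x; for y \<noteq> x it tends to 0
  by mixing of the inverse sequence.\<close>

lemma conj_weak_limit:
  assumes s: "conj_mixing G s" and A: "A \<in> left_algebra"
    and u: "u \<in> carrier (ell2 (carrier G))" and v: "v \<in> carrier (ell2 (carrier G))"
  shows "(\<lambda>k. hinner (ell2 (carrier G)) (regular_rep G (s k) (A (regular_rep G (inv (s k)) u))) v)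
     \<longlonglongrightarrow> A (single 1 \<one>) \<one> * hinner (ell2 (carrier G)) u v"
proof -
  let ?H = "ell2 (carrier G)" and ?c = "A (single 1 \<one>) \<one>"
  have sG: "s k \<in> carrier G" for k using s by (simp add: conj_mixing_def)
  have A': "A \<in> bounded_ops ?H" using A left_algebra_bounded by auto
  obtain C where C: "C \<ge> 0" "\<And>x. x \<in> carrier ?H \<Longrightarrow> hnorm ?H (A x) \<le> C * hnorm ?H x"
    using ell2.bounded_ops_bound[OF A'] by blast
  define B where "B k = compose (carrier ?H) (regular_rep G (s k)) (compose (carrier ?H) A (regular_rep G (inv (s k))))" for k
  define L where "L = (\<lambda>x\<in>carrier ?H. ?c \<odot>\<^bsub>?H\<^esub> x)"
  have reg: "regular_rep G g f \<in> carrier ?H" "hnorm ?H (regular_rep G g f) = hnorm ?H f"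
    if "g \<in> carrier G" "f \<in> carrier ?H" for g f
    using unitary_betweenD(2,6)[OF unitary_regular] that by auto
  have B: "B k \<in> bounded_ops ?H" for k
    unfolding B_def by (intro compose_bounded_ops regular_bounded hilbert_space_ell2 A' sG inv_closed)
  have Bf: "B k f = regular_rep G (s k) (A (regular_rep G (inv (s k)) f))" if "f \<in> carrier ?H" for k f
    using that by (simp add: B_def compose_eq)
  have L: "L \<in> bounded_ops ?H" unfolding L_def by (rule ell2.scalar_bounded_ops)
  have "(\<lambda>k. hinner ?H (B k u) v) \<longlonglongrightarrow> hinner ?H (L u) v"
  proof (rule ell2_weak_tendsto[OF B L _ _ u v, where C = C])
    fix k f assume f: "f \<in> carrier ?H"
    show "hnorm ?H (B k f) \<le> C * hnorm ?H f"
      unfolding Bf[OF f] using reg f sG C bounded_opsD(2)[OF A'] by simp (metis C(2) reg inv_closed sG f)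
  next
    fix x y assume x: "x \<in> carrier G" and y: "y \<in> carrier G"
    have e: "B k (single 1 x) y = A (single 1 \<one>) (inv (s k) \<otimes> (y \<otimes> inv x) \<otimes> inv (inv (s k)))" for k
    proof -
      have "B k (single 1 x) y = A (single 1 (inv (s k) \<otimes> x)) (inv (s k) \<otimes> y)"
        using x y sG[of k] bounded_opsD(2)[OF A'] by (simp add: Bf regular_single regular_apply)
      also have "\<dots> = A (single 1 \<one>) ((inv (s k) \<otimes> y) \<otimes> inv (inv (s k) \<otimes> x))"
        using x y sG[of k] by (intro left_algebra_coeff[OF A]) auto
      also have "(inv (s k) \<otimes> y) \<otimes> inv (inv (s k) \<otimes> x) = inv (s k) \<otimes> (y \<otimes> inv x) \<otimes> inv (inv (s k))"
        using x y sG[of k] by (simp add: inv_mult_group m_assoc)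
      finally show ?thesis .
    qed
    show "(\<lambda>k. B k (single 1 x) y) \<longlonglongrightarrow> L (single 1 x) y"
    proof (cases "y = x")
      case True
      then show ?thesis unfolding e using x sG by (simp add: L_def) (simp add: single_def)
    next
      case False
      then have "y \<otimes> inv x \<noteq> \<one>" using x y by (metis inv_closed inv_equality inv_inv)
      then have "(\<lambda>k. B k (single 1 x) y) \<longlonglongrightarrow> 0"
        unfolding e using conj_mixing_inv[OF s] x y bounded_opsD(2)[OF A'] sG
        by (intro ell2_tendsto_0[where X = "carrier G"]) (auto simp: conj_mixing_def)
      then show ?thesis using False x by (simp add: L_def) (simp add: single_def)
    qed
  qed
  then show ?thesis using Bf[OF u] u v by (simp add: L_def ell2_hinner_smult_left)
qed

text \<open>Combined left and right translation by \<open>s k\<close> sends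
  \<open>\<delta>\<^sub>x\<close> to the point mass at the conjugate of x. It fixes
  \<open>\<delta>\<^sub>1\<close> and pushes every other point mass to infinity, so its weak limit
  is the projection L onto \<open>\<delta>\<^sub>1\<close>.\<close>

lemma conj_functions_weak_limit:
  assumes s: "conj_mixing G s"
    and u: "u \<in> carrier (ell2 (carrier G))" and v: "v \<in> carrier (ell2 (carrier G))"
  shows "(\<lambda>k. hinner (ell2 (carrier G)) (regular_rep G (s k) (right_rep (s k) u)) v)
     \<longlonglongrightarrow> u \<one> * cnj (v \<one>)"
proof -
  let ?H = "ell2 (carrier G)"
  have sG: "s k \<in> carrier G" for k using s by (simp add: conj_mixing_def)
  define B where "B k = compose (carrier ?H) (regular_rep G (s k)) (right_rep (s k))" for k
  define L where "L = (\<lambda>f\<in>carrier ?H. single (f \<one>) \<one>)"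
  have reg: "regular_rep G g f \<in> carrier ?H" "hnorm ?H (regular_rep G g f) = hnorm ?H f"
    "right_rep g f \<in> carrier ?H" "hnorm ?H (right_rep g f) = hnorm ?H f"
    if "g \<in> carrier G" "f \<in> carrier ?H" for g f
    using unitary_betweenD(2,6)[OF unitary_regular] unitary_betweenD(2,6)[OF unitary_right] that by auto
  have B: "B k \<in> bounded_ops ?H" for k
    unfolding B_def by (intro compose_bounded_ops regular_bounded right_bounded hilbert_space_ell2 sG)
  have Bf: "B k f = regular_rep G (s k) (right_rep (s k) f)" if "f \<in> carrier ?H" for k f
    using that by (simp add: B_def compose_eq)
  have L: "L \<in> bounded_ops ?H"
    unfolding bounded_ops_def
  proof (intro CollectI conjI ballI allI)
    show "\<exists>C. \<forall>f\<in>carrier ?H. hnorm ?H (L f) \<le> C * hnorm ?H f"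
      by (intro exI[of _ 1]) (auto simp: L_def hnorm_single intro: ell2_coordinate_le)
    show "L (f \<oplus>\<^bsub>?H\<^esub> g) = L f \<oplus>\<^bsub>?H\<^esub> L g" if "f \<in> carrier ?H" "g \<in> carrier ?H" for f g
      using that ell2_add[OF that] by (auto simp: L_def single_def fun_eq_iff)
    show "L (c \<odot>\<^bsub>?H\<^esub> f) = c \<odot>\<^bsub>?H\<^esub> L f" if "f \<in> carrier ?H" for f c
      using that ell2_smult[OF that] by (auto simp: L_def single_def fun_eq_iff)
  qed (auto simp: L_def)
  have "(\<lambda>k. hinner ?H (B k u) v) \<longlonglongrightarrow> hinner ?H (L u) v"
  proof (rule ell2_weak_tendsto[OF B L _ _ u v, where C = 1])
    fix k f assume f: "f \<in> carrier ?H"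
    show "hnorm ?H (B k f) \<le> 1 * hnorm ?H f"
      unfolding Bf[OF f] using reg f sG by simp
  next
    fix x y assume x: "x \<in> carrier G" and y: "y \<in> carrier G"
    have e: "B k (single 1 x) y = (if s k \<otimes> x \<otimes> inv (s k) = y then 1 else 0)" for k
      using x y sG[of k] by (simp add: Bf regular_single right_single m_assoc) (simp add: single_def)
    show "(\<lambda>k. B k (single 1 x) y) \<longlonglongrightarrow> L (single 1 x) y"
    proof (cases "x = \<one>")
      case True
      then show ?thesis unfolding e using x sG by (simp add: L_def) (simp add: single_def)
    next
      case False
      then have "finite {k. s k \<otimes> x \<otimes> inv (s k) = y}"
        using s x y by (simp add: conj_mixing_def)
      from this[unfolded finite_nat_set_iff_bounded] obtain N where "\<forall>k\<ge>N. B k (single 1 x) y = 0"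
        unfolding e by (auto simp: not_less[symmetric])
      then have "(\<lambda>k. B k (single 1 x) y) \<longlonglongrightarrow> 0"
        by (intro tendsto_eventually) (auto simp: eventually_sequentially)
      moreover have "L (single 1 x) y = 0" using False x by (simp add: L_def) (simp add: single_def)
      ultimately show ?thesis by simp
    qed
  qed
  then show ?thesis using Bf[OF u] u v by (simp add: L_def hinner_single_left)
qed

lemma left_algebra_adjoint_coeff:
  assumes A: "A \<in> left_algebra" and AB: "is_adjoint (ell2 (carrier G)) A B" and x: "x \<in> carrier G"
  shows "B (single 1 \<one>) x = cnj (A (single 1 \<one>) (inv x))"
proof -
  let ?H = "ell2 (carrier G)"
  have B': "B \<in> bounded_ops ?H" using AB by (simp add: is_adjoint_def)
  have cl: "B (single 1 \<one>) \<in> carrier ?H" using bounded_opsD(2)[OF B'] by simp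
  have "A (single 1 x) \<one> = hinner ?H (A (single 1 x)) (single 1 \<one>)"
    by (simp add: hinner_single_right)
  also have "\<dots> = hinner ?H (single 1 x) (B (single 1 \<one>))"
    using AB x by (intro is_adjointD(3)) auto
  also have "\<dots> = cnj (B (single 1 \<one>) x)" using x cl by (simp add: hinner_single_left)
  finally have "cnj (B (single 1 \<one>) x) = A (single 1 \<one>) (inv x)"
    using left_algebra_coeff[OF A x, of \<one>] x by simp
  then show ?thesis by (metis complex_cnj_cnj)
qed

section \<open>The group von Neumann algebra: centre, finiteness, abelian projections\<close>

lemma vN_von_neumann: "von_neumann_algebra (ell2 (carrier G)) vN"
  unfolding vN_def
  by (rule ell2.von_neumann_double_commutant)
    (auto simp: regular_bounded ell2_adjoint_exists intro!: bexI[where x = "inv g" for g] regular_adjoint)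

lemma id_in_vN: "id_op (ell2 (carrier G)) \<in> vN"
  unfolding vN_def ell2.id_op_scalar by (rule ell2.scalar_in_commutant[OF commutant_subset])

text \<open>A central A commutes with left translations as well, so its coefficient function is
  constant on conjugacy classes. Its value at x \<noteq> \<one> recurs along conjugates that leave
  every finite set, and square summability makes it 0.\<close>

lemma vN_factor:
  assumes s: "conj_mixing G s"
  shows "factor (ell2 (carrier G)) vN"
  unfolding factor_def
proof (intro conjI vN_von_neumann)
  let ?H = "ell2 (carrier G)"
  have sG: "s k \<in> carrier G" for k using s by (simp add: conj_mixing_def)
  have "single 1 \<one> \<in> carrier ?H" by simp
  moreover have "single 1 \<one> \<noteq> \<zero>\<^bsub>?H\<^esub>" by (simp add: single_def fun_eq_iff)
  ultimately show "carrier ?H \<noteq> {\<zero>\<^bsub>?H\<^esub>}" by blast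
  show "vN \<inter> commutant ?H vN = {\<lambda>x\<in>carrier ?H. c \<odot>\<^bsub>?H\<^esub> x |c. True}"
  proof (intro equalityI subsetI)
    fix A assume "A \<in> {\<lambda>x\<in>carrier ?H. c \<odot>\<^bsub>?H\<^esub> x |c. True}"
    then obtain c where "A = (\<lambda>x\<in>carrier ?H. c \<odot>\<^bsub>?H\<^esub> x)" by blast
    then show "A \<in> vN \<inter> commutant ?H vN"
      using ell2.scalar_in_commutant[OF commutant_subset] ell2.scalar_in_commutant[OF vN_bounded]
      by (auto simp only: vN_def)
  next
    fix A assume "A \<in> vN \<inter> commutant ?H vN"
    then have A: "A \<in> left_algebra" and A1: "A \<in> commutant ?H vN" using vN_subset by auto
    have A': "A \<in> bounded_ops ?H" using A left_algebra_bounded by auto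
    let ?a = "A (single 1 \<one>)"
    have a: "?a \<in> carrier ?H" using bounded_opsD(2)[OF A'] by simp
    have inv: "?a (g \<otimes> x \<otimes> inv g) = ?a x" if g: "g \<in> carrier G" and x: "x \<in> carrier G" for g x
    proof -
      have "?a (g \<otimes> x \<otimes> inv g) = A (single 1 g) (g \<otimes> x)"
        using left_algebra_coeff[OF A g, of "g \<otimes> x"] g x by simp
      also have "single 1 g = regular_rep G g (single 1 \<one>)" using g by (simp add: regular_single)
      also have "A (regular_rep G g (single 1 \<one>)) = regular_rep G g ?a"
        by (rule commutantD[OF A1 regular_in_vN[OF g]]) simp
      also have "\<dots> (g \<otimes> x) = ?a x" using g x a by (simp add: regular_apply flip: m_assoc)
      finally show ?thesis .
    qed
    have "(\<lambda>x. ?a \<one> * single 1 \<one> x) = ?a"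
    proof (rule ext, rule sym)
      fix x show "?a x = ?a \<one> * single 1 \<one> x"
      proof (cases "x = \<one> \<or> x \<notin> carrier G")
        case True
        then show ?thesis using a by (auto simp: single_def ell2_iff)
      next
        case False
        then have "(\<lambda>k. ?a (s k \<otimes> x \<otimes> inv (s k))) \<longlonglongrightarrow> 0"
          using s sG by (intro ell2_tendsto_0[OF a]) (auto simp: conj_mixing_def)
        then have "?a x = 0" using False inv[OF sG] by (simp add: LIMSEQ_const_iff)
        then show ?thesis using False by (simp add: single_def)
      qed
    qed
    then have "A = (\<lambda>x\<in>carrier ?H. ?a \<one> \<odot>\<^bsub>?H\<^esub> x)"
      by (intro left_algebra_eqI[OF A scalar_in_left_algebra]) simp
    then show "A \<in> {\<lambda>x\<in>carrier ?H. c \<odot>\<^bsub>?H\<^esub> x |c. True}" by blast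
  qed
qed

text \<open>With \<tau>(A) the coefficient of A at \<one>, the trace property gives \<tau>(q) =
  \<tau>(v w) = \<tau>(w v) = 1. For a projection q this forces q to fix
  \<open>\<delta>\<^sub>1\<close>, which is separating.\<close>

lemma vN_id_finite: "finite_projection (ell2 (carrier G)) vN (id_op (ell2 (carrier G)))"
  unfolding finite_projection_def
proof (intro conjI ballI impI)
  let ?H = "ell2 (carrier G)" and ?e = "single 1 \<one> :: 'a \<Rightarrow> complex"
  have "id_op ?H \<in> bounded_ops ?H" using id_in_vN vN_bounded by auto
  then show "id_op ?H \<in> projections ?H vN"
    using id_in_vN by (auto simp: projections_def is_adjoint_def compose_def fun_eq_iff)
  fix q assume q: "q \<in> projections ?H vN"
    and "mvn_equivalent ?H vN (id_op ?H) q \<and> compose (carrier ?H) (id_op ?H) q = q"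
  then obtain v w where v: "v \<in> vN" and w: "w \<in> vN" and vw: "is_adjoint ?H v w"
    and id: "compose (carrier ?H) w v = id_op ?H" and q_eq: "compose (carrier ?H) v w = q"
    by (auto simp: mvn_equivalent_def)
  have e: "?e \<in> carrier ?H" by simp
  have bv: "v \<in> bounded_ops ?H" and bw: "w \<in> bounded_ops ?H" using vw by (auto simp: is_adjoint_def)
  have vH: "v ?e \<in> carrier ?H" and wH: "w ?e \<in> carrier ?H"
    using bounded_opsD(2)[OF bv] bounded_opsD(2)[OF bw] by auto
  have qM: "q \<in> vN" and qq: "is_adjoint ?H q q" "compose (carrier ?H) q q = q"
    using q by (auto simp: projections_def)
  have qH: "q ?e \<in> carrier ?H" using is_adjointD(1)[OF qq(1)] bounded_opsD(2) by fastforce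
  have "hinner ?H (v ?e) (v ?e) = hinner ?H ?e (w (v ?e))"
    by (rule is_adjointD(3)[OF vw e vH])
  also have "w (v ?e) = ?e" using fun_cong[OF id, of ?e] by (simp add: compose_eq)
  finally have "hinner ?H (v ?e) (v ?e) = 1" by (simp add: hinner_single_right) (simp add: single_def)
  moreover have "hinner ?H (w ?e) (w ?e) = hinner ?H (v ?e) (v ?e)"
  proof -
    \<comment> \<open>The trace property: passing to the adjoint conjugates the coefficients and
      inverts their arguments, and inversion only permutes the sum.\<close>
    have "hinner ?H (w ?e) (w ?e) = (\<Sum>\<^sub>\<infinity>x\<in>carrier G. v ?e (inv x) * cnj (v ?e (inv x)))"
      unfolding ell2_simps using left_algebra_adjoint_coeff[OF _ vw] v vN_subset
      by (intro infsum_cong) (auto simp: mult.commute)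
    also have "\<dots> = hinner ?H (v ?e) (v ?e)"
      unfolding ell2_simps
      by (rule infsum_reindex_bij_betw[where g = "\<lambda>x. inv x"])
        (rule bij_betwI[where g = "\<lambda>x. inv x"], auto)
    finally show ?thesis .
  qed
  moreover have "hinner ?H (w ?e) (w ?e) = hinner ?H (q ?e) ?e"
  proof -
    have "hinner ?H (w ?e) (w ?e) = hinner ?H (v (w ?e)) ?e"
      by (rule is_adjointD(3)[OF vw wH e, symmetric])
    then show ?thesis using fun_cong[OF q_eq, of ?e] by (simp add: compose_eq)
  qed
  ultimately have q1: "hinner ?H (q ?e) ?e = 1" by simp
  have "hinner ?H (q ?e) (q ?e) = hinner ?H (q (q ?e)) ?e"
    by (rule is_adjointD(3)[OF qq(1) qH e, symmetric])
  also have "q (q ?e) = q ?e" using fun_cong[OF qq(2), of ?e] by (simp add: compose_eq)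
  finally have q2: "hinner ?H (q ?e) (q ?e) = 1" using q1 by simp
  have q3: "hinner ?H ?e (q ?e) = 1" using ell2.hinner_commute[OF qH e] q1 by simp
  have "hinner ?H ?e ?e = 1" by (simp add: hinner_single_right) (simp add: single_def)
  \<comment> \<open>All four terms of the expansion have absolute value 1, and they cancel as 1 - 1
    - 1 + 1.\<close>
  then have "hinner ?H (q ?e \<ominus>\<^bsub>?H\<^esub> ?e) (q ?e \<ominus>\<^bsub>?H\<^esub> ?e) = 0"
    using ell2.M.minus_closed[OF qH e]
    by (simp add: ell2.hinner_minus_left[OF qH e] ell2.hinner_minus_right[OF qH e] qH q1 q2 q3)
  then have "q ?e = ?e"
    using ell2.hinner_eq_zero[OF ell2.M.minus_closed[OF qH e]] ell2.minus_eq_zero_iff[OF qH e] by simp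
  then show "q = id_op ?H"
    using qM id_in_vN vN_subset by (intro left_algebra_eqI) auto
qed

text \<open>The two limits are taken in turn: \<open>key\<close> is what remains of commutativity
  after the limit in g, and \<xi>(\<one>), which is the squared norm of \<xi>, is then killed by the
  limit in h.\<close>

lemma vN_abelian_projection_zero:
  assumes s: "conj_mixing G s" and nontriv: "x0 \<in> carrier G" "x0 \<noteq> \<one>"
    and p: "abelian_projection (ell2 (carrier G)) vN p"
  shows "p = (\<lambda>x\<in>carrier (ell2 (carrier G)). \<zero>\<^bsub>ell2 (carrier G)\<^esub>)"
proof -
  let ?H = "ell2 (carrier G)" and ?e = "single 1 \<one> :: 'a \<Rightarrow> complex"
  have sG: "s k \<in> carrier G" for k using s by (simp add: conj_mixing_def)
  have pM: "p \<in> vN" and pp: "is_adjoint ?H p p" "compose (carrier ?H) p p = p"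
    using p by (auto simp: projections_def abelian_projection_def)
  have pL: "p \<in> left_algebra" using pM vN_subset by auto
  have bp: "p \<in> bounded_ops ?H" using pM vN_bounded by auto
  note pH = bounded_opsD(2)[OF bp]
  have ppf: "p (p f) = p f" if "f \<in> carrier ?H" for f
    using fun_cong[OF pp(2), of f] that by (simp add: compose_eq)
  have reg: "regular_rep G g f \<in> carrier ?H" if "g \<in> carrier G" "f \<in> carrier ?H" for g f
    using unitary_betweenD(2)[OF unitary_regular] that by auto
  have e: "?e \<in> carrier ?H" by simp
  define \<xi> where "\<xi> = p ?e"
  have \<xi>: "\<xi> \<in> carrier ?H" unfolding \<xi>_def by (rule pH[OF e])
  have key: "\<xi> (inv h) * \<xi> h = \<xi> \<one> * hinner ?H (regular_rep G h (right_rep h \<xi>)) \<xi>"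
    if h: "h \<in> carrier G" for h
  proof -
    define u where "u = p (single 1 (inv h))"
    have u: "u \<in> carrier ?H" unfolding u_def using h by (intro pH) auto
    have pu: "p u = u" unfolding u_def using h by (intro ppf) auto
    have pcoord: "p z \<one> = hinner ?H z \<xi>" if z: "z \<in> carrier ?H" for z
    proof -
      have "p z \<one> = hinner ?H (p z) ?e" by (simp add: hinner_single_right)
      also have "\<dots> = hinner ?H z \<xi>" unfolding \<xi>_def by (rule is_adjointD(3)[OF pp(1) z e])
      finally show ?thesis .
    qed
    have comm: "hinner ?H (regular_rep G g (p (regular_rep G (h \<otimes> inv g) u))) \<xi>
        = hinner ?H (regular_rep G (h \<otimes> inv g) (p (regular_rep G g u))) \<xi>" if g: "g \<in> carrier G" for g
    proof -
      let ?A = "regular_rep G g" and ?B = "regular_rep G (h \<otimes> inv g)"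
      have hg: "h \<otimes> inv g \<in> carrier G" using g h by simp
      have "compose (carrier ?H) (compose (carrier ?H) p (compose (carrier ?H) ?A p))
              (compose (carrier ?H) p (compose (carrier ?H) ?B p))
          = compose (carrier ?H) (compose (carrier ?H) p (compose (carrier ?H) ?B p))
              (compose (carrier ?H) p (compose (carrier ?H) ?A p))"
        \<comment> \<open>The abelian condition for the translations by g and by h g^-1. In either
          order their product contains one factor and its inverse up to h, so that for g =
          \<open>s k\<close> both sides become conjugations.\<close>
        using p regular_in_vN[OF g] regular_in_vN[OF hg] unfolding abelian_projection_def Let_def by blast
      from fun_cong[OF this, of "single 1 (inv h)"]
      have "p (?A (p (p (?B u)))) = p (?B (p (p (?A u))))"
        using h g hg u reg pH by (simp add: compose_eq flip: u_def)
      then have "p (?A (p (?B u))) \<one> = p (?B (p (?A u))) \<one>"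
        using u reg[OF g] reg[OF hg] by (simp add: ppf)
      then show ?thesis using u reg[OF g] reg[OF hg] pH by (simp add: pcoord)
    qed
    \<comment> \<open>For g = \<open>s k\<close> the left side of \<open>comm\<close> is the
      conjugate of this operator by \<open>s k\<close>, applied to u.\<close>
    define A where "A = compose (carrier ?H) p (regular_rep G h)"
    have A: "A \<in> left_algebra"
      unfolding A_def by (intro left_algebra_compose pL regular_in_left_algebra h)
    have hi: "regular_rep G (inv h) \<xi> \<in> carrier ?H" using h \<xi> by (simp add: reg)
    have "(\<lambda>k. hinner ?H (regular_rep G (s k) (A (regular_rep G (inv (s k)) u))) \<xi>)
        \<longlonglongrightarrow> A ?e \<one> * hinner ?H u \<xi>"
      by (rule conj_weak_limit[OF s A u \<xi>])
    moreover have "hinner ?H (regular_rep G (s k) (A (regular_rep G (inv (s k)) u))) \<xi>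
        = hinner ?H (regular_rep G (inv (s k)) (p (regular_rep G (inv (inv (s k))) u))) (regular_rep G (inv h) \<xi>)" for k
    proof -
      have "A (regular_rep G (inv (s k)) u) = p (regular_rep G (h \<otimes> inv (s k)) u)"
        using reg[OF inv_closed[OF sG] u, of k] regular_mult[OF h inv_closed[OF sG] u] by (simp add: A_def compose_eq)
      then have "hinner ?H (regular_rep G (s k) (A (regular_rep G (inv (s k)) u))) \<xi>
          = hinner ?H (regular_rep G (h \<otimes> inv (s k)) (p (regular_rep G (s k) u))) \<xi>"
        using comm[OF sG] by simp
      \<comment> \<open>On the right side h is split off and moved to the other argument; what stays
        is p conjugated by \<open>inv (s k)\<close>, hence the use of the inverse sequence.\<close>
      also have "\<dots> = hinner ?H (regular_rep G h (regular_rep G (inv (s k)) (p (regular_rep G (s k) u)))) \<xi>"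
        using regular_mult[OF h inv_closed[OF sG] pH[OF reg[OF sG u]]] by simp
      also have "\<dots> = hinner ?H (regular_rep G (inv (s k)) (p (regular_rep G (s k) u))) (regular_rep G (inv h) \<xi>)"
        by (rule regular_hinner[OF h reg[OF inv_closed[OF sG] pH[OF reg[OF sG u]]] \<xi>])
      finally show ?thesis using sG by simp
    qed
    moreover have "(\<lambda>k. hinner ?H (regular_rep G (inv (s k)) (p (regular_rep G (inv (inv (s k))) u))) (regular_rep G (inv h) \<xi>))
        \<longlonglongrightarrow> p ?e \<one> * hinner ?H u (regular_rep G (inv h) \<xi>)"
      by (rule conj_weak_limit[OF conj_mixing_inv[OF s] pL u hi])
    ultimately have "A ?e \<one> * hinner ?H u \<xi> = \<xi> \<one> * hinner ?H u (regular_rep G (inv h) \<xi>)"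
      using LIMSEQ_unique by (simp add: \<xi>_def) blast
    moreover have "A ?e \<one> = \<xi> (inv h)"
      using left_algebra_coeff[OF pL h, of \<one>] h by (simp add: A_def compose_eq regular_single \<xi>_def)
    moreover have "hinner ?H u \<xi> = \<xi> h"
      using left_algebra_coeff[OF pL, of "inv h" \<one>] h pcoord[OF u] pu by (simp add: u_def \<xi>_def)
    moreover have "hinner ?H u (regular_rep G (inv h) \<xi>) = hinner ?H (regular_rep G h (right_rep h \<xi>)) \<xi>"
    proof -
      have "u = right_rep h \<xi>"
        unfolding u_def \<xi>_def using h left_algebra_right[OF pL h e] by (simp add: right_single)
      then show ?thesis using regular_hinner[OF h u \<xi>] by simp
    qed
    ultimately show ?thesis by simp
  qed
  \<comment> \<open>Now h runs through the sequence in \<open>key\<close>: this is the limit of its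
    right side, and the product of two null sequences is that of its left side.\<close>
  have "(\<lambda>k. \<xi> \<one> * hinner ?H (regular_rep G (s k) (right_rep (s k) \<xi>)) \<xi>) \<longlonglongrightarrow> \<xi> \<one> * (\<xi> \<one> * cnj (\<xi> \<one>))"
    by (intro tendsto_mult_left conj_functions_weak_limit[OF s \<xi> \<xi>])
  moreover have "(\<lambda>k. \<xi> (inv (s k)) * \<xi> (s k)) \<longlonglongrightarrow> 0 * 0"
    using conj_mixing_finite[OF s nontriv] conj_mixing_finite[OF conj_mixing_inv[OF s] nontriv] sG
    by (intro tendsto_mult ell2_tendsto_0[OF \<xi>]) auto
  ultimately have "\<xi> \<one> * (\<xi> \<one> * cnj (\<xi> \<one>)) = 0"
    unfolding key[OF sG] using LIMSEQ_unique by fastforce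
  then have "\<xi> \<one> = 0" by simp
  moreover have "\<xi> \<one> = hinner ?H \<xi> \<xi>"
  proof -
    have "\<xi> \<one> = hinner ?H (p (p ?e)) ?e" by (simp add: ppf \<xi>_def hinner_single_right)
    also have "\<dots> = hinner ?H \<xi> \<xi>" unfolding \<xi>_def by (rule is_adjointD(3)[OF pp(1) pH[OF e] e])
    finally show ?thesis .
  qed
  ultimately have "\<xi> = (\<lambda>x. 0)" using ell2.hinner_eq_zero[OF \<xi>] by simp
  then have "p = (\<lambda>x\<in>carrier ?H. 0 \<odot>\<^bsub>?H\<^esub> x)"
    by (intro left_algebra_eqI[OF pL scalar_in_left_algebra]) (simp add: \<xi>_def)
  then show ?thesis by simp
qed

text \<open>The element \<open>x0\<close> excludes the trivial group, where mixing is vacuous and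
  the algebra consists of the scalars.\<close>

theorem regular_rep_II1_factor:
  assumes s: "conj_mixing G s" and nontriv: "x0 \<in> carrier G" "x0 \<noteq> \<one>"
  shows "type_II1_factor_rep G (ell2 (carrier G)) (regular_rep G)"
  unfolding type_II1_factor_rep_def Let_def type_II1_def vN_def[symmetric]
  using unitary_rep_regular vN_factor[OF s] vN_von_neumann vN_id_finite
    vN_abelian_projection_zero[OF assms] by blast

end

section \<open>Conjugation in free groups\<close>

lemma inv_letter_inject [simp]: "inv_letter a = inv_letter b \<longleftrightarrow> a = b"
  by (metis inv_letter_inv)

lemma reduced_append:
  "\<lbrakk>reduced_word u; reduced_word v; u \<noteq> [] \<Longrightarrow> v \<noteq> [] \<Longrightarrow> hd v \<noteq> inv_letter (last u)\<rbrakk>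
    \<Longrightarrow> reduced_word (u @ v)"
proof (induction u rule: reduced_word.induct)
  case ("2_2" a)
  then show ?case by (cases v) auto
qed auto

lemma reduced_replicate: "reduced_word (replicate k a)"
proof (induction k)
  case (Suc k)
  then show ?case by (cases k) auto
qed simp

lemma foldr_cancel_Cons_append: "reduced_word (u @ v) \<Longrightarrow> foldr cancel_Cons u v = u @ v"
proof (induction u)
  case (Cons a u)
  then have "foldr cancel_Cons u v = u @ v" using reduced_ConsD by auto
  then show ?case using cancel_Cons_reduced[of a "u @ v"] Cons.prems by simp
qed simp

text \<open>A letter c that does not cancel against d is a barrier: left multiplication by powers of
  d can use up the letters in front of it, but neither c nor anything behind it.\<close>

lemma cancel_replicate_preserves_suffix:
  assumes "c \<noteq> inv_letter d"
  shows "\<exists>x'. foldr cancel_Cons (replicate k d) (x @ c # s) = x' @ c # s"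
proof (induction k)
  case (Suc k)
  then obtain x' where x': "foldr cancel_Cons (replicate k d) (x @ c # s) = x' @ c # s" by blast
  show ?case
  proof (cases x')
    case Nil
    then have "foldr cancel_Cons (replicate (Suc k) d) (x @ c # s) = [d] @ c # s" using x' assms by simp
    then show ?thesis by blast
  next
    case (Cons e x'')
    then have "foldr cancel_Cons (replicate (Suc k) d) (x @ c # s)
        = (if e = inv_letter d then x'' else d # x') @ c # s" using x' by simp
    then show ?thesis by blast
  qed
qed auto

text \<open>\<open>last z\<close> \<noteq> b lets z be followed by the k inverse letters without
  cancellation. \<open>last z\<close> \<noteq> \<open>inv_letter b\<close> makes
  \<open>last z\<close> a barrier for the k letters b from the left. So \<open>last z\<close> and
  the k letters after it survive, k + 1 in all.\<close>

lemma length_conj_replicate: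
  assumes "reduced_word z" "z \<noteq> []" "last z \<noteq> b" "last z \<noteq> inv_letter b"
  shows "length (foldr cancel_Cons (replicate k b) (foldr cancel_Cons z (replicate k (inv_letter b)))) > k"
proof -
  have z: "z = butlast z @ [last z]" using assms by simp
  have "foldr cancel_Cons z (replicate k (inv_letter b)) = z @ replicate k (inv_letter b)"
    using assms by (intro foldr_cancel_Cons_append reduced_append reduced_replicate) auto
  also have "\<dots> = butlast z @ last z # replicate k (inv_letter b)" by (subst z) simp
  finally show ?thesis
    using cancel_replicate_preserves_suffix[OF assms(4), of k "butlast z" "replicate k (inv_letter b)"] by auto
qed

lemma inv_free_group:
  assumes "w \<in> carrier (free_group n)"
  shows "inv\<^bsub>free_group n\<^esub> w = rev (map inv_letter w)"
proof -
  interpret group "free_group n" by (rule group_free_group)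
  show ?thesis
    using assms foldr_inverse[of "[]" w]
    by (intro inv_equality) (force simp: free_group_def foldr_cancel_Cons_Nil reduced_rev)+
qed

lemma free_gen_carrier: "i \<in> {1..n} \<Longrightarrow> free_gen i \<in> carrier (free_group n)"
  by (simp add: free_group_def free_gen_def)

lemma mult_free_group: "u \<otimes>\<^bsub>free_group n\<^esub> v = foldr cancel_Cons u v"
  by (simp add: free_group_def)

lemma one_free_group: "\<one>\<^bsub>free_group n\<^esub> = []"
  by (simp add: free_group_def)

lemma free_gen_pow: "free_gen i [^]\<^bsub>free_group n\<^esub> k = replicate k (i, True)" for k :: nat
proof (induction k)
  case (Suc k)
  interpret group "free_group n" by (rule group_free_group)
  have "free_gen i [^]\<^bsub>free_group n\<^esub> Suc k = foldr cancel_Cons (replicate k (i, True)) [(i, True)]"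
    using Suc by (simp add: mult_free_group) (simp add: free_gen_def)
  also have "\<dots> = replicate k (i, True) @ [(i, True)]"
    by (rule foldr_cancel_Cons_append) (metis reduced_replicate replicate_append_same replicate_Suc)
  finally show ?case by (simp add: replicate_append_same)
qed (simp add: free_group_def)

text \<open>Conjugation by the k-th power of one generator makes a word longer than k unless the
  word ends in that generator or its inverse. Conjugating by b first forces the ending in b, so the
  conjugation by a that follows always takes effect.\<close>

lemma conj_mixing_free_group:
  assumes i: "i \<in> {1..n}" and j: "j \<in> {1..n}" and "i \<noteq> j"
  shows "conj_mixing (free_group n) (\<lambda>k. free_gen i [^]\<^bsub>free_group n\<^esub> k \<otimes>\<^bsub>free_group n\<^esub> free_gen j [^]\<^bsub>free_group n\<^esub> k)"
proof -
  define F where "F = free_group n"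
  interpret group F unfolding F_def by (rule group_free_group)
  define a where "a = free_gen i" define b where "b = free_gen j"
  have a: "a \<in> carrier F" and b: "b \<in> carrier F"
    using i j by (auto simp: a_def b_def F_def free_gen_carrier)
  have conj: "length (free_gen l [^]\<^bsub>F\<^esub> k \<otimes>\<^bsub>F\<^esub> z \<otimes>\<^bsub>F\<^esub> inv\<^bsub>F\<^esub> (free_gen l [^]\<^bsub>F\<^esub> k)) > k"
    if l: "l \<in> {1..n}" and z: "z \<in> carrier F" "z \<noteq> []" "fst (last z) \<noteq> l" for l z k
  proof -
    have g: "free_gen l \<in> carrier F" using l by (simp add: F_def free_gen_carrier)
    have iv: "inv\<^bsub>F\<^esub> (free_gen l [^]\<^bsub>F\<^esub> k) = replicate k (inv_letter (l, True))"
      using nat_pow_closed[OF g, of k] unfolding F_def free_gen_pow by (simp add: inv_free_group)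
    have "free_gen l [^]\<^bsub>F\<^esub> k \<otimes>\<^bsub>F\<^esub> z \<otimes>\<^bsub>F\<^esub> inv\<^bsub>F\<^esub> (free_gen l [^]\<^bsub>F\<^esub> k)
        = free_gen l [^]\<^bsub>F\<^esub> k \<otimes>\<^bsub>F\<^esub> (z \<otimes>\<^bsub>F\<^esub> inv\<^bsub>F\<^esub> (free_gen l [^]\<^bsub>F\<^esub> k))"
      using g z by (simp add: m_assoc)
    also have "\<dots> = foldr cancel_Cons (replicate k (l, True)) (foldr cancel_Cons z (replicate k (inv_letter (l, True))))"
      unfolding iv by (simp add: F_def free_gen_pow mult_free_group)
    also have "length \<dots> > k"
      by (rule length_conj_replicate) (use z in \<open>auto simp: F_def free_group_def\<close>)
    finally show ?thesis .
  qed
  have conj': "length (inv\<^bsub>F\<^esub> (free_gen l [^]\<^bsub>F\<^esub> k) \<otimes>\<^bsub>F\<^esub> z \<otimes>\<^bsub>F\<^esub> (free_gen l [^]\<^bsub>F\<^esub> k)) > k"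
    if l: "l \<in> {1..n}" and z: "z \<in> carrier F" "z \<noteq> []" "fst (last z) \<noteq> l" for l z k
  proof -
    have g: "free_gen l \<in> carrier F" using l by (simp add: F_def free_gen_carrier)
    have iv: "inv\<^bsub>F\<^esub> (free_gen l [^]\<^bsub>F\<^esub> k) = replicate k (l, False)"
      using nat_pow_closed[OF g, of k] unfolding F_def free_gen_pow by (simp add: inv_free_group)
    have "inv\<^bsub>F\<^esub> (free_gen l [^]\<^bsub>F\<^esub> k) \<otimes>\<^bsub>F\<^esub> z \<otimes>\<^bsub>F\<^esub> (free_gen l [^]\<^bsub>F\<^esub> k)
        = inv\<^bsub>F\<^esub> (free_gen l [^]\<^bsub>F\<^esub> k) \<otimes>\<^bsub>F\<^esub> (z \<otimes>\<^bsub>F\<^esub> (free_gen l [^]\<^bsub>F\<^esub> k))"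
      using g z by (simp add: m_assoc)
    also have "\<dots> = foldr cancel_Cons (replicate k (l, False)) (foldr cancel_Cons z (replicate k (inv_letter (l, False))))"
      unfolding iv by (simp add: F_def free_gen_pow mult_free_group)
    also have "length \<dots> > k"
      by (rule length_conj_replicate) (use z in \<open>auto simp: F_def free_group_def\<close>)
    finally show ?thesis .
  qed
  have one: "\<one>\<^bsub>F\<^esub> = []" by (simp add: F_def one_free_group)
  define g where "g k = a [^]\<^bsub>F\<^esub> k \<otimes>\<^bsub>F\<^esub> b [^]\<^bsub>F\<^esub> k" for k :: nat
  have g: "g k \<in> carrier F" for k using a b by (simp add: g_def)
  have len: "length (g k \<otimes>\<^bsub>F\<^esub> w \<otimes>\<^bsub>F\<^esub> inv\<^bsub>F\<^esub> g k) > k"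
    if w: "w \<in> carrier F" "w \<noteq> []" and k: "k \<ge> length w" for w k
  proof -
    define z where "z = b [^]\<^bsub>F\<^esub> k \<otimes>\<^bsub>F\<^esub> w \<otimes>\<^bsub>F\<^esub> inv\<^bsub>F\<^esub> (b [^]\<^bsub>F\<^esub> k)"
    have z: "z \<in> carrier F" using b w by (simp add: z_def)
    have w_eq: "w = inv\<^bsub>F\<^esub> (b [^]\<^bsub>F\<^esub> k) \<otimes>\<^bsub>F\<^esub> z \<otimes>\<^bsub>F\<^esub> (b [^]\<^bsub>F\<^esub> k)"
      using conj_eq_iff[of "b [^]\<^bsub>F\<^esub> k" w z] b w z by (simp add: z_def)
    have "z \<noteq> []"
      using w_eq w b unfolding one[symmetric] by auto
    \<comment> \<open>Otherwise undoing the conjugation by b would produce a word longer than k, yet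
      it returns w, whose length is at most k.\<close>
    have "fst (last z) = j"
    proof (rule ccontr)
      assume "fst (last z) \<noteq> j"
      from conj'[OF j z \<open>z \<noteq> []\<close> this, of k] show False using w_eq k by (simp add: b_def)
    qed
    then have "length (a [^]\<^bsub>F\<^esub> k \<otimes>\<^bsub>F\<^esub> z \<otimes>\<^bsub>F\<^esub> inv\<^bsub>F\<^esub> (a [^]\<^bsub>F\<^esub> k)) > k"
      unfolding a_def using \<open>i \<noteq> j\<close> by (intro conj[OF i z \<open>z \<noteq> []\<close>]) simp
    also have "a [^]\<^bsub>F\<^esub> k \<otimes>\<^bsub>F\<^esub> z \<otimes>\<^bsub>F\<^esub> inv\<^bsub>F\<^esub> (a [^]\<^bsub>F\<^esub> k) = g k \<otimes>\<^bsub>F\<^esub> w \<otimes>\<^bsub>F\<^esub> inv\<^bsub>F\<^esub> g k"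
      using a b w by (simp add: z_def g_def inv_mult_group m_assoc)
    finally show ?thesis .
  qed
  have "finite {k. g k \<otimes>\<^bsub>F\<^esub> x \<otimes>\<^bsub>F\<^esub> inv\<^bsub>F\<^esub> g k = y}" if "x \<in> carrier F - {\<one>\<^bsub>F\<^esub>}" for x y
  proof (rule finite_subset)
    show "{k. g k \<otimes>\<^bsub>F\<^esub> x \<otimes>\<^bsub>F\<^esub> inv\<^bsub>F\<^esub> g k = y} \<subseteq> {..max (length x) (length y)}"
    proof
      fix k assume "k \<in> {k. g k \<otimes>\<^bsub>F\<^esub> x \<otimes>\<^bsub>F\<^esub> inv\<^bsub>F\<^esub> g k = y}"
      then show "k \<in> {..max (length x) (length y)}"
        \<comment> \<open>Once k reaches the length of x the conjugate is longer than k, so it can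
          equal y only for k below the length of y.\<close>
        using len[of x k] that unfolding one by (cases "k \<ge> length x") auto
    qed
  qed simp
  then show ?thesis using g unfolding conj_mixing_def g_def a_def b_def F_def by blast
qed

section \<open>Mixing sequences in products, subgroups and quotients\<close>

text \<open>A nontrivial pair has one nontrivial component, and the index set for the pair lies in
  the finite index set of that component.\<close>

lemma conj_mixing_DirProd:
  assumes "group G" "group H" "conj_mixing G s" "conj_mixing H t"
  shows "conj_mixing (G \<times>\<times> H) (\<lambda>k. (s k, t k))"
  unfolding conj_mixing_def
proof (intro conjI allI ballI)
  interpret G: group G by fact
  interpret H: group H by fact
  have s: "s k \<in> carrier G" and t: "t k \<in> carrier H" for k using assms by (auto simp: conj_mixing_def)
  then show "(s k, t k) \<in> carrier (G \<times>\<times> H)" for k by simp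
  fix x y assume "x \<in> carrier (G \<times>\<times> H) - {\<one>\<^bsub>G \<times>\<times> H\<^esub>}" "y \<in> carrier (G \<times>\<times> H)"
  then obtain x1 x2 y1 y2 where xy: "x = (x1, x2)" "y = (y1, y2)" "x1 \<in> carrier G" "x2 \<in> carrier H"
    "y1 \<in> carrier G" "y2 \<in> carrier H" and ne: "x1 \<noteq> \<one>\<^bsub>G\<^esub> \<or> x2 \<noteq> \<one>\<^bsub>H\<^esub>" by auto
  have eq: "{k. (s k, t k) \<otimes>\<^bsub>G \<times>\<times> H\<^esub> x \<otimes>\<^bsub>G \<times>\<times> H\<^esub> inv\<^bsub>G \<times>\<times> H\<^esub> (s k, t k) = y}
      = {k. s k \<otimes>\<^bsub>G\<^esub> x1 \<otimes>\<^bsub>G\<^esub> inv\<^bsub>G\<^esub> s k = y1} \<inter> {k. t k \<otimes>\<^bsub>H\<^esub> x2 \<otimes>\<^bsub>H\<^esub> inv\<^bsub>H\<^esub> t k = y2}"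
    using s t assms(1,2) by (auto simp: xy)
  show "finite {k. (s k, t k) \<otimes>\<^bsub>G \<times>\<times> H\<^esub> x \<otimes>\<^bsub>G \<times>\<times> H\<^esub> inv\<^bsub>G \<times>\<times> H\<^esub> (s k, t k) = y}"
    unfolding eq using ne assms(3,4) xy unfolding conj_mixing_def by auto
qed

lemma conj_mixing_inj_hom:
  assumes "group G" "group H" "\<psi> \<in> hom G H" "inj_on \<psi> (carrier G)"
    and s: "\<And>k. s k \<in> carrier G" and mix: "conj_mixing H (\<lambda>k. \<psi> (s k))"
  shows "conj_mixing G s"
  unfolding conj_mixing_def
proof (intro conjI allI ballI s)
  interpret group_hom G H \<psi> using assms by (simp add: group_hom_def group_hom_axioms_def)
  fix x y assume x: "x \<in> carrier G - {\<one>\<^bsub>G\<^esub>}" and y: "y \<in> carrier G"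
  have "\<psi> x \<noteq> \<one>\<^bsub>H\<^esub>"
    using x inj_onD[OF assms(4), of x "\<one>\<^bsub>G\<^esub>"] by auto
  then have "finite {k. \<psi> (s k) \<otimes>\<^bsub>H\<^esub> \<psi> x \<otimes>\<^bsub>H\<^esub> inv\<^bsub>H\<^esub> \<psi> (s k) = \<psi> y}"
    using mix x y by (simp add: conj_mixing_def)
  moreover have "{k. s k \<otimes>\<^bsub>G\<^esub> x \<otimes>\<^bsub>G\<^esub> inv\<^bsub>G\<^esub> s k = y} \<subseteq> {k. \<psi> (s k) \<otimes>\<^bsub>H\<^esub> \<psi> x \<otimes>\<^bsub>H\<^esub> inv\<^bsub>H\<^esub> \<psi> (s k) = \<psi> y}"
    using s x by auto
  ultimately show "finite {k. s k \<otimes>\<^bsub>G\<^esub> x \<otimes>\<^bsub>G\<^esub> inv\<^bsub>G\<^esub> s k = y}" by (rule finite_subset[rotated])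
qed

lemma (in group_hom) FactGroup_embedding:
  obtains \<psi> where "\<psi> \<in> hom (G Mod kernel G H h) H"
    "\<And>x. x \<in> carrier G \<Longrightarrow> \<psi> (kernel G H h #> x) = h x"
    "inj_on \<psi> (carrier (G Mod kernel G H h))"
proof -
  obtain \<psi> where \<psi>: "\<psi> \<in> hom (G Mod kernel G H h) H"
    "\<And>x. x \<in> carrier G \<Longrightarrow> \<psi> (kernel G H h #> x) = h x"
    using FactGroup_universal_kernel[OF normal_kernel subset_refl] by blast
  have eq: "kernel G H h #> x = kernel G H h #> y" if x: "x \<in> carrier G" and y: "y \<in> carrier G" and e: "h x = h y" for x y
  proof (rule G.repr_independence[symmetric, OF _ y subgroup_kernel])
    have "x \<otimes> inv y \<in> kernel G H h" using x y e by (simp add: kernel_def)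
    then have "(x \<otimes> inv y) \<otimes> y \<in> kernel G H h #> y" by (auto simp: r_coset_def)
    then show "x \<in> kernel G H h #> y" using x y by (simp add: G.m_assoc)
  qed
  have "inj_on \<psi> (carrier (G Mod kernel G H h))"
  proof (rule inj_onI)
    fix X Y assume "X \<in> carrier (G Mod kernel G H h)" "Y \<in> carrier (G Mod kernel G H h)"
      and e: "\<psi> X = \<psi> Y"
    then obtain x y where x: "x \<in> carrier G" "X = kernel G H h #> x"
      and y: "y \<in> carrier G" "Y = kernel G H h #> y" by (auto simp: carrier_FactGroup)
    have "h x = h y" using e \<psi>(2)[OF x(1)] \<psi>(2)[OF y(1)] x(2) y(2) by simp
    then show "X = Y" unfolding x(2) y(2) by (rule eq[OF x(1) y(1)])
  qed
  then show ?thesis using that \<psi> by blast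
qed

context normal
begin

lemma lcosets_eq: "lcosets H = carrier (G Mod H)"
  using coset_eq by (auto simp: LCOSETS_def carrier_FactGroup)

text \<open>By normality the left cosets are the elements of the quotient group, and the action of g
  on them is multiplication by the class of g. Thus the quasi-regular representation factors through
  the regular one of the quotient.\<close>

lemma quasi_regular_eq:
  assumes g: "g \<in> carrier G"
  shows "quasi_regular_rep G H g = regular_rep (G Mod H) (H #> g)"
proof -
  interpret K: group "G Mod H" by (rule factorgroup_is_group)
  have eq: "inv\<^bsub>G Mod H\<^esub> (H #> g) \<otimes>\<^bsub>G Mod H\<^esub> C = inv g <# C"
    if "C \<in> carrier (G Mod H)" for C
  proof -
    from that obtain c where c: "c \<in> carrier G" and C: "C = H #> c" by (auto simp: carrier_FactGroup)
    have gK: "H #> g \<in> carrier (G Mod H)" using g by (auto simp: carrier_FactGroup)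
    have "inv\<^bsub>G Mod H\<^esub> (H #> g) = H #> inv g"
      using inv_FactGroup[OF gK] g by (simp add: rcos_inv)
    then have "inv\<^bsub>G Mod H\<^esub> (H #> g) \<otimes>\<^bsub>G Mod H\<^esub> C = H #> (inv g \<otimes> c)"
      using g c by (simp add: C rcos_sum)
    also have "\<dots> = (inv g \<otimes> c) <# H" using coset_eq g c by auto
    also have "\<dots> = inv g <# C"
      using lcos_m_assoc[OF subset, of "inv g" c] coset_eq g c by (simp add: C)
    finally show ?thesis .
  qed
  show ?thesis
    unfolding quasi_regular_rep_def regular_rep_def lcosets_eq
    using eq by (auto simp: fun_eq_iff)
qed

end

lemma unitary_rep_comp_hom:
  assumes "unitary_rep K X \<pi>" "f \<in> hom G K" "group G"
    and "\<And>g. g \<in> carrier G \<Longrightarrow> \<rho> g = \<pi> (f g)"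
  shows "unitary_rep G X \<rho>"
  using assms unfolding unitary_rep_def by (auto simp: hom_def Pi_iff group.is_monoid monoid.m_closed)

lemma (in normal) quasi_regular_unitary_rep: "unitary_rep G (ell2 (lcosets H)) (quasi_regular_rep G H)"
  unfolding lcosets_eq
  using group.unitary_rep_regular[OF factorgroup_is_group] r_coset_hom_Mod is_group quasi_regular_eq
  by (rule unitary_rep_comp_hom)

text \<open>Beyond being a unitary representation, the notion depends only on the set of operators,
  and the quotient map is onto, so both representations generate the same algebra.\<close>

lemma (in normal) quasi_regular_II1_factor:
  assumes "conj_mixing (G Mod H) s" and "x \<in> carrier G" "x \<notin> H"
  shows "type_II1_factor_rep G (ell2 (lcosets H)) (quasi_regular_rep G H)"
proof -
  interpret K: group "G Mod H" by (rule factorgroup_is_group)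
  have "H #> x \<in> carrier (G Mod H)" using assms(2) by (auto simp: carrier_FactGroup)
  moreover have "H #> x \<noteq> \<one>\<^bsub>G Mod H\<^esub>"
    using rcos_self[OF assms(2) subgroup_axioms] assms(3) by auto
  ultimately have "type_II1_factor_rep (G Mod H) (ell2 (carrier (G Mod H))) (regular_rep (G Mod H))"
    using K.regular_rep_II1_factor[OF assms(1)] by blast
  moreover have "quasi_regular_rep G H ` carrier G = regular_rep (G Mod H) ` carrier (G Mod H)"
    by (auto simp: carrier_FactGroup quasi_regular_eq image_iff)
  ultimately show ?thesis
    using quasi_regular_unitary_rep by (simp add: type_II1_factor_rep_def lcosets_eq)
qed

theorem quasi_regular_phi_II1_factor:
  assumes n: "n \<ge> 2" and m: "m \<ge> 2"
    and \<phi>: "\<phi> \<in> hom (free_group (n * m)) (free_group n \<times>\<times> free_group m)"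
    and gen: "\<And>i j. i \<in> {1..n} \<Longrightarrow> j \<in> {1..m}
           \<Longrightarrow> \<phi> (free_gen (m * (i - 1) + j)) = (free_gen i, free_gen j)"
    and G: "G = kernel (free_group (n * m)) (free_group n \<times>\<times> free_group m) \<phi>"
  shows "type_II1_factor_rep (free_group (n * m))
      (ell2 (lcosets\<^bsub>free_group (n * m)\<^esub> G)) (quasi_regular_rep (free_group (n * m)) G)"
proof -
  define F where "F = free_group (n * m)"
  define P where "P = free_group n \<times>\<times> free_group m"
  have gF: "group F" and gn: "group (free_group n)" and gm: "group (free_group m)"
    by (simp_all add: F_def group_free_group)
  have gP: "group P" unfolding P_def by (rule DirProd_group[OF gn gm])
  interpret F: group F by fact
  interpret P: group P by fact
  interpret group_hom F P \<phi> using \<phi> gF gP by (simp add: group_hom_def group_hom_axioms_def F_def P_def)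
  have GN: "G = kernel F P \<phi>" using G by (simp add: F_def P_def)
  interpret normal G F unfolding GN by (rule normal_kernel)
  obtain \<psi> where \<psi>: "\<psi> \<in> hom (F Mod G) P" "\<And>x. x \<in> carrier F \<Longrightarrow> \<psi> (G #>\<^bsub>F\<^esub> x) = \<phi> x"
    "inj_on \<psi> (carrier (F Mod G))"
    using FactGroup_embedding unfolding GN by blast
  have two: "(2::nat) \<in> {1..n}" "(2::nat) \<in> {1..m}" "(1::nat) \<in> {1..n}" "(1::nat) \<in> {1..m}"
    using n m by auto
  \<comment> \<open>Indices 1 and m + 2 are m (i - 1) + j for i = j = 1 and i = j = 2, so both
    components of the image are the standard mixing sequences with a common k.\<close>
  define a where "a = free_gen 1"
  define b where "b = free_gen (m + 2)"
  have "m + 2 \<le> n * m" using m mult_le_mono1[OF n, of m] by linarith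
  then have a: "a \<in> carrier F" and b: "b \<in> carrier F"
    unfolding a_def b_def F_def using n m by (auto intro!: free_gen_carrier)
  have \<phi>a: "\<phi> a = (free_gen 1, free_gen 1)" using gen[OF two(3,4)] by (simp add: a_def)
  have \<phi>b: "\<phi> b = (free_gen 2, free_gen 2)" using gen[OF two(1,2)] by (simp add: b_def)
  define \<gamma> where "\<gamma> k = a [^]\<^bsub>F\<^esub> k \<otimes>\<^bsub>F\<^esub> b [^]\<^bsub>F\<^esub> k" for k :: nat
  have \<gamma>: "\<gamma> k \<in> carrier F" for k using a b by (simp add: \<gamma>_def)
  have pow: "(x, y) [^]\<^bsub>P\<^esub> k = (x [^]\<^bsub>free_group n\<^esub> k, y [^]\<^bsub>free_group m\<^esub> k)" for x y and k :: nat
    by (induction k) (auto simp: P_def)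
  let ?s = "\<lambda>n k. free_gen 1 [^]\<^bsub>free_group n\<^esub> k \<otimes>\<^bsub>free_group n\<^esub> free_gen 2 [^]\<^bsub>free_group n\<^esub> (k::nat)"
  have \<phi>\<gamma>: "\<phi> (\<gamma> k) = (?s n k, ?s m k)" for k
    using a b by (simp add: \<gamma>_def hom_nat_pow \<phi>a \<phi>b pow) (simp add: P_def)
  have "conj_mixing P (\<lambda>k. (?s n k, ?s m k))"
    unfolding P_def by (intro conj_mixing_DirProd gn gm conj_mixing_free_group two) auto
  then have "conj_mixing (F Mod G) (\<lambda>k. G #>\<^bsub>F\<^esub> \<gamma> k)"
    using \<gamma> by (intro conj_mixing_inj_hom[OF factorgroup_is_group gP \<psi>(1,3)])
      (auto simp: \<psi>(2) \<phi>\<gamma> carrier_FactGroup)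
  moreover have "\<phi> a \<noteq> \<one>\<^bsub>P\<^esub>"
    unfolding \<phi>a P_def by (simp add: one_free_group) (simp add: free_gen_def)
  then have "a \<notin> G" unfolding GN kernel_def by blast
  ultimately show ?thesis unfolding F_def[symmetric] by (rule quasi_regular_II1_factor[OF _ a])
qed

section \<open>Orthonormal bases\<close>

text \<open>Polarization: the norm of x + y gives the real part of the inner product, and replacing
  y by \<i> y turns the imaginary part into a real one.\<close>

lemma hinner_preserved_by_isometry:
  assumes "hilbert_space H" "hilbert_space K"
    and V: "\<And>x. x \<in> carrier H \<Longrightarrow> V x \<in> carrier K"
    and add: "\<And>x y. \<lbrakk>x \<in> carrier H; y \<in> carrier H\<rbrakk> \<Longrightarrow> V (x \<oplus>\<^bsub>H\<^esub> y) = V x \<oplus>\<^bsub>K\<^esub> V y"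
    and smult: "\<And>c x. x \<in> carrier H \<Longrightarrow> V (c \<odot>\<^bsub>H\<^esub> x) = c \<odot>\<^bsub>K\<^esub> V x"
    and norm: "\<And>x. x \<in> carrier H \<Longrightarrow> hnorm K (V x) = hnorm H x"
    and x: "x \<in> carrier H" and y: "y \<in> carrier H"
  shows "hinner K (V x) (V y) = hinner H x y"
proof -
  interpret H: hilbert_space H by fact
  interpret K: hilbert_space K by fact
  have re: "Re (hinner K (V x) (V y)) = Re (hinner H x y)" if x: "x \<in> carrier H" and y: "y \<in> carrier H" for x y
  proof -
    have "(hnorm H (x \<oplus>\<^bsub>H\<^esub> y))\<^sup>2 = (hnorm H x)\<^sup>2 + 2 * Re (hinner H x y) + (hnorm H y)\<^sup>2"
      using x y H.hinner_commute[OF x y] by (simp add: H.hnorm_sq H.hinner_add_left H.hinner_add_right)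
    moreover have "(hnorm K (V x \<oplus>\<^bsub>K\<^esub> V y))\<^sup>2 = (hnorm K (V x))\<^sup>2 + 2 * Re (hinner K (V x) (V y)) + (hnorm K (V y))\<^sup>2"
      using V x y K.hinner_commute[OF V[OF x] V[OF y]]
      by (simp add: K.hnorm_sq K.hinner_add_left K.hinner_add_right)
    moreover have "hnorm K (V x \<oplus>\<^bsub>K\<^esub> V y) = hnorm H (x \<oplus>\<^bsub>H\<^esub> y)"
      using x y norm[of "x \<oplus>\<^bsub>H\<^esub> y"] by (simp add: add)
    ultimately show ?thesis using norm[OF x] norm[OF y] by simp
  qed
  have "Re (hinner K (V x) (V (\<i> \<odot>\<^bsub>H\<^esub> y))) = Re (hinner H x (\<i> \<odot>\<^bsub>H\<^esub> y))"
    using x y by (intro re) auto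
  then have "Im (hinner K (V x) (V y)) = Im (hinner H x y)"
    using x y V by (simp add: smult H.hinner_smult_right K.hinner_smult_right)
  then show ?thesis using re[OF x y] by (simp add: complex_eq_iff)
qed

text \<open>For the projection c of x onto the span of the chosen vectors, the inner products of c
  with itself and with x are both L^2. Cauchy-Schwarz gives L^2 \<le> L times the norm of x.\<close>

lemma (in hilbert_space) Bessel:
  assumes e: "\<And>i. i \<in> I \<Longrightarrow> e i \<in> carrier H"
    and orth: "\<And>i j. \<lbrakk>i \<in> I; j \<in> I\<rbrakk> \<Longrightarrow> hinner H (e i) (e j) = (if i = j then 1 else 0)"
    and F: "finite F" "F \<subseteq> I" and x: "x \<in> carrier H"
  shows "L2_set (\<lambda>i. cmod (hinner H x (e i))) F \<le> hnorm H x"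
proof -
  define f where "f i = hinner H x (e i)" for i
  let ?L = "L2_set (\<lambda>i. cmod (f i)) F"
  define c where "c = finsum H (\<lambda>i. f i \<odot> e i) F"
  have fe: "f i \<odot> e i \<in> carrier H" if "i \<in> F" for i using that F e by auto
  have c: "c \<in> carrier H" unfolding c_def using fe by (intro M.finsum_closed) auto
  have cz: "hinner H c z = (\<Sum>i\<in>F. f i * hinner H (e i) z)" if "z \<in> carrier H" for z
  proof -
    have "hinner H c z = (\<Sum>i\<in>F. hinner H (f i \<odot> e i) z)"
      unfolding c_def using F(1) fe that by (rule hinner_finsum_left)
    also have "\<dots> = (\<Sum>i\<in>F. f i * hinner H (e i) z)"
      using F e that by (intro sum.cong refl hinner_smult_left) auto
    finally show ?thesis .
  qed
  have L: "(\<Sum>i\<in>F. f i * cnj (f i)) = complex_of_real (?L\<^sup>2)"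
    by (simp add: L2_set_def sum_nonneg complex_norm_square del: of_real_power)
  have "hinner H c (e j) = f j" if "j \<in> F" for j
  proof -
    have "hinner H c (e j) = (\<Sum>i\<in>F. if j = i then f i else 0)"
      unfolding cz[OF e[OF subsetD[OF F(2) that]]] using F that by (intro sum.cong) (auto simp: orth subset_iff)
    then show ?thesis using F that by simp
  qed
  then have "hinner H (e i) c = cnj (f i)" if "i \<in> F" for i
    using hinner_commute[OF c e, of i] that F by auto
  then have cc: "hinner H c c = complex_of_real (?L\<^sup>2)" unfolding cz[OF c] L[symmetric] by simp
  have "hinner H (e i) x = cnj (f i)" if "i \<in> F" for i
    using hinner_commute[OF x e, of i] that F by (auto simp: f_def)
  then have cx: "hinner H c x = complex_of_real (?L\<^sup>2)" unfolding cz[OF x] L[symmetric] by simp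
  have "hnorm H c = ?L" by (simp add: hnorm_def cc)
  moreover have "?L\<^sup>2 = cmod (hinner H c x)" by (simp add: cx norm_power)
  ultimately have "?L * ?L \<le> hnorm H x * ?L"
    using Cauchy_Schwarz[OF c x] by (simp add: power2_eq_square mult.commute)
  moreover have "0 < ?L" if "?L \<noteq> 0" using that L2_set_nonneg[of "\<lambda>i. cmod (f i)" F] by linarith
  ultimately have "?L \<le> hnorm H x"
    using hnorm_nonneg[OF x] mult_right_le_imp_le[of ?L ?L "hnorm H x"] by (cases "?L = 0") simp_all
  then show ?thesis by (simp add: f_def)
qed

text \<open>The vector is a limit of sums over finite sets \<open>F k\<close> that miss at most
  1/(k+1) of the squared norm of f. No enumeration or countability of I is involved.\<close>

lemma (in hilbert_space) Riesz_Fischer: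
  assumes e: "\<And>i. i \<in> I \<Longrightarrow> e i \<in> carrier H"
    and orth: "\<And>i j. \<lbrakk>i \<in> I; j \<in> I\<rbrakk> \<Longrightarrow> hinner H (e i) (e j) = (if i = j then 1 else 0)"
    and f: "f \<in> carrier (ell2 I)"
  obtains z where "z \<in> carrier H" "\<And>i. i \<in> I \<Longrightarrow> hinner H z (e i) = f i"
    "hnorm H z = hnorm (ell2 I) f"
proof -
  define n where "n i = (cmod (f i))\<^sup>2" for i
  define S where "S = infsum n I"
  have sn: "n summable_on I" using f by (simp add: ell2_iff n_def[abs_def])
  have le_S: "sum n F \<le> S" if "finite F" "F \<subseteq> I" for F
    unfolding S_def using that sn by (intro finite_sum_le_infsum) (auto simp: n_def)
  have "\<exists>F. finite F \<and> F \<subseteq> I \<and> S - sum n F \<le> inverse (real (Suc k))" for k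
    using infsum_finite_approximation[OF sn, of "inverse (real (Suc k))"]
    by (auto simp: S_def dist_real_def abs_le_iff)
  then obtain F where F: "\<And>k. finite (F k)" "\<And>k. F k \<subseteq> I" "\<And>k. S - sum n (F k) \<le> inverse (real (Suc k))"
    by metis
  define z where "z k = finsum H (\<lambda>i. f i \<odot> e i) (F k)" for k
  have fe: "f i \<odot> e i \<in> carrier H" if "i \<in> F k" for i k using that F(2) e by blast
  have z: "z k \<in> carrier H" for k unfolding z_def using fe by (intro M.finsum_closed) auto
  have zx: "hinner H (z k) x = (\<Sum>i\<in>F k. f i * hinner H (e i) x)" if "x \<in> carrier H" for k x
  proof -
    have "hinner H (z k) x = (\<Sum>i\<in>F k. hinner H (f i \<odot> e i) x)"
      unfolding z_def using F(1) fe that by (rule hinner_finsum_left)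
    also have "\<dots> = (\<Sum>i\<in>F k. f i * hinner H (e i) x)"
    proof (intro sum.cong refl)
      fix i assume "i \<in> F k"
      then have "e i \<in> carrier H" using F(2) e by blast
      then show "hinner H (f i \<odot> e i) x = f i * hinner H (e i) x" using that by (rule hinner_smult_left)
    qed
    finally show ?thesis .
  qed
  have ze: "hinner H (z k) (e j) = (if j \<in> F k then f j else 0)" if "j \<in> I" for j k
  proof -
    have "hinner H (z k) (e j) = (\<Sum>i\<in>F k. if j = i then f i else 0)"
      unfolding zx[OF e[OF that]] using F(2)[of k] that by (intro sum.cong) (auto simp: orth subset_iff)
    then show ?thesis using F(1) by simp
  qed
  have zz: "hinner H (z k) (z l) = complex_of_real (sum n (F k \<inter> F l))" for k l
  proof -
    have "hinner H (z k) (z l) = (\<Sum>i\<in>F k. if i \<in> F l then complex_of_real (n i) else 0)"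
      unfolding zx[OF z]
    proof (intro sum.cong refl)
      fix i assume "i \<in> F k"
      then have i: "i \<in> I" using F(2) by blast
      show "f i * hinner H (e i) (z l) = (if i \<in> F l then complex_of_real (n i) else 0)"
        using hinner_commute[OF z e[OF i], of l] ze[OF i, of l] by (simp add: n_def complex_norm_square del: of_real_power)
    qed
    then show ?thesis by (simp add: sum.inter_restrict[OF F(1)]) (rule sum.cong; simp)
  qed
  have norm_z: "(hnorm H (z k))\<^sup>2 = sum n (F k)" for k by (simp add: hnorm_sq z zz)
  have diff_sq: "(hnorm H (z k \<ominus> z l))\<^sup>2 \<le> inverse (real (Suc k)) + inverse (real (Suc l))" for k l
  proof -
    \<comment> \<open>The sets \<open>F k\<close> need not be nested, so the difference of two sums
      lives on a symmetric difference. Each half of that is part of what the other set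
      misses.\<close>
    have half: "sum n (F k) - sum n (F k \<inter> F l) \<le> inverse (real (Suc l))" for k l
    proof -
      have "sum n (F k) - sum n (F k \<inter> F l) = sum n (F k \<union> F l) - sum n (F l)"
        using F(1) by (simp add: sum_Un)
      also have "\<dots> \<le> S - sum n (F l)" using le_S[of "F k \<union> F l"] F by simp
      finally show ?thesis using F(3)[of l] by simp
    qed
    have "(hnorm H (z k \<ominus> z l))\<^sup>2 = sum n (F k) - 2 * sum n (F k \<inter> F l) + sum n (F l)"
      using z by (simp add: hnorm_sq hinner_minus_left hinner_minus_right zz Int_commute)
    then show ?thesis using half[of k l] half[of l k] by (simp add: Int_commute)
  qed
  have cauchy: "\<exists>N. \<forall>k\<ge>N. \<forall>l\<ge>N. hnorm H (z k \<ominus> z l) < \<epsilon>" if "\<epsilon> > 0" for \<epsilon>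
  proof -
    have "0 < \<epsilon>\<^sup>2 / 2" using that by simp
    then obtain N where N: "inverse (real (Suc N)) < \<epsilon>\<^sup>2 / 2"
      using reals_Archimedean by blast
    have "hnorm H (z k \<ominus> z l) < \<epsilon>" if "k \<ge> N" "l \<ge> N" for k l
    proof -
      have "inverse (real (Suc k)) \<le> inverse (real (Suc N))" "inverse (real (Suc l)) \<le> inverse (real (Suc N))"
        using that by (auto intro!: le_imp_inverse_le)
      then have "(hnorm H (z k \<ominus> z l))\<^sup>2 < \<epsilon>\<^sup>2" using diff_sq[of k l] N by linarith
      then show ?thesis using \<open>\<epsilon> > 0\<close> by (simp add: power2_less_imp_less)
    qed
    then show ?thesis by blast
  qed
  obtain x where x: "x \<in> carrier H" and lim: "(\<lambda>k. hnorm H (z k \<ominus> x)) \<longlonglongrightarrow> 0"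
    using Cauchy_limit[of z, OF z cauchy] by blast
  have inv0: "(\<lambda>k. inverse (real (Suc k))) \<longlonglongrightarrow> 0" by (rule LIMSEQ_inverse_real_of_nat)
  have "hinner H x (e i) = f i" if i: "i \<in> I" for i
  proof (rule LIMSEQ_unique)
    show "(\<lambda>k. hinner H (z k) (e i)) \<longlonglongrightarrow> hinner H x (e i)"
      by (rule tendsto_hinner_left[OF z x e[OF i] lim])
    show "(\<lambda>k. hinner H (z k) (e i)) \<longlonglongrightarrow> f i"
    proof (rule LIM_zero_cancel, rule Lim_null_comparison)
      \<comment> \<open>A coordinate outside \<open>F k\<close> belongs to the missed part and is
        bounded by its size.\<close>
      have "norm (hinner H (z k) (e i) - f i) \<le> sqrt (inverse (real (Suc k)))" for k
      proof (cases "i \<in> F k")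
        case False
        then have "n i + sum n (F k) \<le> S" using le_S[of "insert i (F k)"] F(1,2)[of k] i by simp
        then have "(cmod (f i))\<^sup>2 \<le> inverse (real (Suc k))" using F(3)[of k] by (simp add: n_def)
        then show ?thesis using False by (simp add: ze[OF i] real_le_rsqrt)
      qed (simp add: ze[OF i])
      then show "\<forall>\<^sub>F k in sequentially. norm (hinner H (z k) (e i) - f i) \<le> sqrt (inverse (real (Suc k)))" by simp
      show "(\<lambda>k. sqrt (inverse (real (Suc k)))) \<longlonglongrightarrow> 0" using tendsto_real_sqrt[OF inv0] by simp
    qed
  qed
  moreover have "hnorm H x = hnorm (ell2 I) f"
  proof -
    have "(\<lambda>k. sum n (F k)) \<longlonglongrightarrow> (hnorm H x)\<^sup>2"
      using tendsto_power[OF tendsto_hnorm[OF z x lim], of 2] by (simp add: norm_z)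
    moreover have "(\<lambda>k. sum n (F k)) \<longlonglongrightarrow> S"
    proof (rule LIM_zero_cancel, rule Lim_null_comparison[OF _ inv0])
      show "\<forall>\<^sub>F k in sequentially. norm (sum n (F k) - S) \<le> inverse (real (Suc k))"
        using F le_S by (simp add: abs_le_iff)
    qed
    ultimately have "(hnorm H x)\<^sup>2 = S" by (rule LIMSEQ_unique)
    then have "hnorm H x = sqrt S" using x by (metis hnorm_nonneg real_sqrt_unique)
    then show ?thesis by (simp add: ell2_hnorm[OF f] S_def n_def[abs_def])
  qed
  ultimately show ?thesis using that x by blast
qed

text \<open>Parseval comes from totality: the vector that \<open>Riesz_Fischer\<close> builds from
  the coefficients of x has the right norm and the same coefficients, so it is x.\<close>

theorem (in hilbert_space) orthonormal_basis_unitary: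
  assumes e: "\<And>i. i \<in> I \<Longrightarrow> e i \<in> carrier H"
    and orth: "\<And>i j. \<lbrakk>i \<in> I; j \<in> I\<rbrakk> \<Longrightarrow> hinner H (e i) (e j) = (if i = j then 1 else 0)"
    and total: "\<And>x. \<lbrakk>x \<in> carrier H; \<And>i. i \<in> I \<Longrightarrow> hinner H x (e i) = 0\<rbrakk> \<Longrightarrow> x = \<zero>"
  shows "unitary_between H (ell2 I) (\<lambda>x i. if i \<in> I then hinner H x (e i) else 0)"
proof -
  define V where "V x i = (if i \<in> I then hinner H x (e i) else 0)" for x i
  have V: "V x \<in> carrier (ell2 I)" if x: "x \<in> carrier H" for x
    unfolding ell2_iff_bdd
  proof (intro conjI exI allI impI)
    fix F assume F: "finite F" "F \<subseteq> I"
    have "L2_set (\<lambda>i. cmod (V x i)) F = L2_set (\<lambda>i. cmod (hinner H x (e i))) F"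
      using F by (intro L2_set_cong) (auto simp: V_def)
    then show "L2_set (\<lambda>i. cmod (V x i)) F \<le> hnorm H x" using Bessel[OF e orth F x] by simp
  qed (simp add: V_def)
  have inj: "x = y" if x: "x \<in> carrier H" and y: "y \<in> carrier H" and eq: "V x = V y" for x y
  proof -
    have "hinner H x (e i) = hinner H y (e i)" if "i \<in> I" for i
      using fun_cong[OF eq, of i] that by (simp add: V_def)
    then have "x \<ominus> y = \<zero>" using x y e by (intro total) (auto simp: hinner_minus_left)
    then show ?thesis using x y by (simp add: minus_eq_zero_iff)
  qed
  have surj: "\<exists>x\<in>carrier H. V x = f \<and> hnorm H x = hnorm (ell2 I) f" if f: "f \<in> carrier (ell2 I)" for f
  proof -
    obtain x where x: "x \<in> carrier H" "\<And>i. i \<in> I \<Longrightarrow> hinner H x (e i) = f i" "hnorm H x = hnorm (ell2 I) f"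
      using Riesz_Fischer[where e = e, OF e orth f] by blast
    have "V x = f" using x(2) ell2_outside[OF f] by (auto simp: V_def fun_eq_iff)
    then show ?thesis using x by blast
  qed
  have norm: "hnorm (ell2 I) (V x) = hnorm H x" if x: "x \<in> carrier H" for x
    using surj[OF V[OF x]] inj[OF _ x] by metis
  have add: "V (x \<oplus> y) = V x \<oplus>\<^bsub>ell2 I\<^esub> V y" if "x \<in> carrier H" "y \<in> carrier H" for x y
    using that e by (auto simp: V_def fun_eq_iff hinner_add_left)
  have smult: "V (c \<odot> x) = c \<odot>\<^bsub>ell2 I\<^esub> V x" if "x \<in> carrier H" for c x
    using that e by (auto simp: V_def fun_eq_iff hinner_smult_left)
  have "bij_betw V (carrier H) (carrier (ell2 I))"
    unfolding bij_betw_def using inj V surj by (force intro!: inj_onI)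
  then have "unitary_between H (ell2 I) V"
    unfolding unitary_between_def
    using add smult hinner_preserved_by_isometry[OF hilbert_space_axioms hilbert_space_ell2 V add smult norm]
    by blast
  then show ?thesis by (simp add: V_def[abs_def])
qed

section \<open>Transport along unitaries\<close>

lemma unitary_between_comp:
  assumes V: "unitary_between H K V" and W: "unitary_between K L W"
  shows "unitary_between H L (\<lambda>x. W (V x))"
  using unitary_betweenD(2-5)[OF V] unitary_betweenD(2-5)[OF W]
    bij_betw_trans[OF unitary_betweenD(1)[OF V] unitary_betweenD(1)[OF W]]
  unfolding unitary_between_def comp_def by simp

lemma unitary_between_inv:
  assumes V: "unitary_between H K V" and "hilbert_space H"
  shows "unitary_between K H (inv_into (carrier H) V)"
proof -
  interpret hilbert_space H by fact
  let ?W = "inv_into (carrier H) V"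
  have bij: "bij_betw V (carrier H) (carrier K)" by (rule unitary_betweenD(1)[OF V])
  have W: "?W y \<in> carrier H" "V (?W y) = y" if "y \<in> carrier K" for y
    using bij that by (auto simp: bij_betw_def inv_into_into f_inv_into_f)
  have VW: "?W (V x) = x" if "x \<in> carrier H" for x using bij that by (simp add: bij_betw_def)
  show ?thesis
    unfolding unitary_between_def
  proof (intro conjI ballI allI)
    show "bij_betw ?W (carrier K) (carrier H)" by (rule bij_betw_inv_into[OF bij])
    fix x y assume x: "x \<in> carrier K" and y: "y \<in> carrier K"
    have "V (?W x \<oplus>\<^bsub>H\<^esub> ?W y) = x \<oplus>\<^bsub>K\<^esub> y" using W x y by (simp add: unitary_betweenD(3)[OF V])
    then show "?W (x \<oplus>\<^bsub>K\<^esub> y) = ?W x \<oplus>\<^bsub>H\<^esub> ?W y" using VW[of "?W x \<oplus>\<^bsub>H\<^esub> ?W y"] W x y by simp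
    show "hinner H (?W x) (?W y) = hinner K x y"
      using unitary_betweenD(5)[OF V W(1)[OF x] W(1)[OF y]] W x y by simp
  next
    fix c x assume x: "x \<in> carrier K"
    have "V (c \<odot>\<^bsub>H\<^esub> ?W x) = c \<odot>\<^bsub>K\<^esub> x" using W x by (simp add: unitary_betweenD(4)[OF V])
    then show "?W (c \<odot>\<^bsub>K\<^esub> x) = c \<odot>\<^bsub>H\<^esub> ?W x" using VW[of "c \<odot>\<^bsub>H\<^esub> ?W x"] W x by simp
  qed
qed

text \<open>Used to obtain all axioms for \<open>inf_copies\<close>, including completeness, from a
  space of square summable functions. The zero field of K is not mentioned by
  \<open>unitary_between\<close>, hence the assumption \<open>zero\<close>.\<close>

lemma hilbert_space_transfer:
  assumes "hilbert_space H" and V: "unitary_between H K V" and zero: "\<zero>\<^bsub>K\<^esub> = V \<zero>\<^bsub>H\<^esub>"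
  shows "hilbert_space K"
proof -
  interpret H: hilbert_space H by fact
  note cl = unitary_betweenD(2)[OF V] and add = unitary_betweenD(3)[OF V]
    and smult = unitary_betweenD(4)[OF V] and hin = unitary_betweenD(5)[OF V]
  have sur: "\<exists>a\<in>carrier H. x = V a" if "x \<in> carrier K" for x
    using unitary_betweenD(1)[OF V] that by (auto simp: bij_betw_def)
  have inj: "V a = V b \<longleftrightarrow> a = b" if "a \<in> carrier H" "b \<in> carrier H" for a b
    using unitary_betweenD(1)[OF V] that by (auto simp: bij_betw_def inj_on_def)
  have abel: "abelian_group K"
  proof (rule abelian_groupI)
    show "\<zero>\<^bsub>K\<^esub> \<in> carrier K" unfolding zero by (rule cl) simp
    fix x assume x: "x \<in> carrier K"
    then obtain a where a: "a \<in> carrier H" "x = V a" using sur by blast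
    show "\<zero>\<^bsub>K\<^esub> \<oplus>\<^bsub>K\<^esub> x = x" using a by (simp add: zero flip: add)
    have "V (\<ominus>\<^bsub>H\<^esub> a) \<oplus>\<^bsub>K\<^esub> x = \<zero>\<^bsub>K\<^esub>" using a by (simp add: zero H.M.l_neg flip: add)
    then show "\<exists>y\<in>carrier K. y \<oplus>\<^bsub>K\<^esub> x = \<zero>\<^bsub>K\<^esub>" using a cl by blast
    fix y assume "y \<in> carrier K"
    then obtain b where b: "b \<in> carrier H" "y = V b" using sur by blast
    show "x \<oplus>\<^bsub>K\<^esub> y \<in> carrier K" using a b cl by (simp flip: add)
    show "x \<oplus>\<^bsub>K\<^esub> y = y \<oplus>\<^bsub>K\<^esub> x" using a b by (simp add: H.M.a_comm flip: add)
    fix z assume "z \<in> carrier K"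
    then obtain c where c: "c \<in> carrier H" "z = V c" using sur by blast
    show "x \<oplus>\<^bsub>K\<^esub> y \<oplus>\<^bsub>K\<^esub> z = x \<oplus>\<^bsub>K\<^esub> (y \<oplus>\<^bsub>K\<^esub> z)" using a b c by (simp add: H.M.a_assoc flip: add)
  qed
  interpret K: abelian_group K by (rule abel)
  have mod: "module complex_ring K"
  proof (rule moduleI[OF cring_complex_ring abel])
    fix c x assume "x \<in> carrier K"
    then obtain a where a: "a \<in> carrier H" "x = V a" using sur by blast
    show "c \<odot>\<^bsub>K\<^esub> x \<in> carrier K" using a cl by (simp flip: smult)
    show "\<one>\<^bsub>complex_ring\<^esub> \<odot>\<^bsub>K\<^esub> x = x" using a H.smult_one by (simp flip: smult)
    fix d
    show "(c \<oplus>\<^bsub>complex_ring\<^esub> d) \<odot>\<^bsub>K\<^esub> x = c \<odot>\<^bsub>K\<^esub> x \<oplus>\<^bsub>K\<^esub> d \<odot>\<^bsub>K\<^esub> x"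
      using a H.smult_l_distr[of c d a] by (simp add: complex_ring_def flip: smult add)
    show "(c \<otimes>\<^bsub>complex_ring\<^esub> d) \<odot>\<^bsub>K\<^esub> x = c \<odot>\<^bsub>K\<^esub> (d \<odot>\<^bsub>K\<^esub> x)"
      using a H.smult_assoc1[of c d a] by (simp add: complex_ring_def flip: smult)
    fix y assume "y \<in> carrier K"
    then obtain b where b: "b \<in> carrier H" "y = V b" using sur by blast
    show "c \<odot>\<^bsub>K\<^esub> (x \<oplus>\<^bsub>K\<^esub> y) = c \<odot>\<^bsub>K\<^esub> x \<oplus>\<^bsub>K\<^esub> c \<odot>\<^bsub>K\<^esub> y"
      using a b H.smult_r_distr[of c a b] by (simp add: complex_ring_def flip: smult add)
  qed
  have uminus: "\<ominus>\<^bsub>K\<^esub> V a = V (\<ominus>\<^bsub>H\<^esub> a)" if "a \<in> carrier H" for a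
    using that cl by (intro K.minus_equality) (auto simp: zero H.M.l_neg simp flip: add)
  have dist: "hdist K (V a) (V b) = hdist H a b" if "a \<in> carrier H" "b \<in> carrier H" for a b
    using that cl unitary_betweenD(6)[OF V, of "a \<ominus>\<^bsub>H\<^esub> b"] by (simp add: hdist_def a_minus_def uminus flip: add)
  interpret MH: Metric_space "carrier H" "hdist H" by (rule H.Metric_space_hdist)
  \<comment> \<open>Completeness of K can only be unfolded inside the metric space locale; its laws
    hold because V preserves distances.\<close>
  interpret MK: Metric_space "carrier K" "hdist K"
  proof
    fix x y z
    have off: "hdist K x y = 0" if "x \<notin> carrier K \<or> y \<notin> carrier K" for x y using that by (auto simp: hdist_def)
    show "0 \<le> hdist K x y"
    proof (cases "x \<in> carrier K \<and> y \<in> carrier K")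
      case True
      then show ?thesis using sur dist MH.nonneg by metis
    qed (use off in auto)
    show "hdist K x y = hdist K y x"
    proof (cases "x \<in> carrier K \<and> y \<in> carrier K")
      case True
      then show ?thesis using sur dist MH.commute by metis
    qed (use off in auto)
    assume x: "x \<in> carrier K" and y: "y \<in> carrier K"
    then obtain a b where ab: "a \<in> carrier H" "x = V a" "b \<in> carrier H" "y = V b" using sur by metis
    then show "hdist K x y = 0 \<longleftrightarrow> x = y" using dist inj MH.zero by simp
    assume "z \<in> carrier K"
    then obtain c where "c \<in> carrier H" "z = V c" using sur by metis
    then show "hdist K x z \<le> hdist K x y + hdist K y z" using ab dist MH.triangle by simp
  qed
  have k6: "MK.mcomplete"
    unfolding MK.mcomplete_def
  proof (intro allI impI)
    fix \<sigma> assume \<sigma>: "MK.MCauchy \<sigma>"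
    then have "\<sigma> k \<in> carrier K" for k unfolding MK.MCauchy_def by blast
    then have "\<exists>a. a \<in> carrier H \<and> \<sigma> k = V a" for k using sur by blast
    then obtain \<tau> where \<tau>: "\<And>k. \<tau> k \<in> carrier H" "\<And>k. \<sigma> k = V (\<tau> k)" by metis
    have "MH.MCauchy \<tau>" using \<sigma> \<tau> unfolding MH.MCauchy_def MK.MCauchy_def by (auto simp: dist)
    then obtain x where x: "limitin MH.mtopology \<tau> x sequentially"
      using H.complete unfolding MH.mcomplete_def by blast
    then have xH: "x \<in> carrier H" by (simp add: MH.limit_metric_sequentially)
    then have "limitin MK.mtopology \<sigma> (V x) sequentially"
      using x \<tau> cl by (simp add: MH.limit_metric_sequentially MK.limit_metric_sequentially dist)
    then show "\<exists>x. limitin MK.mtopology \<sigma> x sequentially" by blast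
  qed
  have k1: "hinner K (x \<oplus>\<^bsub>K\<^esub> y) z = hinner K x z + hinner K y z"
    if "x \<in> carrier K" "y \<in> carrier K" "z \<in> carrier K" for x y z
  proof -
    from that sur obtain a b c where "a \<in> carrier H" "x = V a" "b \<in> carrier H" "y = V b" "c \<in> carrier H" "z = V c"
      by metis
    then show ?thesis by (simp add: hin H.hinner_add_left flip: add)
  qed
  have k2: "hinner K (c \<odot>\<^bsub>K\<^esub> x) y = c * hinner K x y" and k3: "hinner K y x = cnj (hinner K x y)"
    if "x \<in> carrier K" "y \<in> carrier K" for c x y
  proof -
    from that sur obtain a b where "a \<in> carrier H" "x = V a" "b \<in> carrier H" "y = V b" by metis
    then show "hinner K (c \<odot>\<^bsub>K\<^esub> x) y = c * hinner K x y" "hinner K y x = cnj (hinner K x y)"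
      using H.hinner_commute[of a b] by (simp_all add: hin H.hinner_smult_left flip: smult)
  qed
  have k4: "0 \<le> Re (hinner K x x)" and k5: "hinner K x x = 0 \<Longrightarrow> x = \<zero>\<^bsub>K\<^esub>" if "x \<in> carrier K" for x
  proof -
    from that sur obtain a where "a \<in> carrier H" "x = V a" by metis
    then show "0 \<le> Re (hinner K x x)" "hinner K x x = 0 \<Longrightarrow> x = \<zero>\<^bsub>K\<^esub>"
      using H.hinner_nonneg[of a] H.hinner_eq_zero[of a] by (simp_all add: hin zero)
  qed
  show ?thesis
    by (rule hilbert_space.intro[OF mod], rule hilbert_space_axioms.intro,
        fact k1, fact k2, fact k3, fact k4, fact k5, fact k6)
qed

text \<open>On the carrier, \<rho>(g) is \<pi>(g) conjugated by V. Extensionality upgrades this to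
  equality of operators, which the homomorphism law into \<open>unitary_group\<close>
  demands.\<close>

lemma unitary_rep_transfer:
  assumes \<pi>: "unitary_rep G H \<pi>" and V: "unitary_between H K V" and K: "hilbert_space K"
    and ext: "\<And>g. g \<in> carrier G \<Longrightarrow> \<rho> g \<in> extensional (carrier K)"
    and eq: "\<And>g x. \<lbrakk>g \<in> carrier G; x \<in> carrier H\<rbrakk> \<Longrightarrow> \<rho> g (V x) = V (\<pi> g x)"
  shows "unitary_rep G K \<rho>"
proof -
  have G: "group G" and H: "hilbert_space H" and hom: "\<pi> \<in> hom G (unitary_group H)"
    using \<pi> by (auto simp: unitary_rep_def)
  interpret G: group G by fact
  interpret K: hilbert_space K by fact
  have \<pi>u: "unitary_between H H (\<pi> g)" if "g \<in> carrier G" for g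
    using hom that by (auto simp: hom_def unitary_group_def)
  let ?W = "inv_into (carrier H) V"
  have W: "?W y \<in> carrier H" "V (?W y) = y" if "y \<in> carrier K" for y
    using unitary_betweenD(1)[OF V] that by (auto simp: bij_betw_def inv_into_into f_inv_into_f)
  have \<rho>: "\<rho> g y = V (\<pi> g (?W y))" if "g \<in> carrier G" "y \<in> carrier K" for g y
    using eq[OF that(1) W(1)[OF that(2)]] W(2)[OF that(2)] by simp
  have \<rho>u: "unitary_between K K (\<rho> g)" if g: "g \<in> carrier G" for g
  proof -
    have "unitary_between K K (\<lambda>y. V (\<pi> g (?W y)))"
      by (rule unitary_between_comp[OF unitary_between_comp[OF unitary_between_inv[OF V H] \<pi>u[OF g]] V])
    then have "unitary_between K K (restrict (\<lambda>y. V (\<pi> g (?W y))) (carrier K))"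
      by (rule unitary_between_restrict[OF _ K])
    also have "restrict (\<lambda>y. V (\<pi> g (?W y))) (carrier K) = \<rho> g"
      using \<rho>[OF g] ext[OF g] by (auto simp: fun_eq_iff extensional_def)
    finally show ?thesis .
  qed
  show ?thesis
    unfolding unitary_rep_def
  proof (intro conjI G K homI)
    show "\<rho> g \<in> carrier (unitary_group K)" if "g \<in> carrier G" for g
      using \<rho>u ext that by (simp add: unitary_group_def)
    fix g h assume g: "g \<in> carrier G" and h: "h \<in> carrier G"
    have "\<rho> (g \<otimes>\<^bsub>G\<^esub> h) = compose (carrier K) (\<rho> g) (\<rho> h)"
    proof (rule extensionalityI[OF ext compose_extensional])
      fix y assume y: "y \<in> carrier K"
      have "\<pi> (g \<otimes>\<^bsub>G\<^esub> h) = compose (carrier H) (\<pi> g) (\<pi> h)"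
        using hom_mult[OF hom g h] by (simp add: unitary_group_def)
      then have "\<rho> (g \<otimes>\<^bsub>G\<^esub> h) y = V (\<pi> g (\<pi> h (?W y)))"
        using g h y W by (simp add: \<rho> compose_eq)
      also have "\<dots> = \<rho> g (V (\<pi> h (?W y)))"
        using eq[OF g unitary_betweenD(2)[OF \<pi>u[OF h] W(1)[OF y]]] by simp
      finally show "\<rho> (g \<otimes>\<^bsub>G\<^esub> h) y = compose (carrier K) (\<rho> g) (\<rho> h) y"
        using \<rho>[OF h y] y by (simp add: compose_eq)
    qed (use g h in simp)
    then show "\<rho> (g \<otimes>\<^bsub>G\<^esub> h) = \<rho> g \<otimes>\<^bsub>unitary_group K\<^esub> \<rho> h" by (simp add: unitary_group_def)
  qed
qed

lemma unitarily_equivalent_via: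
  assumes "unitary_rep G H \<pi>"
    and K: "unitary_rep G K \<rho>" and V: "unitary_between H K V"
    and eqV: "\<And>g x. \<lbrakk>g \<in> carrier G; x \<in> carrier H\<rbrakk> \<Longrightarrow> \<rho> g (V x) = V (\<pi> g x)"
    and L: "unitary_rep G L \<sigma>" and W: "unitary_between H L W"
    and eqW: "\<And>g x. \<lbrakk>g \<in> carrier G; x \<in> carrier H\<rbrakk> \<Longrightarrow> \<sigma> g (W x) = W (\<pi> g x)"
  shows "unitarily_equivalent G K \<rho> L \<sigma>"
  unfolding unitarily_equivalent_def
proof (intro conjI exI ballI K L)
  have \<pi>: "\<pi> g x \<in> carrier H" if "g \<in> carrier G" "x \<in> carrier H" for g x
    using assms(1) that unitary_betweenD(2)[of H H "\<pi> g" x] by (auto simp: unitary_rep_def hom_def unitary_group_def)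
  have H: "hilbert_space H" using assms(1) by (simp add: unitary_rep_def)
  let ?V' = "inv_into (carrier H) V"
  have V': "?V' y \<in> carrier H" "V (?V' y) = y" if "y \<in> carrier K" for y
    using unitary_betweenD(1)[OF V] that by (auto simp: bij_betw_def inv_into_into f_inv_into_f)
  have VV': "?V' (V x) = x" if "x \<in> carrier H" for x
    using unitary_betweenD(1)[OF V] that by (simp add: bij_betw_def)
  show "unitary_between K L (\<lambda>y. W (?V' y))"
    by (rule unitary_between_comp[OF unitary_between_inv[OF V H] W])
  fix g y assume g: "g \<in> carrier G" and y: "y \<in> carrier K"
  have "?V' (\<rho> g y) = \<pi> g (?V' y)"
    using eqV[OF g V'(1)[OF y]] V'(2)[OF y] VV'[OF \<pi>[OF g V'(1)[OF y]]] by simp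
  then show "W (?V' (\<rho> g y)) = \<sigma> g (W (?V' y))" using eqW[OF g V'(1)[OF y]] by simp
qed

text \<open>Fubini for the product of the index sets. \<open>inf_copies\<close> sums as a series
  over k and \<open>ell2\<close> without order: nonnegativity reconciles the two for norms,
  summability over the product for inner products.\<close>

theorem unitary_ell2_inf_copies:
  fixes C :: "'c set"
  shows "unitary_between (ell2 (UNIV \<times> C)) (inf_copies (ell2 C)) (\<lambda>f k c. f (k, c))"
proof -
  let ?V = "\<lambda>f k c. f (k::nat, c) :: complex"
  have sq: "(hnorm (ell2 C) g)\<^sup>2 = (\<Sum>\<^sub>\<infinity>c\<in>C. (cmod (g c))\<^sup>2)" if "g \<in> carrier (ell2 C)" for g
    using that by (simp add: ell2_hnorm infsum_nonneg)
  have V: "?V f \<in> carrier (inf_copies (ell2 C))" if f: "f \<in> carrier (ell2 (UNIV \<times> C))" for f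
  proof -
    have s: "(\<lambda>(k, c). (cmod (f (k, c)))\<^sup>2) summable_on UNIV \<times> C"
      using f by (simp add: ell2_iff case_prod_unfold)
    have sk: "(\<lambda>c. (cmod (f (k, c)))\<^sup>2) summable_on C" for k
      using summable_on_SigmaD1[OF s, of k] by simp
    then have fk: "?V f k \<in> carrier (ell2 C)" for k using f by (auto simp: ell2_iff)
    have "(\<lambda>k. \<Sum>\<^sub>\<infinity>c\<in>C. (cmod (f (k, c)))\<^sup>2) summable_on UNIV"
      using summable_on_Sigma_banach[OF s] by simp
    then have "summable (\<lambda>k. (hnorm (ell2 C) (?V f k))\<^sup>2)"
      unfolding sq[OF fk] by (subst summable_on_UNIV_nonneg_real_iff[symmetric]) (auto simp: infsum_nonneg)
    then show ?thesis using fk by (simp add: inf_copies_def)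
  qed
  have V': "(\<lambda>(k, c). g k c) \<in> carrier (ell2 (UNIV \<times> C))" if g: "g \<in> carrier (inf_copies (ell2 C))" for g
  proof -
    have gk: "g k \<in> carrier (ell2 C)" for k using g by (simp add: inf_copies_def)
    have "summable (\<lambda>k. \<Sum>\<^sub>\<infinity>c\<in>C. (cmod (g k c))\<^sup>2)" using g sq[OF gk] by (simp add: inf_copies_def)
    then have "(\<lambda>k. \<Sum>\<^sub>\<infinity>c\<in>C. (cmod (g k c))\<^sup>2) summable_on UNIV"
      by (subst summable_on_UNIV_nonneg_real_iff) (auto simp: infsum_nonneg)
    then have "(\<lambda>(k, c). (cmod (g k c))\<^sup>2) summable_on UNIV \<times> C"
      using gk by (intro summable_on_SigmaI[where g = "\<lambda>k. \<Sum>\<^sub>\<infinity>c\<in>C. (cmod (g k c))\<^sup>2"]) (auto simp: ell2_iff)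
    then show ?thesis using ell2_outside[OF gk] by (auto simp: ell2_iff case_prod_unfold)
  qed
  show ?thesis
    unfolding unitary_between_def
  proof (intro conjI ballI allI)
    show "bij_betw ?V (carrier (ell2 (UNIV \<times> C))) (carrier (inf_copies (ell2 C)))"
      by (rule bij_betwI[where g = "\<lambda>g (k, c). g k c"]) (use V V' in auto)
    fix f g :: "nat \<times> 'c \<Rightarrow> complex"
    assume f: "f \<in> carrier (ell2 (UNIV \<times> C))" and g: "g \<in> carrier (ell2 (UNIV \<times> C))"
    have s: "(\<lambda>(k, c). f (k, c) * cnj (g (k, c))) summable_on UNIV \<times> C"
      using ell2_hinner_summable[OF f g] by (simp add: case_prod_unfold)
    have "(\<lambda>k. \<Sum>\<^sub>\<infinity>c\<in>C. f (k, c) * cnj (g (k, c))) summable_on UNIV"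
      using summable_on_Sigma_banach[OF s] by simp
    then have "(\<Sum>k. \<Sum>\<^sub>\<infinity>c\<in>C. f (k, c) * cnj (g (k, c))) = (\<Sum>\<^sub>\<infinity>k. \<Sum>\<^sub>\<infinity>c\<in>C. f (k, c) * cnj (g (k, c)))"
      by (intro sums_unique[symmetric] has_sum_imp_sums) simp
    also have "\<dots> = (\<Sum>\<^sub>\<infinity>z\<in>UNIV \<times> C. f z * cnj (g z))"
      using infsum_Sigma'_banach[OF s] by (simp add: case_prod_unfold)
    finally show "hinner (inf_copies (ell2 C)) (?V f) (?V g) = hinner (ell2 (UNIV \<times> C)) f g"
      by (simp add: inf_copies_def ell2_simps)
  qed (auto simp: inf_copies_def)
qed

lemma hilbert_space_inf_copies_ell2: "hilbert_space (inf_copies (ell2 C))"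
  by (rule hilbert_space_transfer[OF hilbert_space_ell2 unitary_ell2_inf_copies]) (simp add: inf_copies_def)

section \<open>Tensor products\<close>

lemma hilbert_tensorD:
  assumes "hilbert_tensor H K T t"
  shows "hilbert_space T"
    and "\<And>a b. \<lbrakk>a \<in> carrier H; b \<in> carrier K\<rbrakk> \<Longrightarrow> t a b \<in> carrier T"
    and "\<And>a a' b. \<lbrakk>a \<in> carrier H; a' \<in> carrier H; b \<in> carrier K\<rbrakk> \<Longrightarrow> t (a \<oplus>\<^bsub>H\<^esub> a') b = t a b \<oplus>\<^bsub>T\<^esub> t a' b"
    and "\<And>a b b'. \<lbrakk>a \<in> carrier H; b \<in> carrier K; b' \<in> carrier K\<rbrakk> \<Longrightarrow> t a (b \<oplus>\<^bsub>K\<^esub> b') = t a b \<oplus>\<^bsub>T\<^esub> t a b'"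
    and "\<And>c a b. \<lbrakk>a \<in> carrier H; b \<in> carrier K\<rbrakk> \<Longrightarrow> t (c \<odot>\<^bsub>H\<^esub> a) b = c \<odot>\<^bsub>T\<^esub> t a b"
    and "\<And>c a b. \<lbrakk>a \<in> carrier H; b \<in> carrier K\<rbrakk> \<Longrightarrow> t a (c \<odot>\<^bsub>K\<^esub> b) = c \<odot>\<^bsub>T\<^esub> t a b"
    and "\<And>a a' b b'. \<lbrakk>a \<in> carrier H; a' \<in> carrier H; b \<in> carrier K; b' \<in> carrier K\<rbrakk>
        \<Longrightarrow> hinner T (t a b) (t a' b') = hinner H a a' * hinner K b b'"
    and "Metric_space.mtopology (carrier T) (hdist T) closure_of
       {finsum T (\<lambda>i. t (a i) (b i)) {..<k} | (k::nat) a b.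
          a \<in> {..<k} \<rightarrow> carrier H \<and> b \<in> {..<k} \<rightarrow> carrier K}
       = carrier T"
  using assms unfolding hilbert_tensor_def by simp_all

text \<open>For d in the dense span, orthogonality turns the squared norm of z into the inner
  product of z - d with z, so the norm of z is at most that of z - d.\<close>

lemma hilbert_tensor_total:
  assumes T: "hilbert_tensor H K T t" and z: "z \<in> carrier T"
    and orth: "\<And>a b. \<lbrakk>a \<in> carrier H; b \<in> carrier K\<rbrakk> \<Longrightarrow> hinner T z (t a b) = 0"
  shows "z = \<zero>\<^bsub>T\<^esub>"
proof -
  interpret T: hilbert_space T by (rule hilbert_tensorD(1)[OF T])
  interpret MT: Metric_space "carrier T" "hdist T" by (rule T.Metric_space_hdist)
  have small: "hnorm T z < r" if "r > 0" for r
  proof -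
    have "z \<in> MT.mtopology closure_of
       {finsum T (\<lambda>i. t (a i) (b i)) {..<k} | (k::nat) a b.
          a \<in> {..<k} \<rightarrow> carrier H \<and> b \<in> {..<k} \<rightarrow> carrier K}"
      unfolding hilbert_tensorD(8)[OF T] by (rule z)
    then obtain k :: nat and a b where ab: "a \<in> {..<k} \<rightarrow> carrier H" "b \<in> {..<k} \<rightarrow> carrier K"
      and ball: "finsum T (\<lambda>i. t (a i) (b i)) {..<k} \<in> MT.mball z r"
      using \<open>r > 0\<close> unfolding MT.metric_closure_of by blast
    define d where "d = finsum T (\<lambda>i. t (a i) (b i)) {..<k}"
    have tab: "t (a i) (b i) \<in> carrier T" if "i \<in> {..<k}" for i
      using ab that by (intro hilbert_tensorD(2)[OF T]) auto
    then have d: "d \<in> carrier T" unfolding d_def by (intro T.M.finsum_closed) auto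
    have "hinner T d z = (\<Sum>i<k. hinner T (t (a i) (b i)) z)"
      unfolding d_def by (rule T.hinner_finsum_left[OF _ tab z]) auto
    also have "\<dots> = 0"
    proof (rule sum.neutral, rule ballI)
      fix i assume i: "i \<in> {..<k}"
      have "hinner T z (t (a i) (b i)) = 0" using ab i by (intro orth) auto
      then show "hinner T (t (a i) (b i)) z = 0" using T.hinner_commute[OF z tab[OF i]] by simp
    qed
    finally have "hinner T z z = hinner T (z \<ominus>\<^bsub>T\<^esub> d) z" using z d by (simp add: T.hinner_minus_left)
    then have "(hnorm T z)\<^sup>2 \<le> hnorm T (z \<ominus>\<^bsub>T\<^esub> d) * hnorm T z"
      using T.Cauchy_Schwarz[of "z \<ominus>\<^bsub>T\<^esub> d" z] z d complex_Re_le_cmod[of "hinner T z z"]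
      by (simp add: T.hnorm_sq)
    moreover have "hnorm T (z \<ominus>\<^bsub>T\<^esub> d) < r" using ball z d by (simp add: d_def[symmetric] hdist_def)
    ultimately show ?thesis
      using T.hnorm_nonneg[OF z] \<open>r > 0\<close>
      by (cases "hnorm T z = 0") (auto simp: power2_eq_square mult_le_cancel_right)
  qed
  \<comment> \<open>\<open>small\<close> with r equal to the norm itself is absurd unless the norm
    is 0.\<close>
  have "hnorm T z = 0"
    using small[of "hnorm T z"] T.hnorm_nonneg[OF z] by (cases "hnorm T z = 0") auto
  then show ?thesis using T.hnorm_eq_zero_iff[OF z] by simp
qed

lemma hilbert_tensor_norm:
  assumes T: "hilbert_tensor H K T t" and "hilbert_space H" "hilbert_space K"
    and a: "a \<in> carrier H" and b: "b \<in> carrier K"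
  shows "hnorm T (t a b) = hnorm H a * hnorm K b"
proof -
  interpret H: hilbert_space H by fact
  interpret K: hilbert_space K by fact
  have "hinner T (t a b) (t a b) = complex_of_real ((hnorm H a * hnorm K b)\<^sup>2)"
    using hilbert_tensorD(7)[OF T a a b b] a b by (simp add: H.hinner_self K.hinner_self power_mult_distrib)
  then show ?thesis using a b by (simp add: hnorm_def[of T])
qed

context
  fixes X :: "'a set" and Y :: "'b set" and T :: "('t, 'z) hilbert_scheme" and t
  assumes T: "hilbert_tensor (ell2 X) (ell2 Y) T t"
begin

interpretation T: hilbert_space T by (rule hilbert_tensorD(1)[OF T])

text \<open>Elementary tensors are bounded and additive in each argument, so vanishing on point
  masses extends first in a and then in b.\<close>

lemma tensor_total_basis:
  assumes z: "z \<in> carrier T" and orth: "\<And>x y. \<lbrakk>x \<in> X; y \<in> Y\<rbrakk> \<Longrightarrow> hinner T z (t (single 1 x) (single 1 y)) = 0"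
  shows "z = \<zero>\<^bsub>T\<^esub>"
proof (rule hilbert_tensor_total[OF T z])
  note tcl = hilbert_tensorD(2)[OF T]
  fix a b assume a: "a \<in> carrier (ell2 X)" and b: "b \<in> carrier (ell2 Y)"
  have bd: "cmod (hinner T z (t a b)) \<le> hnorm T z * (hnorm (ell2 X) a * hnorm (ell2 Y) b)"
    if "a \<in> carrier (ell2 X)" "b \<in> carrier (ell2 Y)" for a b
    using T.Cauchy_Schwarz[OF z tcl[OF that]] hilbert_tensor_norm[OF T hilbert_space_ell2 hilbert_space_ell2 that] by simp
  have step: "hinner T z (t a (single c y)) = 0" if y: "y \<in> Y" for c y
  proof (rule ell2_functional_eq_0[where X = X and l = "\<lambda>a. hinner T z (t a (single c y))"
        and C = "hnorm T z * hnorm (ell2 Y) (single c y)", OF _ _ _ a])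
    fix f g assume f: "f \<in> carrier (ell2 X)" and g: "g \<in> carrier (ell2 X)"
    show "hinner T z (t (\<lambda>x. f x + g x) (single c y)) = hinner T z (t f (single c y)) + hinner T z (t g (single c y))"
      using hilbert_tensorD(3)[OF T f g single_in_ell2[OF y, of c]] z f g y tcl by (simp add: T.hinner_add_right)
    show "cmod (hinner T z (t f (single c y))) \<le> hnorm T z * hnorm (ell2 Y) (single c y) * hnorm (ell2 X) f"
      using bd[OF f single_in_ell2[OF y, of c]] by (simp add: mult_ac)
  next
    fix x d assume x: "x \<in> X"
    have "t (single d x) (single c y) = d \<odot>\<^bsub>T\<^esub> (c \<odot>\<^bsub>T\<^esub> t (single 1 x) (single 1 y))"
      using hilbert_tensorD(5)[OF T single_in_ell2[OF x, of 1] single_in_ell2[OF y, of c], of d]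
        hilbert_tensorD(6)[OF T single_in_ell2[OF x, of 1] single_in_ell2[OF y, of 1], of c]
      by (simp flip: single_smult)
    then show "hinner T z (t (single d x) (single c y)) = 0"
      using orth[OF x y] z x y tcl by (simp add: T.hinner_smult_right)
  qed
  show "hinner T z (t a b) = 0"
  proof (rule ell2_functional_eq_0[where X = Y and l = "\<lambda>b. hinner T z (t a b)"
        and C = "hnorm T z * hnorm (ell2 X) a", OF _ _ _ b])
    fix f g assume f: "f \<in> carrier (ell2 Y)" and g: "g \<in> carrier (ell2 Y)"
    show "hinner T z (t a (\<lambda>x. f x + g x)) = hinner T z (t a f) + hinner T z (t a g)"
      using hilbert_tensorD(4)[OF T a f g] z f g a tcl by (simp add: T.hinner_add_right)
    show "cmod (hinner T z (t a f)) \<le> hnorm T z * hnorm (ell2 X) a * hnorm (ell2 Y) f"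
      using bd[OF a f] by (simp add: mult_ac)
  qed (rule step)
qed

text \<open>The tensors of point masses form an orthonormal basis of T; V takes coefficients with
  respect to it.\<close>

theorem tensor_unitary:
  obtains V where "unitary_between T (ell2 (X \<times> Y)) V"
    "\<And>a b. \<lbrakk>a \<in> carrier (ell2 X); b \<in> carrier (ell2 Y)\<rbrakk> \<Longrightarrow> V (t a b) = (\<lambda>(x, y). a x * b y)"
proof
  let ?e = "\<lambda>(x, y). t (single 1 x) (single 1 y)"
  let ?V = "\<lambda>z i. if i \<in> X \<times> Y then hinner T z (?e i) else 0"
  show "unitary_between T (ell2 (X \<times> Y)) ?V"
  proof (rule T.orthonormal_basis_unitary)
    show "?e i \<in> carrier T" if "i \<in> X \<times> Y" for i
      using that by (auto intro!: hilbert_tensorD(2)[OF T])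
    show "hinner T (?e i) (?e j) = (if i = j then 1 else 0)" if "i \<in> X \<times> Y" "j \<in> X \<times> Y" for i j
      using that by (auto simp: hilbert_tensorD(7)[OF T] hinner_single_right) (auto simp: single_def split: if_splits)
    show "z = \<zero>\<^bsub>T\<^esub>" if "z \<in> carrier T" "\<And>i. i \<in> X \<times> Y \<Longrightarrow> hinner T z (?e i) = 0" for z
    proof (rule tensor_total_basis[OF that(1)])
      fix x y assume "x \<in> X" "y \<in> Y"
      then show "hinner T z (t (single 1 x) (single 1 y)) = 0" using that(2)[of "(x, y)"] by simp
    qed
  qed
  show "?V (t a b) = (\<lambda>(x, y). a x * b y)" if a: "a \<in> carrier (ell2 X)" and b: "b \<in> carrier (ell2 Y)" for a b
    using a b ell2_outside[OF a] ell2_outside[OF b]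
    by (auto simp: fun_eq_iff hilbert_tensorD(7)[OF T] hinner_single_right)
qed

text \<open>Discharges the definite description in \<open>tensor_op\<close>. Two bounded operators
  that agree on elementary tensors agree on the preimages of point masses under the unitary onto
  \<open>ell2 (X \<times> Y)\<close>, and by boundedness everywhere.\<close>

lemma tensor_op_eqI:
  assumes C: "C \<in> bounded_ops T"
    and eq: "\<And>a b. \<lbrakk>a \<in> carrier (ell2 X); b \<in> carrier (ell2 Y)\<rbrakk> \<Longrightarrow> C (t a b) = t (A a) (B b)"
  shows "tensor_op (ell2 X) (ell2 Y) T t A B = C"
  unfolding tensor_op_def
proof (rule the_equality)
  show "C \<in> bounded_ops T \<and> (\<forall>a\<in>carrier (ell2 X). \<forall>b\<in>carrier (ell2 Y). C (t a b) = t (A a) (B b))"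
    using C eq by blast
  fix D assume "D \<in> bounded_ops T \<and> (\<forall>a\<in>carrier (ell2 X). \<forall>b\<in>carrier (ell2 Y). D (t a b) = t (A a) (B b))"
  then have D: "D \<in> bounded_ops T"
    and DC: "\<And>a b. \<lbrakk>a \<in> carrier (ell2 X); b \<in> carrier (ell2 Y)\<rbrakk> \<Longrightarrow> D (t a b) = C (t a b)"
    using eq by auto
  obtain V where V: "unitary_between T (ell2 (X \<times> Y)) V"
    and Vt: "\<And>a b. \<lbrakk>a \<in> carrier (ell2 X); b \<in> carrier (ell2 Y)\<rbrakk> \<Longrightarrow> V (t a b) = (\<lambda>(x, y). a x * b y)"
    using tensor_unitary by blast
  define W where "W = inv_into (carrier T) V"
  have W: "unitary_between (ell2 (X \<times> Y)) T W"
    unfolding W_def by (rule unitary_between_inv[OF V]) unfold_locales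
  have WV: "W (V x) = x" if "x \<in> carrier T" for x
    using unitary_betweenD(1)[OF V] that by (simp add: W_def bij_betw_def)
  note Wcl = unitary_betweenD(2)[OF W]
  have W_single: "W (single c (x, y)) = t (single c x) (single 1 y)" if x: "x \<in> X" and y: "y \<in> Y" for c x y
  proof -
    have "V (t (single c x) (single 1 y)) = (\<lambda>(u, v). single c x u * single 1 y v)"
      using x y by (intro Vt) auto
    also have "\<dots> = single c (x, y)" by (auto simp: single_def fun_eq_iff)
    finally have "single c (x, y) = V (t (single c x) (single 1 y))" ..
    then show ?thesis using x y by (simp add: WV hilbert_tensorD(2)[OF T])
  qed
  have bdd: "\<exists>k. \<forall>f\<in>carrier (ell2 (X \<times> Y)). cmod (hinner T (E (W f)) z) \<le> k * hnorm (ell2 (X \<times> Y)) f"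
    if E: "E \<in> bounded_ops T" and z: "z \<in> carrier T" for E z
  proof -
    obtain k where k: "\<And>x. x \<in> carrier T \<Longrightarrow> hnorm T (E x) \<le> k * hnorm T x"
      using T.bounded_ops_bound[OF E] by blast
    have "cmod (hinner T (E (W f)) z) \<le> (k * hnorm T z) * hnorm (ell2 (X \<times> Y)) f"
      if f: "f \<in> carrier (ell2 (X \<times> Y))" for f
      using T.Cauchy_Schwarz[OF bounded_opsD(2)[OF E Wcl[OF f]] z]
        mult_right_mono[OF k[OF Wcl[OF f]] T.hnorm_nonneg[OF z]] unitary_betweenD(6)[OF W f]
      by (simp add: mult_ac)
    then show ?thesis by blast
  qed
  have lin: "hinner T (E (W (\<lambda>i. f i + g i))) z = hinner T (E (W f)) z + hinner T (E (W g)) z"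
    if E: "E \<in> bounded_ops T" and z: "z \<in> carrier T"
      and f: "f \<in> carrier (ell2 (X \<times> Y))" and g: "g \<in> carrier (ell2 (X \<times> Y))" for E z f g
    using unitary_betweenD(3)[OF W f g] bounded_opsD(2)[OF E] bounded_opsD(3)[OF E Wcl[OF f] Wcl[OF g]] Wcl f g z
    by (simp add: T.hinner_add_left)
  have DW: "D (W u) = C (W u)" if u: "u \<in> carrier (ell2 (X \<times> Y))" for u
  proof (rule T.hinner_ext)
    fix z assume z: "z \<in> carrier T"
    obtain k k' where k: "\<And>f. f \<in> carrier (ell2 (X \<times> Y)) \<Longrightarrow> cmod (hinner T (D (W f)) z) \<le> k * hnorm (ell2 (X \<times> Y)) f"
      "\<And>f. f \<in> carrier (ell2 (X \<times> Y)) \<Longrightarrow> cmod (hinner T (C (W f)) z) \<le> k' * hnorm (ell2 (X \<times> Y)) f"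
      using bdd[OF D z] bdd[OF C z] by blast
    show "hinner T (D (W u)) z = hinner T (C (W u)) z"
    proof (rule ell2_functional_ext[where X = "X \<times> Y" and l = "\<lambda>f. hinner T (D (W f)) z"
          and l' = "\<lambda>f. hinner T (C (W f)) z", OF lin[OF D z] lin[OF C z] k _ u])
      fix i c assume "i \<in> X \<times> Y"
      then obtain x y where "i = (x, y)" "x \<in> X" "y \<in> Y" by blast
      then show "hinner T (D (W (single c i))) z = hinner T (C (W (single c i))) z"
        using DC[of "single c x" "single 1 y"] by (simp add: W_single)
    qed
  qed (use u Wcl bounded_opsD(2)[OF C] bounded_opsD(2)[OF D] in auto)
  show "D = C"
  proof (rule extensionalityI[OF bounded_opsD(1)[OF D] bounded_opsD(1)[OF C]])
    fix x assume "x \<in> carrier T"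
    then show "D x = C x" using DW[of "V x"] WV unitary_betweenD(2)[OF V] by simp
  qed
qed

end

lemma regular_tensor:
  assumes "group G" "group K" "g \<in> carrier G" "h \<in> carrier K"
    and a: "a \<in> carrier (ell2 (carrier G))" and b: "b \<in> carrier (ell2 (carrier K))"
  shows "regular_rep (G \<times>\<times> K) (g, h) (\<lambda>(x, y). a x * b y)
    = (\<lambda>(x, y). regular_rep G g a x * regular_rep K h b y)"
  using assms ell2_tensor_in[OF a b] by (auto simp: regular_rep_def fun_eq_iff)

text \<open>The operator on T is the translation of the product group carried over by W; it
  satisfies the characterization of \<open>tensor_op\<close> because translations act on product
  functions factorwise.\<close>

theorem tensor_regular_rep:
  assumes G: "group G" and K: "group K"
    and T: "hilbert_tensor (ell2 (carrier G)) (ell2 (carrier K)) T t"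
  obtains W where "unitary_between (ell2 (carrier (G \<times>\<times> K))) T W"
    "\<And>g h. \<lbrakk>g \<in> carrier G; h \<in> carrier K\<rbrakk> \<Longrightarrow>
       tensor_op (ell2 (carrier G)) (ell2 (carrier K)) T t (regular_rep G g) (regular_rep K h) \<in> extensional (carrier T)"
    "\<And>g h f. \<lbrakk>g \<in> carrier G; h \<in> carrier K; f \<in> carrier (ell2 (carrier (G \<times>\<times> K)))\<rbrakk> \<Longrightarrow>
       tensor_op (ell2 (carrier G)) (ell2 (carrier K)) T t (regular_rep G g) (regular_rep K h) (W f)
       = W (regular_rep (G \<times>\<times> K) (g, h) f)"
proof -
  let ?P = "G \<times>\<times> K"
  interpret G: group G by fact
  interpret K: group K by fact
  interpret P: group ?P by (rule DirProd_group[OF G K])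
  interpret T: hilbert_space T by (rule hilbert_tensorD(1)[OF T])
  have hT: "hilbert_space T" by unfold_locales
  obtain V where V: "unitary_between T (ell2 (carrier ?P)) V"
    and Vt: "\<And>a b. \<lbrakk>a \<in> carrier (ell2 (carrier G)); b \<in> carrier (ell2 (carrier K))\<rbrakk> \<Longrightarrow> V (t a b) = (\<lambda>(x, y). a x * b y)"
    using tensor_unitary[OF T] by auto
  define W where "W = inv_into (carrier T) V"
  have W: "unitary_between (ell2 (carrier ?P)) T W"
    unfolding W_def by (rule unitary_between_inv[OF V hT])
  have WV: "W (V x) = x" if "x \<in> carrier T" for x
    using unitary_betweenD(1)[OF V] that by (simp add: W_def bij_betw_def)
  have VW: "V (W f) = f" if "f \<in> carrier (ell2 (carrier ?P))" for f
    using unitary_betweenD(1)[OF V] that by (simp add: W_def bij_betw_def f_inv_into_f)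
  note Wcl = unitary_betweenD(2)[OF W] and Vcl = unitary_betweenD(2)[OF V]
  define C where "C g h = restrict (\<lambda>x. W (regular_rep ?P (g, h) (V x))) (carrier T)" for g h
  have op: "tensor_op (ell2 (carrier G)) (ell2 (carrier K)) T t (regular_rep G g) (regular_rep K h) = C g h"
    if g: "g \<in> carrier G" and h: "h \<in> carrier K" for g h
  proof (rule tensor_op_eqI[OF T])
    have "(g, h) \<in> carrier ?P" using g h by simp
    then have "unitary_between T T (\<lambda>x. W (regular_rep ?P (g, h) (V x)))"
      by (intro unitary_between_comp[OF unitary_between_comp[OF V] W] P.unitary_regular)
    then show "C g h \<in> bounded_ops T"
      unfolding C_def by (intro unitary_bounded_ops unitary_between_restrict hT) auto
    fix a b assume a: "a \<in> carrier (ell2 (carrier G))" and b: "b \<in> carrier (ell2 (carrier K))"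
    have a': "regular_rep G g a \<in> carrier (ell2 (carrier G))" and b': "regular_rep K h b \<in> carrier (ell2 (carrier K))"
      using unitary_betweenD(2)[OF G.unitary_regular[OF g] a] unitary_betweenD(2)[OF K.unitary_regular[OF h] b] by auto
    have "C g h (t a b) = W (regular_rep ?P (g, h) (\<lambda>(x, y). a x * b y))"
      using hilbert_tensorD(2)[OF T a b] by (simp add: C_def Vt[OF a b])
    also have "\<dots> = W (V (t (regular_rep G g a) (regular_rep K h b)))"
      unfolding regular_tensor[OF G K g h a b] Vt[OF a' b'] ..
    also have "\<dots> = t (regular_rep G g a) (regular_rep K h b)"
      by (rule WV[OF hilbert_tensorD(2)[OF T a' b']])
    finally show "C g h (t a b) = t (regular_rep G g a) (regular_rep K h b)" .
  qed
  show ?thesis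
  proof (rule that[OF W])
    fix g h assume gh: "g \<in> carrier G" "h \<in> carrier K"
    show "tensor_op (ell2 (carrier G)) (ell2 (carrier K)) T t (regular_rep G g) (regular_rep K h) \<in> extensional (carrier T)"
      unfolding op[OF gh] by (simp add: C_def)
    fix f assume f: "f \<in> carrier (ell2 (carrier ?P))"
    show "tensor_op (ell2 (carrier G)) (ell2 (carrier K)) T t (regular_rep G g) (regular_rep K h) (W f)
       = W (regular_rep ?P (g, h) f)"
      unfolding op[OF gh] using VW[OF f] Wcl[OF f] by (simp add: C_def)
  qed
qed

section \<open>Decomposition of the tensor product\<close>

lemma free_gen_index:
  fixes n m k :: nat
  assumes k: "k \<in> {1..n * m}"
  obtains i j where "i \<in> {1..n}" "j \<in> {1..m}" "k = m * (i - 1) + j"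
proof
  have "m > 0" using k by (cases m) auto
  have "(k - 1) div m < n" using k by (intro less_mult_imp_div_less) auto
  then show "(k - 1) div m + 1 \<in> {1..n}" by simp
  show "(k - 1) mod m + 1 \<in> {1..m}" using mod_less_divisor[OF \<open>m > 0\<close>, of "k - 1"] by simp
  show "k = m * ((k - 1) div m + 1 - 1) + ((k - 1) mod m + 1)"
    using k mult_div_mod_eq[of m "k - 1"] by simp
qed

lemma exponent_sum:
  obtains d where "d \<in> hom (free_group n) integer_group" "\<And>i. i \<in> {1..n} \<Longrightarrow> d (free_gen i) = 1"
  using free_group_universal[OF group_integer_group, of n "\<lambda>_. 1"] by auto

text \<open>Each component of \<phi> sends every generator to a generator, so both composites with
  the exponent sums send all generators to 1. The uniqueness part of the universal property
  identifies them.\<close>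

lemma phi_exponent_sums:
  assumes \<phi>: "\<phi> \<in> hom (free_group (n * m)) (free_group n \<times>\<times> free_group m)"
    and gen: "\<And>i j. i \<in> {1..n} \<Longrightarrow> j \<in> {1..m}
           \<Longrightarrow> \<phi> (free_gen (m * (i - 1) + j)) = (free_gen i, free_gen j)"
    and d: "d \<in> hom (free_group n) integer_group" "\<And>i. i \<in> {1..n} \<Longrightarrow> d (free_gen i) = 1"
    and d': "d' \<in> hom (free_group m) integer_group" "\<And>i. i \<in> {1..m} \<Longrightarrow> d' (free_gen i) = 1"
    and w: "w \<in> carrier (free_group (n * m))"
  shows "d (fst (\<phi> w)) = d' (snd (\<phi> w))"
proof -
  obtain h where h: "\<forall>h' \<in> hom (free_group (n * m)) integer_group. (\<forall>i\<in>{1..n * m}. h' (free_gen i) = 1)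
      \<longrightarrow> (\<forall>w\<in>carrier (free_group (n * m)). h' w = h w)"
    using free_group_universal[OF group_integer_group, of "n * m" "\<lambda>_. 1"] by auto
  have uniq: "h' w = h w" if "h' \<in> hom (free_group (n * m)) integer_group"
      "\<forall>i\<in>{1..n * m}. h' (free_gen i) = 1" "w \<in> carrier (free_group (n * m))" for h' w
    using h that by blast
  have \<phi>12: "fst \<circ> \<phi> \<in> hom (free_group (n * m)) (free_group n)" "snd \<circ> \<phi> \<in> hom (free_group (n * m)) (free_group m)"
    using \<phi> by (auto simp: hom_pairwise)
  have "d (fst (\<phi> w)) = h w"
  proof (rule uniq[OF _ _ w])
    show "(\<lambda>w. d (fst (\<phi> w))) \<in> hom (free_group (n * m)) integer_group"
      using Group.hom_compose[OF \<phi>12(1) d(1)] by (simp add: comp_def)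
    show "\<forall>i\<in>{1..n * m}. d (fst (\<phi> (free_gen i))) = 1"
    proof
      fix k assume "k \<in> {1..n * m}"
      then obtain i j where "i \<in> {1..n}" "j \<in> {1..m}" "k = m * (i - 1) + j" by (rule free_gen_index)
      then show "d (fst (\<phi> (free_gen k))) = 1" using gen[of i j] d(2)[of i] by simp
    qed
  qed
  moreover have "d' (snd (\<phi> w)) = h w"
  proof (rule uniq[OF _ _ w])
    show "(\<lambda>w. d' (snd (\<phi> w))) \<in> hom (free_group (n * m)) integer_group"
      using Group.hom_compose[OF \<phi>12(2) d'(1)] by (simp add: comp_def)
    show "\<forall>i\<in>{1..n * m}. d' (snd (\<phi> (free_gen i))) = 1"
    proof
      fix k assume "k \<in> {1..n * m}"
      then obtain i j where "i \<in> {1..n}" "j \<in> {1..m}" "k = m * (i - 1) + j" by (rule free_gen_index)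
      then show "d' (snd (\<phi> (free_gen k))) = 1" using gen[of i j] d'(2)[of j] by simp
    qed
  qed
  ultimately show ?thesis by simp
qed

text \<open>The difference of the two exponent sums vanishes on the image but is k at the pair of
  the k-th power of a generator with \<one>, so these pairs lie in distinct cosets. The argument
  includes n = m = 1.\<close>

lemma phi_infinite_index:
  assumes n: "n \<ge> 1"
    and \<phi>: "\<phi> \<in> hom (free_group (n * m)) (free_group n \<times>\<times> free_group m)"
    and gen: "\<And>i j. i \<in> {1..n} \<Longrightarrow> j \<in> {1..m}
           \<Longrightarrow> \<phi> (free_gen (m * (i - 1) + j)) = (free_gen i, free_gen j)"
  shows "infinite (rcosets\<^bsub>free_group n \<times>\<times> free_group m\<^esub> (\<phi> ` carrier (free_group (n * m))))"
proof -
  define F where "F = free_group (n * m)"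
  define Fn where "Fn = free_group n"
  define Fm where "Fm = free_group m"
  interpret F: group F unfolding F_def by (rule group_free_group)
  interpret Fn: group Fn unfolding Fn_def by (rule group_free_group)
  interpret Fm: group Fm unfolding Fm_def by (rule group_free_group)
  define P where "P = Fn \<times>\<times> Fm"
  have gP: "group P" unfolding P_def by (intro DirProd_group Fn.is_group Fm.is_group)
  interpret P: group P by (rule gP)
  interpret group_hom F P \<phi>
    using \<phi> F.is_group gP by (simp add: group_hom_def group_hom_axioms_def F_def P_def Fn_def Fm_def)
  obtain d where d: "d \<in> hom Fn integer_group" "\<And>i. i \<in> {1..n} \<Longrightarrow> d (free_gen i) = 1"
    unfolding Fn_def by (rule exponent_sum) blast
  obtain d' where d': "d' \<in> hom Fm integer_group" "\<And>i. i \<in> {1..m} \<Longrightarrow> d' (free_gen i) = 1"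
    unfolding Fm_def by (rule exponent_sum) blast
  interpret d: group_hom Fn integer_group d
    using d by (simp add: group_hom_def group_hom_axioms_def Fn.is_group)
  interpret d': group_hom Fm integer_group d'
    using d' by (simp add: group_hom_def group_hom_axioms_def Fm.is_group)
  define a where "a = free_gen 1"
  have a: "a \<in> carrier Fn" using n by (simp add: a_def Fn_def free_gen_carrier)
  have da: "d (a [^]\<^bsub>Fn\<^esub> k) = int k" for k :: nat
    using d.hom_nat_pow[OF a, of k] d(2)[of 1] n by (simp add: a_def)
  define x where "x k = (a [^]\<^bsub>Fn\<^esub> (k::nat), \<one>\<^bsub>Fm\<^esub>)" for k
  have x: "x k \<in> carrier P" for k using a by (simp add: x_def P_def)
  have sub: "subgroup (\<phi> ` carrier F) P" by (rule img_is_subgroup)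
  have "inj (\<lambda>k. \<phi> ` carrier F #>\<^bsub>P\<^esub> x k)"
  proof (rule injI)
    fix k l assume "\<phi> ` carrier F #>\<^bsub>P\<^esub> x k = \<phi> ` carrier F #>\<^bsub>P\<^esub> x l"
    then have "x k \<in> \<phi> ` carrier F #>\<^bsub>P\<^esub> x l" using P.rcos_self[OF x sub] by blast
    then obtain w where w: "w \<in> carrier F" and e: "x k = \<phi> w \<otimes>\<^bsub>P\<^esub> x l" by (auto simp: r_coset_def)
    obtain u v where uv: "\<phi> w = (u, v)" by fastforce
    have "\<phi> w \<in> carrier P" using w by simp
    then have u: "u \<in> carrier Fn" and v: "v \<in> carrier Fm" by (auto simp: uv P_def)
    have "a [^]\<^bsub>Fn\<^esub> k = u \<otimes>\<^bsub>Fn\<^esub> a [^]\<^bsub>Fn\<^esub> l" and v1: "v = \<one>\<^bsub>Fm\<^esub>"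
      using e v by (auto simp: x_def uv P_def)
    then have "int k = d u + int l" using d.hom_mult[OF u, of "a [^]\<^bsub>Fn\<^esub> l"] a by (simp add: da flip: da)
    moreover have "d u = d' v"
      using phi_exponent_sums[OF \<phi> gen d[unfolded Fn_def] d'[unfolded Fm_def], of w] w by (simp add: uv F_def)
    ultimately show "k = l" using v1 by simp
  qed
  then have "infinite (range (\<lambda>k. \<phi> ` carrier F #>\<^bsub>P\<^esub> x k))" by (rule range_inj_infinite)
  moreover have "range (\<lambda>k. \<phi> ` carrier F #>\<^bsub>P\<^esub> x k) \<subseteq> rcosets\<^bsub>P\<^esub> (\<phi> ` carrier F)"
    using x by (auto simp: RCOSETS_def)
  ultimately have "infinite (rcosets\<^bsub>P\<^esub> (\<phi> ` carrier F))" using finite_subset by blast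
  then show ?thesis by (simp add: P_def F_def Fn_def Fm_def)
qed

text \<open>Right cosets are the orbits of left translation by the image. The factor
  \<open>r k\<close> selects the orbit, and \<psi> C runs through the image exactly once, so the
  product determines k and then C.\<close>

lemma (in group_hom) orbit_bijection:
  assumes inf: "infinite (rcosets\<^bsub>H\<^esub> (h ` carrier G))" and cnt: "countable (carrier H)"
    and \<psi>: "\<And>x. x \<in> carrier G \<Longrightarrow> \<psi> (kernel G H h #> x) = h x" "inj_on \<psi> (carrier (G Mod kernel G H h))"
  obtains r :: "nat \<Rightarrow> 'c" where "\<And>k. r k \<in> carrier H"
    "bij_betw (\<lambda>(k, C). \<psi> C \<otimes>\<^bsub>H\<^esub> r k) (UNIV \<times> carrier (G Mod kernel G H h)) (carrier H)"
proof -
  let ?Q = "rcosets\<^bsub>H\<^esub> (h ` carrier G)" and ?N = "kernel G H h"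
  have sub: "subgroup (h ` carrier G) H" by (rule img_is_subgroup)
  have Q: "?Q = (\<lambda>x. h ` carrier G #>\<^bsub>H\<^esub> x) ` carrier H" by (auto simp: RCOSETS_def)
  then have "countable ?Q" using cnt by simp
  then obtain q :: "nat \<Rightarrow> 'c set" where q: "bij_betw q UNIV ?Q"
    using bij_betw_from_nat_into inf by blast
  have "\<exists>x. x \<in> carrier H \<and> q k = h ` carrier G #>\<^bsub>H\<^esub> x" for k
  proof -
    have "q k \<in> ?Q" using bij_betwE[OF q] by blast
    then show ?thesis unfolding Q by blast
  qed
  then obtain r where r: "\<And>k. r k \<in> carrier H" "\<And>k. q k = h ` carrier G #>\<^bsub>H\<^esub> r k" by metis
  have \<psi>h: "\<psi> C \<in> h ` carrier G" if "C \<in> carrier (G Mod ?N)" for C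
    using that \<psi>(1) by (auto simp: carrier_FactGroup)
  have hH: "h ` carrier G \<subseteq> carrier H" by auto
  have "bij_betw (\<lambda>(k, C). \<psi> C \<otimes>\<^bsub>H\<^esub> r k) (UNIV \<times> carrier (G Mod ?N)) (carrier H)"
    unfolding bij_betw_def
  proof (intro conjI equalityI subsetI)
    show "inj_on (\<lambda>(k, C). \<psi> C \<otimes>\<^bsub>H\<^esub> r k) (UNIV \<times> carrier (G Mod ?N))"
    proof (rule inj_onI, clarify)
      fix k C k' C' assume C: "C \<in> carrier (G Mod ?N)" and C': "C' \<in> carrier (G Mod ?N)"
        and e: "\<psi> C \<otimes>\<^bsub>H\<^esub> r k = \<psi> C' \<otimes>\<^bsub>H\<^esub> r k'"
      have "q j = h ` carrier G #>\<^bsub>H\<^esub> (\<psi> D \<otimes>\<^bsub>H\<^esub> r j)" if "D \<in> carrier (G Mod ?N)" for j D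
        unfolding r(2) using \<psi>h[OF that] r(1) sub
        by (intro H.repr_independence) (auto simp: r_coset_def)
      then have "q k = q k'" using C C' e by metis
      then have "k = k'" using q by (auto simp: bij_betw_def dest: injD)
      moreover have "\<psi> C = \<psi> C'"
        using e r(1)[of k'] subsetD[OF hH \<psi>h[OF C]] subsetD[OF hH \<psi>h[OF C']] \<open>k = k'\<close> by simp
      ultimately show "k = k' \<and> C = C'" using inj_onD[OF \<psi>(2)] C C' by blast
    qed
  next
    fix y assume "y \<in> (\<lambda>(k, C). \<psi> C \<otimes>\<^bsub>H\<^esub> r k) ` (UNIV \<times> carrier (G Mod ?N))"
    then show "y \<in> carrier H" using r(1) subsetD[OF hH \<psi>h] by auto
  next
    fix y assume y: "y \<in> carrier H"
    then have "h ` carrier G #>\<^bsub>H\<^esub> y \<in> ?Q" by (auto simp: Q)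
    then obtain k where "q k = h ` carrier G #>\<^bsub>H\<^esub> y"
      using bij_betw_imp_surj_on[OF q] by (metis imageE)
    then have "y \<in> h ` carrier G #>\<^bsub>H\<^esub> r k" using H.rcos_self[OF y sub] r(2) by simp
    then obtain x where x: "x \<in> carrier G" "y = h x \<otimes>\<^bsub>H\<^esub> r k" by (auto simp: r_coset_def)
    then have "y = (\<lambda>(k, C). \<psi> C \<otimes>\<^bsub>H\<^esub> r k) (k, ?N #> x)" by (simp add: \<psi>(1))
    then show "y \<in> (\<lambda>(k, C). \<psi> C \<otimes>\<^bsub>H\<^esub> r k) ` (UNIV \<times> carrier (G Mod ?N))"
      using x by (intro image_eqI) (auto simp: carrier_FactGroup)
  qed
  then show ?thesis using that r(1) by blast
qed

text \<open>In the coordinates (k, C), left translation by h g leaves the orbit index k alone and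
  translates C in the quotient, which is the quasi-regular action in each copy.\<close>

theorem (in group_hom) regular_rep_inf_copies:
  assumes inf: "infinite (rcosets\<^bsub>H\<^esub> (h ` carrier G))" and cnt: "countable (carrier H)"
  obtains W where
    "unitary_between (ell2 (carrier H)) (inf_copies (ell2 (lcosets (kernel G H h)))) W"
    "\<And>g f. \<lbrakk>g \<in> carrier G; f \<in> carrier (ell2 (carrier H))\<rbrakk> \<Longrightarrow>
       inf_copies_rep (ell2 (lcosets (kernel G H h))) (quasi_regular_rep G (kernel G H h)) g (W f)
       = W (regular_rep H (h g) f)"
proof -
  let ?N = "kernel G H h"
  interpret N: normal ?N G by (rule normal_kernel)
  interpret K: group "G Mod ?N" by (rule N.factorgroup_is_group)
  obtain \<psi> where \<psi>: "\<psi> \<in> hom (G Mod ?N) H" "\<And>x. x \<in> carrier G \<Longrightarrow> \<psi> (?N #> x) = h x"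
    "inj_on \<psi> (carrier (G Mod ?N))"
    using FactGroup_embedding by blast
  interpret \<psi>: group_hom "G Mod ?N" H \<psi>
    using \<psi>(1) by (simp add: group_hom_def group_hom_axioms_def K.is_group)
  obtain r :: "nat \<Rightarrow> 'c" where r: "\<And>k. r k \<in> carrier H"
    and b: "bij_betw (\<lambda>(k, C). \<psi> C \<otimes>\<^bsub>H\<^esub> r k) (UNIV \<times> carrier (G Mod ?N)) (carrier H)"
    using orbit_bijection[OF inf cnt \<psi>(2,3)] by blast
  define b' where "b' = (\<lambda>(k, C). \<psi> C \<otimes>\<^bsub>H\<^esub> r k)"
  define W where "W f k C = (if (k, C) \<in> UNIV \<times> carrier (G Mod ?N) then f (b' (k, C)) else 0)"
    for f :: "'c \<Rightarrow> complex" and k :: nat and C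
  have W: "unitary_between (ell2 (carrier H)) (inf_copies (ell2 (carrier (G Mod ?N)))) W"
    using unitary_between_comp[OF unitary_between_reindex[OF b[folded b'_def]] unitary_ell2_inf_copies]
    by (simp add: W_def[abs_def])
  have "inf_copies_rep (ell2 (lcosets ?N)) (quasi_regular_rep G ?N) g (W f) = W (regular_rep H (h g) f)"
    if g: "g \<in> carrier G" and f: "f \<in> carrier (ell2 (carrier H))" for g f
  proof -
    have Wf: "W f \<in> carrier (inf_copies (ell2 (carrier (G Mod ?N))))"
      by (rule unitary_betweenD(2)[OF W f])
    then have Wfk: "W f k \<in> carrier (ell2 (carrier (G Mod ?N)))" for k by (simp add: inf_copies_def)
    have gK: "?N #> g \<in> carrier (G Mod ?N)" using g by (auto simp: carrier_FactGroup)
    have "regular_rep (G Mod ?N) (?N #> g) (W f k) C = W (regular_rep H (h g) f) k C" for k C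
    proof (cases "C \<in> carrier (G Mod ?N)")
      case True
      let ?D = "inv\<^bsub>G Mod ?N\<^esub> (?N #> g) \<otimes>\<^bsub>G Mod ?N\<^esub> C"
      have D: "?D \<in> carrier (G Mod ?N)" using True gK by (intro K.m_closed K.inv_closed)
      have "b' (k, ?D) = inv\<^bsub>H\<^esub> (h g) \<otimes>\<^bsub>H\<^esub> b' (k, C)"
        unfolding b'_def
        using \<psi>.hom_mult[OF K.inv_closed[OF gK] True] \<psi>.hom_inv[OF gK] \<psi>(2)[OF g] \<psi>.hom_closed[OF True] r[of k] g
        by (simp add: H.m_assoc del: \<psi>.hom_mult mult_FactGroup)
      moreover have "b' (k, C) \<in> carrier H" using \<psi>.hom_closed[OF True] r[of k] by (simp add: b'_def)
      ultimately show ?thesis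
        unfolding K.regular_apply[OF Wfk True] using D True f g by (simp add: W_def H.regular_apply)
    qed (simp add: regular_rep_def W_def Wfk)
    then show ?thesis
      using Wf by (auto simp: inf_copies_rep_def N.lcosets_eq N.quasi_regular_eq[OF g] fun_eq_iff)
  qed
  then show ?thesis using that[of W] W by (simp add: N.lcosets_eq)
qed

theorem proposition3p5:
  fixes n m :: nat
    and \<phi> :: "letter list \<Rightarrow> letter list \<times> letter list"
    and G :: "letter list set"
    and T :: "'t hilbert"
    and t :: "(letter list \<Rightarrow> complex) \<Rightarrow> (letter list \<Rightarrow> complex) \<Rightarrow> 't"
  assumes "n \<ge> 1" and "m \<ge> 1"
    and "\<phi> \<in> hom (free_group (n * m)) (free_group n \<times>\<times> free_group m)"
    and "\<And>i j. i \<in> {1..n} \<Longrightarrow> j \<in> {1..m}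
           \<Longrightarrow> \<phi> (free_gen (m * (i - 1) + j)) = (free_gen i, free_gen j)"
    and "G = kernel (free_group (n * m)) (free_group n \<times>\<times> free_group m) \<phi>"
  shows "(hilbert_tensor (ell2 (carrier (free_group n))) (ell2 (carrier (free_group m))) T t
        \<longrightarrow> unitarily_equivalent (free_group (n * m))
              T
              (tensor_rep (ell2 (carrier (free_group n))) (ell2 (carrier (free_group m))) T t \<phi>
                 (regular_rep (free_group n)) (regular_rep (free_group m)))
              (inf_copies (ell2 (lcosets\<^bsub>free_group (n * m)\<^esub> G)))
              (inf_copies_rep (ell2 (lcosets\<^bsub>free_group (n * m)\<^esub> G))
                 (quasi_regular_rep (free_group (n * m)) G)))
    \<and> (n \<ge> 2 \<and> m \<ge> 2
        \<longrightarrow> type_II1_factor_rep (free_group (n * m))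
              (ell2 (lcosets\<^bsub>free_group (n * m)\<^esub> G)) (quasi_regular_rep (free_group (n * m)) G))"
proof (intro conjI impI)
  assume "n \<ge> 2 \<and> m \<ge> 2"
  then show "type_II1_factor_rep (free_group (n * m))
      (ell2 (lcosets\<^bsub>free_group (n * m)\<^esub> G)) (quasi_regular_rep (free_group (n * m)) G)"
    using quasi_regular_phi_II1_factor[OF _ _ assms(3-5)] by blast
next
  assume T: "hilbert_tensor (ell2 (carrier (free_group n))) (ell2 (carrier (free_group m))) T t"
  let ?F = "free_group (n * m)" and ?P = "free_group n \<times>\<times> free_group m"
  let ?\<tau> = "tensor_rep (ell2 (carrier (free_group n))) (ell2 (carrier (free_group m))) T t \<phi>
                 (regular_rep (free_group n)) (regular_rep (free_group m))"
  let ?\<rho> = "inf_copies_rep (ell2 (lcosets\<^bsub>?F\<^esub> G)) (quasi_regular_rep ?F G)"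
  have gF: "group ?F" and gP: "group ?P" by (intro DirProd_group group_free_group)+
  interpret P: group ?P by (rule gP)
  interpret group_hom ?F ?P \<phi>
    using assms(3) gF gP by (simp add: group_hom_def group_hom_axioms_def)
  have rep: "unitary_rep ?F (ell2 (carrier ?P)) (\<lambda>g. regular_rep ?P (\<phi> g))"
    by (rule unitary_rep_comp_hom[OF P.unitary_rep_regular assms(3) gF]) simp
  obtain V where V: "unitary_between (ell2 (carrier ?P)) T V"
    and Vext: "\<And>g h. \<lbrakk>g \<in> carrier (free_group n); h \<in> carrier (free_group m)\<rbrakk> \<Longrightarrow>
       tensor_op (ell2 (carrier (free_group n))) (ell2 (carrier (free_group m))) T t
         (regular_rep (free_group n) g) (regular_rep (free_group m) h) \<in> extensional (carrier T)"
    and Veq: "\<And>g h f. \<lbrakk>g \<in> carrier (free_group n); h \<in> carrier (free_group m); f \<in> carrier (ell2 (carrier ?P))\<rbrakk> \<Longrightarrow>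
       tensor_op (ell2 (carrier (free_group n))) (ell2 (carrier (free_group m))) T t
         (regular_rep (free_group n) g) (regular_rep (free_group m) h) (V f)
       = V (regular_rep ?P (g, h) f)"
    using tensor_regular_rep[OF group_free_group group_free_group T] by blast
  have \<phi>g: "fst (\<phi> g) \<in> carrier (free_group n)" "snd (\<phi> g) \<in> carrier (free_group m)" if "g \<in> carrier ?F" for g
    using hom_closed[OF that] by auto
  have eqV: "?\<tau> g (V f) = V (regular_rep ?P (\<phi> g) f)" if "g \<in> carrier ?F" "f \<in> carrier (ell2 (carrier ?P))" for g f
    using Veq[OF \<phi>g[OF that(1)] that(2)] by (simp add: tensor_rep_def)
  have repT: "unitary_rep ?F T ?\<tau>"
  proof (rule unitary_rep_transfer[where \<rho> = ?\<tau>, OF rep V hilbert_tensorD(1)[OF T]])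
    show "?\<tau> g \<in> extensional (carrier T)" if "g \<in> carrier ?F" for g
      unfolding tensor_rep_def by (rule Vext[OF \<phi>g[OF that]])
  qed (rule eqV)
  obtain W where W: "unitary_between (ell2 (carrier ?P)) (inf_copies (ell2 (lcosets\<^bsub>?F\<^esub> G))) W"
    and eqW: "\<And>g f. \<lbrakk>g \<in> carrier ?F; f \<in> carrier (ell2 (carrier ?P))\<rbrakk> \<Longrightarrow> ?\<rho> g (W f) = W (regular_rep ?P (\<phi> g) f)"
    unfolding assms(5)
    \<comment> \<open>Words over letters form a countable type; together with infinite index this
      lets the naturals enumerate the cosets, one per copy.\<close>
    by (rule regular_rep_inf_copies[OF phi_infinite_index[OF assms(1,3,4)] countableI_type]) blast+
  have repI: "unitary_rep ?F (inf_copies (ell2 (lcosets\<^bsub>?F\<^esub> G))) ?\<rho>"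
  proof (rule unitary_rep_transfer[where \<rho> = ?\<rho>, OF rep W hilbert_space_inf_copies_ell2])
    show "?\<rho> g \<in> extensional (carrier (inf_copies (ell2 (lcosets\<^bsub>?F\<^esub> G))))" for g
      by (simp add: inf_copies_rep_def)
  qed (rule eqW)
  show "unitarily_equivalent ?F T ?\<tau> (inf_copies (ell2 (lcosets\<^bsub>?F\<^esub> G))) ?\<rho>"
    by (rule unitarily_equivalent_via[where \<rho> = ?\<tau> and \<sigma> = ?\<rho>, OF rep repT V _ repI W]) (fact eqV, fact eqW)
qed

end
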